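(* Let $A$ be a vector space, $\Phi:A\otimes A\longrightarrow A\otimes A$ a linear map, $V$ a vector space and $*:A\longrightarrow\mathrm{Hom}(V\otimes V,V)$, $a\mapsto *_a$, a linear map. Define a product $\star$ on $V\otimes A$ by: for all $x,y\in V$, $a,b\in A$, $$xa\star yb=\sum(x*_{a''\triangleright b''}y)\,(a'\rightarrow b').$$ Then: 1. If $(A,\Phi)$ is an $\ell$EAS and $(V,* )$ is a $\Phi$-associative algebra, then $(V\otimes A,\star)$ is an associative algebra. 2. If $(A,\Phi)$ is a nondegenerate $\ell$EAS and $(V\otimes A,\star)$ is an associative algebra, then $(V,* )$ is a $\Phi$-associative algebra. 3. Let $V$ be a nonzero vector space, and let $T_A(V)$ be endowed with the products $*_a$ described in the context. If $(T_A(V)\otimes A,\star)$ is an associative algebra, then $(A,\Phi)$ is an $\ell$EAS.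
   Context: All vector spaces are over a field $\mathbb{K}$; associative algebras are not assumed unital; $xa$ denotes $x\otimes a$. Sweedler-like notation: $\Phi(a\otimes b)=\sum a'\rightarrow b'\otimes a''\triangleright b''$ (purely symbolic). $(A,\Phi)$ is an $\ell$EAS if $(\mathrm{Id}\otimes\Phi)\circ(\Phi\otimes\mathrm{Id})\circ(\mathrm{Id}\otimes\Phi)=(\Phi\otimes\mathrm{Id})\circ(\mathrm{Id}\otimes\tau)\circ(\Phi\otimes\mathrm{Id})$ on $A^{\otimes 3}$, where $\tau(a\otimes b)=b\otimes a$; it is nondegenerate if $\Phi$ is invertible. $(V,* )$ is a $\Phi$-associative algebra if $x*_a(y*_bz)=\sum(x*_{a''\triangleright b''}y)*_{a'\rightarrow b'}z$ for all $x,y,z\in V$, $a,b\in A$. $T_A(V)=\bigoplus_{n\geqslant 1}A^{\otimes(n-1)}\otimes V^{\otimes n}$, with tensors written $a_1\ldots a_{n-1}x_1\ldots x_n$ (a word of length $n$); $\cdot:T_A(V)\otimes A\otimes V\to T_A(V)$ is given by $a_1\ldots a_{n-1}x_1\ldots x_n\cdot ax=a_1\ldots a_{n-1}a\,x_1\ldots x_nx$; the products $*_a$ on $T_A(V)$ are defined by induction on the length of the right factor by $w*_az=w\cdot az$ and $u*_a(v\cdot bz)=\sum(u*_{a''\triangleright b''}v)\cdot(a'\rightarrow b')z$ for $u,v,w\in T_A(V)$, $z\in V$, $a,b\in A$. *)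

theory Defs
  imports "HOL-Algebra.Module" "HOL-Algebra.AbelCoset"
begin

text \<open>Vector spaces over a field \<open>K\<close> are modules over \<open>K\<close> in the sense of HOL-Algebra.  Records of
  type \<open>module\<close> also carry the ring fields \<open>mult\<close> and \<open>one\<close>, which mean nothing for a vector space
  and are left \<open>undefined\<close> in the constructions below.\<close>

section \<open>Linear maps\<close>

definition linear_map ::
  "'k ring \<Rightarrow> ('k, 'v) module \<Rightarrow> ('k, 'w) module \<Rightarrow> ('v \<Rightarrow> 'w) \<Rightarrow> bool" where
  "linear_map K V W f \<longleftrightarrow>
     f \<in> carrier V \<rightarrow> carrier W \<and>
     (\<forall>x\<in>carrier V. \<forall>y\<in>carrier V. f (x \<oplus>\<^bsub>V\<^esub> y) = f x \<oplus>\<^bsub>W\<^esub> f y) \<and>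
     (\<forall>c\<in>carrier K. \<forall>x\<in>carrier V. f (c \<odot>\<^bsub>V\<^esub> x) = c \<odot>\<^bsub>W\<^esub> f x)"

definition Hom_space ::
  "'k ring \<Rightarrow> ('k, 'v) module \<Rightarrow> ('k, 'w) module \<Rightarrow> ('k, 'v \<Rightarrow> 'w) module" where
  "Hom_space K V W =
     \<lparr>carrier = {f \<in> extensional (carrier V). linear_map K V W f},
      mult = undefined, one = undefined,
      zero = (\<lambda>x\<in>carrier V. \<zero>\<^bsub>W\<^esub>),
      add = (\<lambda>f g. \<lambda>x\<in>carrier V. f x \<oplus>\<^bsub>W\<^esub> g x),
      smult = (\<lambda>c f. \<lambda>x\<in>carrier V. c \<odot>\<^bsub>W\<^esub> f x)\<rparr>"

definition bilinear_map ::
  "'k ring \<Rightarrow> ('k, 'u) module \<Rightarrow> ('k, 'v) module \<Rightarrow> ('k, 'w) module \<Rightarrow>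
   ('u \<Rightarrow> 'v \<Rightarrow> 'w) \<Rightarrow> bool" where
  "bilinear_map K U V W \<beta> \<longleftrightarrow>
     (\<forall>u\<in>carrier U. linear_map K V W (\<beta> u)) \<and>
     (\<forall>v\<in>carrier V. linear_map K U W (\<lambda>u. \<beta> u v))"

text \<open>Associative algebras are not required to be unital or commutative (unlike the locale
  \<open>algebra\<close> of HOL-Algebra).\<close>

definition assoc_algebra ::
  "'k ring \<Rightarrow> ('k, 'v) module \<Rightarrow> ('v \<Rightarrow> 'v \<Rightarrow> 'v) \<Rightarrow> bool" where
  "assoc_algebra K V m \<longleftrightarrow>
     module K V \<and> bilinear_map K V V V m \<and>
     (\<forall>x\<in>carrier V. \<forall>y\<in>carrier V. \<forall>z\<in>carrier V. m (m x y) z = m x (m y z))"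


section \<open>Spaces given by generators and relations\<close>

definition free_space :: "'k ring \<Rightarrow> 'x set \<Rightarrow> ('k, 'x \<Rightarrow> 'k) module" where
  "free_space K X =
     \<lparr>carrier = {f. (\<forall>x. f x \<in> carrier K) \<and> (\<forall>x. x \<notin> X \<longrightarrow> f x = \<zero>\<^bsub>K\<^esub>) \<and>
                    finite {x. f x \<noteq> \<zero>\<^bsub>K\<^esub>}},
      mult = undefined, one = undefined,
      zero = (\<lambda>x. \<zero>\<^bsub>K\<^esub>),
      add = (\<lambda>f g x. f x \<oplus>\<^bsub>K\<^esub> g x),
      smult = (\<lambda>c f x. c \<otimes>\<^bsub>K\<^esub> f x)\<rparr>"

definition free_gen :: "'k ring \<Rightarrow> 'x \<Rightarrow> 'x \<Rightarrow> 'k" where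
  "free_gen K x = (\<lambda>y. if y = x then \<one>\<^bsub>K\<^esub> else \<zero>\<^bsub>K\<^esub>)"

definition lin_span :: "'k ring \<Rightarrow> ('k, 'v) module \<Rightarrow> 'v set \<Rightarrow> 'v set" where
  "lin_span K V S = \<Inter>{H. submodule H K V \<and> S \<subseteq> H}"

text \<open>In the scalar multiplication of a quotient, \<open>H\<close> has to be added because the image of a
  coset under multiplication by the zero scalar is not a coset.\<close>

definition quot_space :: "('k, 'v) module \<Rightarrow> 'v set \<Rightarrow> ('k, 'v set) module" where
  "quot_space V H =
     \<lparr>carrier = a_rcosets\<^bsub>V\<^esub> H,
      mult = undefined, one = undefined,
      zero = H,
      add = (\<lambda>X Y. X <+>\<^bsub>V\<^esub> Y),
      smult = (\<lambda>c X. H <+>\<^bsub>V\<^esub> ((\<lambda>x. c \<odot>\<^bsub>V\<^esub> x) ` X))\<rparr>"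

definition presented_space ::
  "'k ring \<Rightarrow> 'x set \<Rightarrow> ('x \<Rightarrow> 'k) set \<Rightarrow> ('k, ('x \<Rightarrow> 'k) set) module" where
  "presented_space K X R = quot_space (free_space K X) (lin_span K (free_space K X) R)"

definition presented_gen ::
  "'k ring \<Rightarrow> 'x set \<Rightarrow> ('x \<Rightarrow> 'k) set \<Rightarrow> 'x \<Rightarrow> ('x \<Rightarrow> 'k) set" where
  "presented_gen K X R x = lin_span K (free_space K X) R +>\<^bsub>free_space K X\<^esub> free_gen K x"

text \<open>The linear map into \<open>Z\<close>, defined on a presented space, that maps each generator \<open>x\<close> to \<open>\<beta> x\<close>:
  it is evaluated on a representative \<open>f\<close> of the class \<open>t\<close>, the choice of which does not matter when
  \<open>\<beta>\<close> respects the relations.\<close>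

definition presented_lift ::
  "'k ring \<Rightarrow> ('k, 'z) module \<Rightarrow> ('x \<Rightarrow> 'z) \<Rightarrow> ('x \<Rightarrow> 'k) set \<Rightarrow> 'z" where
  "presented_lift K Z \<beta> t =
     (let f = (SOME f. f \<in> t) in \<Oplus>\<^bsub>Z\<^esub>x\<in>{x. f x \<noteq> \<zero>\<^bsub>K\<^esub>}. f x \<odot>\<^bsub>Z\<^esub> \<beta> x)"


section \<open>Tensor products\<close>

type_synonym ('k, 'v, 'w) tensor = "('v \<times> 'w \<Rightarrow> 'k) set"

definition bilinear_rels ::
  "'k ring \<Rightarrow> ('k, 'v) module \<Rightarrow> ('k, 'w) module \<Rightarrow> ('v \<times> 'w \<Rightarrow> 'k) set" where
  "bilinear_rels K V W =
     (let F = free_space K (carrier V \<times> carrier W); e = (\<lambda>v w. free_gen K (v, w)) in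
       {e (v \<oplus>\<^bsub>V\<^esub> v') w \<ominus>\<^bsub>F\<^esub> (e v w \<oplus>\<^bsub>F\<^esub> e v' w) | v v' w.
          v \<in> carrier V \<and> v' \<in> carrier V \<and> w \<in> carrier W} \<union>
       {e v (w \<oplus>\<^bsub>W\<^esub> w') \<ominus>\<^bsub>F\<^esub> (e v w \<oplus>\<^bsub>F\<^esub> e v w') | v w w'.
          v \<in> carrier V \<and> w \<in> carrier W \<and> w' \<in> carrier W} \<union>
       {e (c \<odot>\<^bsub>V\<^esub> v) w \<ominus>\<^bsub>F\<^esub> (c \<odot>\<^bsub>F\<^esub> e v w) | c v w.
          c \<in> carrier K \<and> v \<in> carrier V \<and> w \<in> carrier W} \<union>
       {e v (c \<odot>\<^bsub>W\<^esub> w) \<ominus>\<^bsub>F\<^esub> (c \<odot>\<^bsub>F\<^esub> e v w) | c v w.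
          c \<in> carrier K \<and> v \<in> carrier V \<and> w \<in> carrier W})"

definition tensor_space ::
  "'k ring \<Rightarrow> ('k, 'v) module \<Rightarrow> ('k, 'w) module \<Rightarrow> ('k, ('k, 'v, 'w) tensor) module" where
  "tensor_space K V W = presented_space K (carrier V \<times> carrier W) (bilinear_rels K V W)"

definition pure_tensor ::
  "'k ring \<Rightarrow> ('k, 'v) module \<Rightarrow> ('k, 'w) module \<Rightarrow> 'v \<Rightarrow> 'w \<Rightarrow> ('k, 'v, 'w) tensor" where
  "pure_tensor K V W v w =
     presented_gen K (carrier V \<times> carrier W) (bilinear_rels K V W) (v, w)"

text \<open>For bilinear \<open>\<beta>\<close>, the linear map on a tensor product with \<open>v \<otimes> w \<mapsto> \<beta> v w\<close>.  In particular,
  Sweedler-like notation such as \<open>\<Sum> \<beta> (a' \<rightarrow> b') (a'' \<triangleright> b'')\<close> stands for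
  \<open>tensor_lift K Z \<beta> (\<Phi> (a \<otimes> b))\<close>.\<close>

definition tensor_lift ::
  "'k ring \<Rightarrow> ('k, 'z) module \<Rightarrow> ('v \<Rightarrow> 'w \<Rightarrow> 'z) \<Rightarrow> ('k, 'v, 'w) tensor \<Rightarrow> 'z" where
  "tensor_lift K Z \<beta> t = presented_lift K Z (\<lambda>(v, w). \<beta> v w) t"

definition tensor_map ::
  "'k ring \<Rightarrow> ('k, 'v2) module \<Rightarrow> ('k, 'w2) module \<Rightarrow> ('v1 \<Rightarrow> 'v2) \<Rightarrow> ('w1 \<Rightarrow> 'w2) \<Rightarrow>
   ('k, 'v1, 'w1) tensor \<Rightarrow> ('k, 'v2, 'w2) tensor" where
  "tensor_map K V2 W2 f g =
     tensor_lift K (tensor_space K V2 W2) (\<lambda>v w. pure_tensor K V2 W2 (f v) (g w))"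

definition tensor_flip ::
  "'k ring \<Rightarrow> ('k, 'v) module \<Rightarrow> ('k, 'w) module \<Rightarrow> ('k, 'v, 'w) tensor \<Rightarrow> ('k, 'w, 'v) tensor" where
  "tensor_flip K V W = tensor_lift K (tensor_space K W V) (\<lambda>v w. pure_tensor K W V w v)"

definition tensor_assoc ::
  "'k ring \<Rightarrow> ('k, 'u) module \<Rightarrow> ('k, 'v) module \<Rightarrow> ('k, 'w) module \<Rightarrow>
   ('k, ('k, 'u, 'v) tensor, 'w) tensor \<Rightarrow> ('k, 'u, ('k, 'v, 'w) tensor) tensor" where
  "tensor_assoc K U V W =
     (let Z = tensor_space K U (tensor_space K V W) in
       tensor_lift K Z (\<lambda>s w. tensor_lift K Z
         (\<lambda>u v. pure_tensor K U (tensor_space K V W) u (pure_tensor K V W v w)) s))"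

definition tensor_assoc_inv ::
  "'k ring \<Rightarrow> ('k, 'u) module \<Rightarrow> ('k, 'v) module \<Rightarrow> ('k, 'w) module \<Rightarrow>
   ('k, 'u, ('k, 'v, 'w) tensor) tensor \<Rightarrow> ('k, ('k, 'u, 'v) tensor, 'w) tensor" where
  "tensor_assoc_inv K U V W =
     (let Z = tensor_space K (tensor_space K U V) W in
       tensor_lift K Z (\<lambda>u s. tensor_lift K Z
         (\<lambda>v w. pure_tensor K (tensor_space K U V) W (pure_tensor K U V u v) w) s))"


section \<open>\<open>\<ell>\<close>EAS and \<open>\<Phi>\<close>-associative algebras\<close>

text \<open>\<open>A \<otimes> A \<otimes> A\<close> is bracketed to the right; \<open>\<Phi> \<otimes> Id\<close> is transported along the associativity
  isomorphism.\<close>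

definition id_tensor ::
  "'k ring \<Rightarrow> ('k, 'a) module \<Rightarrow> (('k, 'a, 'a) tensor \<Rightarrow> ('k, 'a, 'a) tensor) \<Rightarrow>
   ('k, 'a, ('k, 'a, 'a) tensor) tensor \<Rightarrow> ('k, 'a, ('k, 'a, 'a) tensor) tensor" where
  "id_tensor K A \<Phi> = tensor_map K A (tensor_space K A A) id \<Phi>"

definition tensor_id ::
  "'k ring \<Rightarrow> ('k, 'a) module \<Rightarrow> (('k, 'a, 'a) tensor \<Rightarrow> ('k, 'a, 'a) tensor) \<Rightarrow>
   ('k, 'a, ('k, 'a, 'a) tensor) tensor \<Rightarrow> ('k, 'a, ('k, 'a, 'a) tensor) tensor" where
  "tensor_id K A \<Phi> =
     tensor_assoc K A A A \<circ> tensor_map K (tensor_space K A A) A \<Phi> id \<circ> tensor_assoc_inv K A A A"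

definition lEAS ::
  "'k ring \<Rightarrow> ('k, 'a) module \<Rightarrow> (('k, 'a, 'a) tensor \<Rightarrow> ('k, 'a, 'a) tensor) \<Rightarrow> bool" where
  "lEAS K A \<Phi> \<longleftrightarrow>
     module K A \<and> linear_map K (tensor_space K A A) (tensor_space K A A) \<Phi> \<and>
     (\<forall>t\<in>carrier (tensor_space K A (tensor_space K A A)).
        (id_tensor K A \<Phi> \<circ> tensor_id K A \<Phi> \<circ> id_tensor K A \<Phi>) t =
        (tensor_id K A \<Phi> \<circ> id_tensor K A (tensor_flip K A A) \<circ> tensor_id K A \<Phi>) t)"

definition nondegenerate_lEAS ::
  "'k ring \<Rightarrow> ('k, 'a) module \<Rightarrow> (('k, 'a, 'a) tensor \<Rightarrow> ('k, 'a, 'a) tensor) \<Rightarrow> bool" where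
  "nondegenerate_lEAS K A \<Phi> \<longleftrightarrow>
     lEAS K A \<Phi> \<and>
     bij_betw \<Phi> (carrier (tensor_space K A A)) (carrier (tensor_space K A A))"

text \<open>A family of products is a linear map \<open>m\<close> from \<open>A\<close> to \<open>Hom (V \<otimes> V, V)\<close>; this is \<open>x *\<^sub>a y\<close>.\<close>

definition prod_at ::
  "'k ring \<Rightarrow> ('k, 'v) module \<Rightarrow> ('a \<Rightarrow> ('k, 'v, 'v) tensor \<Rightarrow> 'v) \<Rightarrow> 'a \<Rightarrow> 'v \<Rightarrow> 'v \<Rightarrow> 'v" where
  "prod_at K V m a x y = m a (pure_tensor K V V x y)"

definition phi_assoc_algebra ::
  "'k ring \<Rightarrow> ('k, 'a) module \<Rightarrow> (('k, 'a, 'a) tensor \<Rightarrow> ('k, 'a, 'a) tensor) \<Rightarrow>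
   ('k, 'v) module \<Rightarrow> ('a \<Rightarrow> ('k, 'v, 'v) tensor \<Rightarrow> 'v) \<Rightarrow> bool" where
  "phi_assoc_algebra K A \<Phi> V m \<longleftrightarrow>
     module K V \<and> linear_map K A (Hom_space K (tensor_space K V V) V) m \<and>
     (\<forall>x\<in>carrier V. \<forall>y\<in>carrier V. \<forall>z\<in>carrier V. \<forall>a\<in>carrier A. \<forall>b\<in>carrier A.
        prod_at K V m a x (prod_at K V m b y z) =
        tensor_lift K V (\<lambda>p q. prod_at K V m p (prod_at K V m q x y) z)
          (\<Phi> (pure_tensor K A A a b)))"

text \<open>The product on \<open>V \<otimes> A\<close>: the bilinear extension of
  \<open>(x \<otimes> a, y \<otimes> b) \<mapsto> \<Sum> (x *\<^bsub>a'' \<triangleright> b''\<^esub> y) \<otimes> (a' \<rightarrow> b')\<close>.\<close>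

definition star_prod ::
  "'k ring \<Rightarrow> ('k, 'a) module \<Rightarrow> (('k, 'a, 'a) tensor \<Rightarrow> ('k, 'a, 'a) tensor) \<Rightarrow>
   ('k, 'v) module \<Rightarrow> ('a \<Rightarrow> ('k, 'v, 'v) tensor \<Rightarrow> 'v) \<Rightarrow>
   ('k, 'v, 'a) tensor \<Rightarrow> ('k, 'v, 'a) tensor \<Rightarrow> ('k, 'v, 'a) tensor" where
  "star_prod K A \<Phi> V m s t =
     (let VA = tensor_space K V A in
       tensor_lift K VA (\<lambda>x a. tensor_lift K VA (\<lambda>y b.
         tensor_lift K VA (\<lambda>p q. pure_tensor K V A (prod_at K V m q x y) p)
           (\<Phi> (pure_tensor K A A a b))) t) s)"


section \<open>Tensor powers and direct sums\<close>

definition pow_words :: "('k, 'v) module \<Rightarrow> nat \<Rightarrow> 'v list set" where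
  "pow_words V n = {xs. length xs = n \<and> set xs \<subseteq> carrier V}"

definition multilinear_rels ::
  "'k ring \<Rightarrow> ('k, 'v) module \<Rightarrow> nat \<Rightarrow> ('v list \<Rightarrow> 'k) set" where
  "multilinear_rels K V n =
     (let F = free_space K (pow_words V n); e = free_gen K in
       {e (xs[i := v \<oplus>\<^bsub>V\<^esub> v']) \<ominus>\<^bsub>F\<^esub> (e (xs[i := v]) \<oplus>\<^bsub>F\<^esub> e (xs[i := v'])) | xs i v v'.
          xs \<in> pow_words V n \<and> i < n \<and> v \<in> carrier V \<and> v' \<in> carrier V} \<union>
       {e (xs[i := c \<odot>\<^bsub>V\<^esub> v]) \<ominus>\<^bsub>F\<^esub> (c \<odot>\<^bsub>F\<^esub> e (xs[i := v])) | xs i c v.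
          xs \<in> pow_words V n \<and> i < n \<and> c \<in> carrier K \<and> v \<in> carrier V})"

text \<open>The elements of all tensor powers of \<open>V\<close> have the same type.  The power with exponent \<open>0\<close> is
  one-dimensional, spanned by the empty word.\<close>

definition tensor_pow ::
  "'k ring \<Rightarrow> ('k, 'v) module \<Rightarrow> nat \<Rightarrow> ('k, ('v list \<Rightarrow> 'k) set) module" where
  "tensor_pow K V n = presented_space K (pow_words V n) (multilinear_rels K V n)"

definition pure_pow :: "'k ring \<Rightarrow> ('k, 'v) module \<Rightarrow> 'v list \<Rightarrow> ('v list \<Rightarrow> 'k) set" where
  "pure_pow K V xs =
     presented_gen K (pow_words V (length xs)) (multilinear_rels K V (length xs)) xs"

text \<open>The map \<open>V\<^sup>\<otimes>\<^sup>n \<rightarrow> V\<^sup>\<otimes>\<^sup>n\<^sup>+\<^sup>1\<close>, \<open>x\<^sub>1\<dots>x\<^sub>n \<mapsto> x\<^sub>1\<dots>x\<^sub>nx\<close>.\<close>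

definition pow_snoc ::
  "'k ring \<Rightarrow> ('k, 'v) module \<Rightarrow> nat \<Rightarrow> ('v list \<Rightarrow> 'k) set \<Rightarrow> 'v \<Rightarrow> ('v list \<Rightarrow> 'k) set" where
  "pow_snoc K V n \<xi> x =
     presented_lift K (tensor_pow K V (Suc n)) (\<lambda>xs. pure_pow K V (xs @ [x])) \<xi>"

definition direct_sum :: "'i set \<Rightarrow> ('i \<Rightarrow> ('k, 'v) module) \<Rightarrow> ('k, 'i \<Rightarrow> 'v) module" where
  "direct_sum I M =
     \<lparr>carrier = {t \<in> (\<Pi>\<^sub>E n\<in>I. carrier (M n)). finite {n \<in> I. t n \<noteq> \<zero>\<^bsub>M n\<^esub>}},
      mult = undefined, one = undefined,
      zero = (\<lambda>n\<in>I. \<zero>\<^bsub>M n\<^esub>),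
      add = (\<lambda>s t. \<lambda>n\<in>I. s n \<oplus>\<^bsub>M n\<^esub> t n),
      smult = (\<lambda>c t. \<lambda>n\<in>I. c \<odot>\<^bsub>M n\<^esub> t n)\<rparr>"


section \<open>The space \<open>T\<^sub>A(V)\<close> and its products\<close>

type_synonym ('k, 'a, 'v) TA =
  "nat \<Rightarrow> ('k, ('a list \<Rightarrow> 'k) set, ('v list \<Rightarrow> 'k) set) tensor"

definition TA_component ::
  "'k ring \<Rightarrow> ('k, 'a) module \<Rightarrow> ('k, 'v) module \<Rightarrow> nat \<Rightarrow>
   ('k, ('k, ('a list \<Rightarrow> 'k) set, ('v list \<Rightarrow> 'k) set) tensor) module" where
  "TA_component K A V n = tensor_space K (tensor_pow K A (n - 1)) (tensor_pow K V n)"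

definition TA_space ::
  "'k ring \<Rightarrow> ('k, 'a) module \<Rightarrow> ('k, 'v) module \<Rightarrow> ('k, ('k, 'a, 'v) TA) module" where
  "TA_space K A V = direct_sum {1..} (TA_component K A V)"

text \<open>\<open>a\<^sub>1\<dots>a\<^bsub>n-1\<^esub>x\<^sub>1\<dots>x\<^sub>n \<cdot> ax = a\<^sub>1\<dots>a\<^bsub>n-1\<^esub>a x\<^sub>1\<dots>x\<^sub>nx\<close>: the component of degree \<open>n + 1\<close> of the result
  comes from the component of degree \<open>n\<close> of \<open>u\<close>.\<close>

definition TA_dot ::
  "'k ring \<Rightarrow> ('k, 'a) module \<Rightarrow> ('k, 'v) module \<Rightarrow>
   ('k, 'a, 'v) TA \<Rightarrow> 'a \<Rightarrow> 'v \<Rightarrow> ('k, 'a, 'v) TA" where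
  "TA_dot K A V u a x = (\<lambda>n\<in>{1..}.
     if n = 1 then \<zero>\<^bsub>TA_component K A V 1\<^esub>
     else tensor_lift K (TA_component K A V n)
       (\<lambda>\<alpha> \<xi>. pure_tensor K (tensor_pow K A (n - 1)) (tensor_pow K V n)
          (pow_snoc K A (n - 2) \<alpha> a) (pow_snoc K V (n - 1) \<xi> x))
       (u (n - 1)))"

text \<open>The product \<open>u *\<^sub>a w\<close> for a word \<open>w\<close>, by recursion on the length of \<open>w\<close>: the letters of \<open>w\<close>
  are given in reverse order, so that \<open>bs = []\<close>, \<open>xs = [z]\<close> is the word \<open>z\<close> of length \<open>1\<close>, and
  \<open>b # bs\<close>, \<open>z # xs\<close> is the word \<open>v \<cdot> bz\<close> with \<open>v\<close> given by \<open>bs\<close>, \<open>xs\<close>.  Only the case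
  \<open>length xs = length bs + 1\<close> is meaningful.\<close>

fun TA_mult_word ::
  "'k ring \<Rightarrow> ('k, 'a) module \<Rightarrow> ('k, 'v) module \<Rightarrow>
   (('k, 'a, 'a) tensor \<Rightarrow> ('k, 'a, 'a) tensor) \<Rightarrow>
   'a \<Rightarrow> ('k, 'a, 'v) TA \<Rightarrow> 'a list \<Rightarrow> 'v list \<Rightarrow> ('k, 'a, 'v) TA" where
  "TA_mult_word K A V \<Phi> a u [] (z # xs) = TA_dot K A V u a z"
| "TA_mult_word K A V \<Phi> a u (b # bs) (z # xs) =
     tensor_lift K (TA_space K A V)
       (\<lambda>p q. TA_dot K A V (TA_mult_word K A V \<Phi> q u bs xs) p z)
       (\<Phi> (pure_tensor K A A a b))"
| "TA_mult_word K A V \<Phi> a u bs [] = \<zero>\<^bsub>TA_space K A V\<^esub>"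

definition TA_mult ::
  "'k ring \<Rightarrow> ('k, 'a) module \<Rightarrow> ('k, 'v) module \<Rightarrow>
   (('k, 'a, 'a) tensor \<Rightarrow> ('k, 'a, 'a) tensor) \<Rightarrow>
   'a \<Rightarrow> ('k, 'a, 'v) TA \<Rightarrow> ('k, 'a, 'v) TA \<Rightarrow> ('k, 'a, 'v) TA" where
  "TA_mult K A V \<Phi> a u w =
     (let T = TA_space K A V in
       \<Oplus>\<^bsub>T\<^esub>n\<in>{n \<in> {1..}. w n \<noteq> \<zero>\<^bsub>TA_component K A V n\<^esub>}.
         tensor_lift K T (\<lambda>\<alpha> \<xi>.
           presented_lift K T (\<lambda>as.
             presented_lift K T (\<lambda>xs. TA_mult_word K A V \<Phi> a u (rev as) (rev xs)) \<xi>) \<alpha>) (w n))"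

definition TA_prods ::
  "'k ring \<Rightarrow> ('k, 'a) module \<Rightarrow> ('k, 'v) module \<Rightarrow>
   (('k, 'a, 'a) tensor \<Rightarrow> ('k, 'a, 'a) tensor) \<Rightarrow>
   'a \<Rightarrow> ('k, ('k, 'a, 'v) TA, ('k, 'a, 'v) TA) tensor \<Rightarrow> ('k, 'a, 'v) TA" where
  "TA_prods K A V \<Phi> a =
     (\<lambda>t\<in>carrier (tensor_space K (TA_space K A V) (TA_space K A V)).
        tensor_lift K (TA_space K A V) (TA_mult K A V \<Phi> a) t)"

end

theory Submission
  imports Defs
begin

text \<open>For fixed \<open>x\<close>, \<open>y\<close>, \<open>z\<close>, let \<open>G\<close> and \<open>H\<close> be the linear maps from \<open>A \<otimes> A \<otimes> A\<close> to \<open>V \<otimes> A\<close> that send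
  \<open>r \<otimes> s \<otimes> q\<close> to \<open>((x *\<^sub>q y) *\<^sub>s z) \<otimes> r\<close> and to \<open>(x *\<^sub>s (y *\<^sub>q z)) \<otimes> r\<close>.  Then
  \<open>(xa \<star> yb) \<star> zc\<close> is the value of \<open>G \<circ> (\<Phi> \<otimes> Id) \<circ> (Id \<otimes> \<tau>) \<circ> (\<Phi> \<otimes> Id)\<close> at \<open>a \<otimes> b \<otimes> c\<close>, while
  \<open>xa \<star> (yb \<star> zc)\<close> is the value of \<open>H \<circ> (\<Phi> \<otimes> Id) \<circ> (Id \<otimes> \<Phi>)\<close>, and \<open>\<Phi>\<close>-associativity gives
  \<open>H = G \<circ> (Id \<otimes> \<Phi>)\<close>.  This yields the first claim.  For the second, \<open>(\<Phi> \<otimes> Id) \<circ> (Id \<otimes> \<Phi>)\<close> is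
  surjective, so \<open>H = G \<circ> (Id \<otimes> \<Phi>)\<close> follows, and a nonzero \<open>r\<close> can be cancelled from \<open>v \<otimes> r\<close> by means of
  a linear functional.  For the third, take \<open>x = y = z\<close> to be a nonzero letter \<open>w\<close>: then
  \<open>H = G \<circ> (Id \<otimes> \<Phi>)\<close> holds by construction of the products, and \<open>G\<close>, which maps \<open>r \<otimes> s \<otimes> q\<close> to the word
  \<open>q s w w w\<close> tensored with \<open>r\<close>, is injective.\<close>

section \<open>Linear maps\<close>

text \<open>A Sweedler sum has no preferred summands: \<Phi>(a \<otimes> b) is an arbitrary tensor,
  known only as a coset. Each such sum is therefore handled as the value of a linear lift, and an
  identity between sums as an identity between linear maps that is checked on pure tensors. This is
  why associativity is rephrased through maps on A \<otimes> A \<otimes> A that do not involve a, b,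
  c.

  The second and third claims meet complementary obstacles. Associativity relates H and G only after
  operators built from \<Phi> have been applied. If the lEAS identity is known, these operators have
  to be removed on the right, and a left-over tensor factor r beside the product. If the relation
  between H and G is known, the map G has to be removed on the left. Removing r and removing G both
  use a left inverse made from a linear functional with value one at a chosen nonzero vector; this
  is where division in K enters.\<close>

lemma linear_mapI:
  assumes "\<And>x. x \<in> carrier V \<Longrightarrow> f x \<in> carrier W"
    and "\<And>x y. x \<in> carrier V \<Longrightarrow> y \<in> carrier V \<Longrightarrow> f (x \<oplus>\<^bsub>V\<^esub> y) = f x \<oplus>\<^bsub>W\<^esub> f y"
    and "\<And>c x. c \<in> carrier K \<Longrightarrow> x \<in> carrier V \<Longrightarrow> f (c \<odot>\<^bsub>V\<^esub> x) = c \<odot>\<^bsub>W\<^esub> f x"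
  shows "linear_map K V W f"
  using assms by (auto simp: linear_map_def)

lemma linear_map_closed: "linear_map K V W f \<Longrightarrow> x \<in> carrier V \<Longrightarrow> f x \<in> carrier W"
  by (auto simp: linear_map_def)

lemma linear_map_add:
  "linear_map K V W f \<Longrightarrow> x \<in> carrier V \<Longrightarrow> y \<in> carrier V \<Longrightarrow> f (x \<oplus>\<^bsub>V\<^esub> y) = f x \<oplus>\<^bsub>W\<^esub> f y"
  by (auto simp: linear_map_def)

lemma linear_map_smult:
  "linear_map K V W f \<Longrightarrow> c \<in> carrier K \<Longrightarrow> x \<in> carrier V \<Longrightarrow> f (c \<odot>\<^bsub>V\<^esub> x) = c \<odot>\<^bsub>W\<^esub> f x"
  by (auto simp: linear_map_def)

lemma linear_map_cong:
  assumes "module K V" and "linear_map K V W f" and "\<And>x. x \<in> carrier V \<Longrightarrow> g x = f x"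
  shows "linear_map K V W g"
proof -
  interpret V: module K V by fact
  show ?thesis
    using assms(2,3) by (intro linear_mapI) (simp_all add: linear_map_closed linear_map_add linear_map_smult)
qed

lemma linear_map_zero:
  assumes "module K V" and "module K W" and "linear_map K V W f"
  shows "f \<zero>\<^bsub>V\<^esub> = \<zero>\<^bsub>W\<^esub>"
proof -
  interpret V: module K V by fact
  interpret W: module K W by fact
  have "f (\<zero>\<^bsub>K\<^esub> \<odot>\<^bsub>V\<^esub> \<zero>\<^bsub>V\<^esub>) = \<zero>\<^bsub>K\<^esub> \<odot>\<^bsub>W\<^esub> f \<zero>\<^bsub>V\<^esub>"
    by (rule linear_map_smult[OF assms(3)]) simp_all
  then show ?thesis
    using linear_map_closed[OF assms(3) V.M.zero_closed] by simp
qed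

lemma linear_map_id: "linear_map K V V id" "linear_map K V V (\<lambda>x. x)"
  by (simp_all add: linear_map_def)

lemma linear_map_compose:
  assumes "linear_map K V W f" and "linear_map K U V g"
  shows "linear_map K U W (\<lambda>x. f (g x))"
  using assms by (intro linear_mapI) (simp_all add: linear_map_closed linear_map_add linear_map_smult)

lemma linear_map_const_zero:
  assumes "module K W" shows "linear_map K V W (\<lambda>x. \<zero>\<^bsub>W\<^esub>)"
proof -
  interpret W: module K W by fact
  show ?thesis by (intro linear_mapI) simp_all
qed

lemma linear_map_plus:
  assumes "module K W" and "linear_map K V W f" and "linear_map K V W g"
  shows "linear_map K V W (\<lambda>x. f x \<oplus>\<^bsub>W\<^esub> g x)"
proof -
  interpret W: module K W by fact
  show ?thesis
    using assms(2,3)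
    by (intro linear_mapI)
      (simp_all add: linear_map_closed linear_map_add linear_map_smult W.smult_r_distr W.M.a_ac)
qed

lemma linear_map_scale:
  assumes "module K W" and "linear_map K V W f" and "c \<in> carrier K"
  shows "linear_map K V W (\<lambda>x. c \<odot>\<^bsub>W\<^esub> f x)"
proof -
  interpret W: module K W by fact
  show ?thesis
    using assms(2,3)
    by (intro linear_mapI)
      (simp_all add: linear_map_closed linear_map_add linear_map_smult W.smult_r_distr
        W.smult_assoc1[symmetric] W.R.m_comm)
qed

section \<open>Submodules and the sets where linear maps agree\<close>

lemma submodule_subset: "submodule H K V \<Longrightarrow> H \<subseteq> carrier V"
  using subgroup.subset[of H "add_monoid V"] by (auto simp: submodule_def)

text \<open>Closure under negation follows from closure under scalars, since negation is the action
  of minus one.\<close>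

lemma submoduleI':
  assumes "module K V" and "H \<subseteq> carrier V" and "\<zero>\<^bsub>V\<^esub> \<in> H"
    and "\<And>x y. x \<in> H \<Longrightarrow> y \<in> H \<Longrightarrow> x \<oplus>\<^bsub>V\<^esub> y \<in> H"
    and "\<And>c x. c \<in> carrier K \<Longrightarrow> x \<in> H \<Longrightarrow> c \<odot>\<^bsub>V\<^esub> x \<in> H"
  shows "submodule H K V"
proof -
  interpret V: module K V by fact
  have "\<ominus>\<^bsub>V\<^esub> x \<in> H" if "x \<in> H" for x
  proof -
    have "\<ominus>\<^bsub>V\<^esub> x = (\<ominus>\<^bsub>K\<^esub> \<one>\<^bsub>K\<^esub>) \<odot>\<^bsub>V\<^esub> x"
      using that assms(2) by (simp add: V.smult_l_minus subset_iff)
    then show ?thesis using assms(5)[of "\<ominus>\<^bsub>K\<^esub> \<one>\<^bsub>K\<^esub>" x] that by simp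
  qed
  then show ?thesis using assms by (intro V.submoduleI) auto
qed

text \<open>Basis of the extensionality arguments below: the set where two linear maps agree is
  closed under the operations, so it is everything once it contains generators.\<close>

lemma submodule_equalizer:
  assumes "module K V" and "module K W" and "linear_map K V W f" and "linear_map K V W g"
  shows "submodule {x \<in> carrier V. f x = g x} K V"
proof -
  interpret V: module K V by fact
  show ?thesis
    using assms(3,4) linear_map_zero[OF assms(1,2,3)] linear_map_zero[OF assms(1,2,4)]
    by (intro submoduleI'[OF assms(1)]) (auto simp: linear_map_add linear_map_smult)
qed

lemma submodule_kernel:
  assumes "module K V" and "module K W" and "linear_map K V W f"
  shows "submodule {x \<in> carrier V. f x = \<zero>\<^bsub>W\<^esub>} K V"
  using submodule_equalizer[OF assms linear_map_const_zero[OF assms(2)]] .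

text \<open>Both the evaluation of formal linear combinations and the maps out of a direct sum are sums of
  linear maps over a support that depends on the argument.\<close>

lemma linear_map_finsum_support:
  assumes "module K V" and "module K W"
    and fin: "\<And>t. t \<in> carrier V \<Longrightarrow> finite (S t)" and sub: "\<And>t. t \<in> carrier V \<Longrightarrow> S t \<subseteq> I"
    and lin: "\<And>i. i \<in> I \<Longrightarrow> linear_map K V W (h i)"
    and zero: "\<And>i t. t \<in> carrier V \<Longrightarrow> i \<in> I \<Longrightarrow> i \<notin> S t \<Longrightarrow> h i t = \<zero>\<^bsub>W\<^esub>"
  shows "linear_map K V W (\<lambda>t. \<Oplus>\<^bsub>W\<^esub>i\<in>S t. h i t)"
proof -
  interpret V: module K V by fact
  interpret W: module K W by fact
  have cl: "h i t \<in> carrier W" if "i \<in> I" "t \<in> carrier V" for i t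
    using lin that by (blast intro: linear_map_closed)
  \<comment> \<open>The support varies with the argument and is not additive. Sums are therefore
    compared over a common finite set, where the additional summands vanish.\<close>
  have eq: "(\<Oplus>\<^bsub>W\<^esub>i\<in>S t. h i t) = (\<Oplus>\<^bsub>W\<^esub>i\<in>B. h i t)"
    if "t \<in> carrier V" "S t \<subseteq> B" "B \<subseteq> I" "finite B" for t B
    using that zero cl by (intro W.M.add.finprod_mono_neutral_cong_left) (auto simp: Pi_def)
  show ?thesis
  proof (rule linear_mapI)
    fix x assume "x \<in> carrier V"
    then show "(\<Oplus>\<^bsub>W\<^esub>i\<in>S x. h i x) \<in> carrier W"
      using sub cl by (intro W.M.finsum_closed) blast
  next
    fix x y assume xy: "x \<in> carrier V" "y \<in> carrier V"
    let ?B = "S x \<union> S y \<union> S (x \<oplus>\<^bsub>V\<^esub> y)"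
    have B: "finite ?B" "?B \<subseteq> I" using fin sub xy by auto
    have S: "S x \<subseteq> ?B" "S y \<subseteq> ?B" "S (x \<oplus>\<^bsub>V\<^esub> y) \<subseteq> ?B" by blast+
    have "(\<Oplus>\<^bsub>W\<^esub>i\<in>?B. h i (x \<oplus>\<^bsub>V\<^esub> y)) = (\<Oplus>\<^bsub>W\<^esub>i\<in>?B. h i x \<oplus>\<^bsub>W\<^esub> h i y)"
      using B(2) xy cl by (intro W.M.finsum_cong' refl linear_map_add[OF lin]) blast+
    also have "\<dots> = (\<Oplus>\<^bsub>W\<^esub>i\<in>?B. h i x) \<oplus>\<^bsub>W\<^esub> (\<Oplus>\<^bsub>W\<^esub>i\<in>?B. h i y)"
      using B xy cl by (intro W.M.finsum_addf) blast+
    finally show "(\<Oplus>\<^bsub>W\<^esub>i\<in>S (x \<oplus>\<^bsub>V\<^esub> y). h i (x \<oplus>\<^bsub>V\<^esub> y)) = (\<Oplus>\<^bsub>W\<^esub>i\<in>S x. h i x) \<oplus>\<^bsub>W\<^esub> (\<Oplus>\<^bsub>W\<^esub>i\<in>S y. h i y)"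
      unfolding eq[OF xy(1) S(1) B(2,1)] eq[OF xy(2) S(2) B(2,1)] eq[OF V.M.a_closed[OF xy] S(3) B(2,1)] .
  next
    fix c x assume cx: "c \<in> carrier K" "x \<in> carrier V"
    let ?B = "S x \<union> S (c \<odot>\<^bsub>V\<^esub> x)"
    have B: "finite ?B" "?B \<subseteq> I" using fin sub cx by auto
    have "(\<Oplus>\<^bsub>W\<^esub>i\<in>?B. h i (c \<odot>\<^bsub>V\<^esub> x)) = (\<Oplus>\<^bsub>W\<^esub>i\<in>?B. c \<odot>\<^bsub>W\<^esub> h i x)"
      using B(2) cx cl by (intro W.M.finsum_cong' refl linear_map_smult[OF lin]) blast+
    also have "\<dots> = c \<odot>\<^bsub>W\<^esub> (\<Oplus>\<^bsub>W\<^esub>i\<in>?B. h i x)"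
      using B cx cl by (intro W.finsum_smult_ldistr[symmetric]) blast+
    finally show "(\<Oplus>\<^bsub>W\<^esub>i\<in>S (c \<odot>\<^bsub>V\<^esub> x). h i (c \<odot>\<^bsub>V\<^esub> x)) = c \<odot>\<^bsub>W\<^esub> (\<Oplus>\<^bsub>W\<^esub>i\<in>S x. h i x)"
      using eq[OF _ _ B(2,1), of x] eq[OF _ _ B(2,1), of "c \<odot>\<^bsub>V\<^esub> x"] cx by auto
  qed
qed

lemma linear_map_finsum_fixed:
  assumes U: "module K U" and Z: "module K Z" and "finite S"
    and "\<And>i. i \<in> S \<Longrightarrow> linear_map K U Z (h i)"
  shows "linear_map K U Z (\<lambda>u. \<Oplus>\<^bsub>Z\<^esub>i\<in>S. h i u)"
  by (rule linear_map_finsum_support[OF U Z, where I = S]) (use assms in auto)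

section \<open>Free, quotient and presented spaces\<close>

lemma free_space_simps:
  "carrier (free_space K X) = {f. (\<forall>x. f x \<in> carrier K) \<and> (\<forall>x. x \<notin> X \<longrightarrow> f x = \<zero>\<^bsub>K\<^esub>) \<and>
     finite {x. f x \<noteq> \<zero>\<^bsub>K\<^esub>}}"
  "\<zero>\<^bsub>free_space K X\<^esub> = (\<lambda>x. \<zero>\<^bsub>K\<^esub>)"
  "f \<oplus>\<^bsub>free_space K X\<^esub> g = (\<lambda>x. f x \<oplus>\<^bsub>K\<^esub> g x)"
  "c \<odot>\<^bsub>free_space K X\<^esub> f = (\<lambda>x. c \<otimes>\<^bsub>K\<^esub> f x)"
  by (simp_all add: free_space_def)

lemma module_free_space:
  assumes "cring K" shows "module K (free_space K X)"
proof -
  interpret K: cring K by fact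
  have add: "f \<oplus>\<^bsub>free_space K X\<^esub> g \<in> carrier (free_space K X)"
    if "f \<in> carrier (free_space K X)" "g \<in> carrier (free_space K X)" for f g
  proof -
    have "{x. f x \<oplus>\<^bsub>K\<^esub> g x \<noteq> \<zero>\<^bsub>K\<^esub>} \<subseteq> {x. f x \<noteq> \<zero>\<^bsub>K\<^esub>} \<union> {x. g x \<noteq> \<zero>\<^bsub>K\<^esub>}" by auto
    then show ?thesis
      using that by (auto simp: free_space_simps dest: finite_subset)
  qed
  have smult: "c \<odot>\<^bsub>free_space K X\<^esub> f \<in> carrier (free_space K X)"
    if "c \<in> carrier K" "f \<in> carrier (free_space K X)" for c f
  proof -
    have "{x. c \<otimes>\<^bsub>K\<^esub> f x \<noteq> \<zero>\<^bsub>K\<^esub>} \<subseteq> {x. f x \<noteq> \<zero>\<^bsub>K\<^esub>}" using that by auto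
    then show ?thesis
      using that by (auto simp: free_space_simps dest: finite_subset)
  qed
  show ?thesis
  proof (intro moduleI abelian_groupI)
    fix f assume f: "f \<in> carrier (free_space K X)"
    show "\<exists>g\<in>carrier (free_space K X). g \<oplus>\<^bsub>free_space K X\<^esub> f = \<zero>\<^bsub>free_space K X\<^esub>"
    proof
      show "(\<ominus>\<^bsub>K\<^esub> \<one>\<^bsub>K\<^esub>) \<odot>\<^bsub>free_space K X\<^esub> f \<in> carrier (free_space K X)" using f smult by simp
      show "(\<ominus>\<^bsub>K\<^esub> \<one>\<^bsub>K\<^esub>) \<odot>\<^bsub>free_space K X\<^esub> f \<oplus>\<^bsub>free_space K X\<^esub> f = \<zero>\<^bsub>free_space K X\<^esub>"
        using f by (auto simp: free_space_simps K.l_minus K.l_neg)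
    qed
  qed (use add smult assms in \<open>auto simp: free_space_simps K.a_ac K.m_ac K.l_distr K.r_distr\<close>)
qed

lemma free_gen_closed:
  assumes "cring K" and "x \<in> X" shows "free_gen K x \<in> carrier (free_space K X)"
proof -
  interpret K: cring K by fact
  have "{y. free_gen K x y \<noteq> \<zero>\<^bsub>K\<^esub>} \<subseteq> {x}" by (auto simp: free_gen_def)
  then show ?thesis
    using assms(2) by (auto simp: free_space_simps free_gen_def dest: finite_subset)
qed

text \<open>Induction on the support: setting one value of \<open>f\<close> to zero shrinks the
  support, and the term removed is a scalar multiple of a generator.\<close>

lemma submodule_free_space_eq:
  assumes "cring K" and "submodule N K (free_space K X)" and "\<And>x. x \<in> X \<Longrightarrow> free_gen K x \<in> N"
  shows "N = carrier (free_space K X)"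
proof
  interpret K: cring K by fact
  interpret F: module K "free_space K X" by (rule module_free_space) fact
  note N = F.submoduleE[OF assms(2)]
  show "N \<subseteq> carrier (free_space K X)" by (rule N(1))
  have zero: "\<zero>\<^bsub>free_space K X\<^esub> \<in> N"
    using submodule.axioms(1)[OF assms(2)] subgroup.one_closed by force
  have "finite S \<Longrightarrow> f \<in> carrier (free_space K X) \<Longrightarrow> {x. f x \<noteq> \<zero>\<^bsub>K\<^esub>} = S \<Longrightarrow> f \<in> N" for f S
  proof (induction S arbitrary: f rule: finite_induct)
    case empty
    then have "f = \<zero>\<^bsub>free_space K X\<^esub>" by (auto simp: free_space_simps)
    then show ?case using zero by simp
  next
    case (insert x S)
    have x: "x \<in> X" "f x \<in> carrier K"
      using insert.prems by (auto simp: free_space_simps)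
    define g where "g = f(x := \<zero>\<^bsub>K\<^esub>)"
    have S: "{x. g x \<noteq> \<zero>\<^bsub>K\<^esub>} = S" using insert by (auto simp: g_def)
    have "g \<in> carrier (free_space K X)"
      using insert.prems(1) S \<open>finite S\<close> by (auto simp: free_space_simps g_def)
    then have "g \<in> N" using S by (rule insert.IH)
    moreover have "f = g \<oplus>\<^bsub>free_space K X\<^esub> f x \<odot>\<^bsub>free_space K X\<^esub> free_gen K x"
      using insert.prems(1) by (auto simp: free_space_simps g_def free_gen_def)
    ultimately show ?case using N(4,5) assms(3) x by metis
  qed
  then show "carrier (free_space K X) \<subseteq> N" by (auto simp: free_space_simps)
qed

lemma submodule_lin_span:
  assumes "module K V" and "S \<subseteq> carrier V"
  shows "submodule (lin_span K V S) K V"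
proof -
  interpret V: module K V by fact
  show ?thesis
  proof (rule submoduleI'[OF assms(1)])
    \<comment> \<open>The family being intersected is nonempty, because the whole carrier belongs to
      it.\<close>
    show "lin_span K V S \<subseteq> carrier V"
      using V.carrier_is_submodule assms(2) by (auto simp: lin_span_def)
    show "\<zero>\<^bsub>V\<^esub> \<in> lin_span K V S"
      using submodule.axioms(1) subgroup.one_closed unfolding lin_span_def by fastforce
  qed (auto simp: lin_span_def dest: V.submoduleE(4,5))
qed

lemma lin_span_superset: "S \<subseteq> lin_span K V S"
  by (auto simp: lin_span_def)

lemma lin_span_least: "submodule H K V \<Longrightarrow> S \<subseteq> H \<Longrightarrow> lin_span K V S \<subseteq> H"
  by (auto simp: lin_span_def)

text \<open>The module laws are equations, so they pass to any surjective image whose operations are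
  computed on representatives; additive inverses are images of inverses.\<close>

lemma module_surj_image:
  assumes "module K V" and onto: "carrier W = p ` carrier V"
    and add: "\<And>x y. x \<in> carrier V \<Longrightarrow> y \<in> carrier V \<Longrightarrow> p x \<oplus>\<^bsub>W\<^esub> p y = p (x \<oplus>\<^bsub>V\<^esub> y)"
    and smult: "\<And>c x. c \<in> carrier K \<Longrightarrow> x \<in> carrier V \<Longrightarrow> c \<odot>\<^bsub>W\<^esub> p x = p (c \<odot>\<^bsub>V\<^esub> x)"
    and zero: "\<zero>\<^bsub>W\<^esub> = p \<zero>\<^bsub>V\<^esub>"
  shows "module K W"
proof -
  interpret V: module K V by fact
  show ?thesis
  proof (intro moduleI abelian_groupI)
    fix x assume "x \<in> carrier W"
    then obtain v where v: "v \<in> carrier V" "x = p v" using onto by auto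
    then have "p (\<ominus>\<^bsub>V\<^esub> v) \<oplus>\<^bsub>W\<^esub> x = \<zero>\<^bsub>W\<^esub>" by (simp add: add zero V.M.l_neg)
    then show "\<exists>y\<in>carrier W. y \<oplus>\<^bsub>W\<^esub> x = \<zero>\<^bsub>W\<^esub>" using v onto by blast
  qed (auto simp: onto add smult zero V.M.a_ac V.smult_l_distr V.smult_r_distr V.smult_assoc1 V.R.cring_axioms)
qed

lemma abelian_subgroup_submodule:
  assumes "module K V" and "submodule H K V" shows "abelian_subgroup H V"
proof -
  interpret V: module K V by fact
  show ?thesis
    using submodule.axioms(1)[OF assms(2)]
    by (intro abelian_subgroupI3 additive_subgroupI V.M.abelian_group_axioms)
qed

lemma quot_space_add:
  assumes "module K V" and "submodule H K V" and "x \<in> carrier V" and "y \<in> carrier V"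
  shows "(H +>\<^bsub>V\<^esub> x) \<oplus>\<^bsub>quot_space V H\<^esub> (H +>\<^bsub>V\<^esub> y) = H +>\<^bsub>V\<^esub> (x \<oplus>\<^bsub>V\<^esub> y)"
  using abelian_subgroup.a_rcos_sum[OF abelian_subgroup_submodule[OF assms(1,2)]] assms(3,4)
  by (simp add: quot_space_def)

text \<open>The sum \<open>H + c(H + x)\<close> stays inside \<open>H + cx\<close> because
  \<open>cH\<close> is contained in \<open>H\<close>; the converse inclusion takes zero from the
  inner copy of \<open>H\<close>.\<close>

lemma quot_space_smult:
  assumes "module K V" and "submodule H K V" and "c \<in> carrier K" and "x \<in> carrier V"
  shows "c \<odot>\<^bsub>quot_space V H\<^esub> (H +>\<^bsub>V\<^esub> x) = H +>\<^bsub>V\<^esub> (c \<odot>\<^bsub>V\<^esub> x)"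
proof -
  interpret V: module K V by fact
  interpret H: abelian_subgroup H V by (rule abelian_subgroup_submodule) fact+
  note HE = V.submoduleE[OF assms(2)]
  have eq: "h \<oplus>\<^bsub>V\<^esub> c \<odot>\<^bsub>V\<^esub> (h' \<oplus>\<^bsub>V\<^esub> x) = (h \<oplus>\<^bsub>V\<^esub> c \<odot>\<^bsub>V\<^esub> h') \<oplus>\<^bsub>V\<^esub> c \<odot>\<^bsub>V\<^esub> x"
    if "h \<in> H" "h' \<in> H" for h h'
    using that assms HE(1) by (simp add: V.smult_r_distr V.M.a_assoc subset_iff)
  have "(\<exists>h\<in>H. \<exists>h'\<in>H. z = h \<oplus>\<^bsub>V\<^esub> c \<odot>\<^bsub>V\<^esub> (h' \<oplus>\<^bsub>V\<^esub> x)) \<longleftrightarrow> (\<exists>h\<in>H. z = h \<oplus>\<^bsub>V\<^esub> c \<odot>\<^bsub>V\<^esub> x)" for z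
  proof
    assume "\<exists>h\<in>H. \<exists>h'\<in>H. z = h \<oplus>\<^bsub>V\<^esub> c \<odot>\<^bsub>V\<^esub> (h' \<oplus>\<^bsub>V\<^esub> x)"
    then show "\<exists>h\<in>H. z = h \<oplus>\<^bsub>V\<^esub> c \<odot>\<^bsub>V\<^esub> x" using eq HE(4,5) assms(3) by metis
  next
    assume "\<exists>h\<in>H. z = h \<oplus>\<^bsub>V\<^esub> c \<odot>\<^bsub>V\<^esub> x"
    then obtain h where h: "h \<in> H" "z = h \<oplus>\<^bsub>V\<^esub> c \<odot>\<^bsub>V\<^esub> x" by blast
    then have "z = h \<oplus>\<^bsub>V\<^esub> c \<odot>\<^bsub>V\<^esub> (\<zero>\<^bsub>V\<^esub> \<oplus>\<^bsub>V\<^esub> x)" using assms(4) by simp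
    then show "\<exists>h\<in>H. \<exists>h'\<in>H. z = h \<oplus>\<^bsub>V\<^esub> c \<odot>\<^bsub>V\<^esub> (h' \<oplus>\<^bsub>V\<^esub> x)" using h(1) H.zero_closed by blast
  qed
  then show ?thesis
    unfolding quot_space_def a_r_coset_def' set_add_def' by auto
qed

lemma linear_map_quot_proj:
  assumes "module K V" and "submodule H K V"
  shows "linear_map K V (quot_space V H) (\<lambda>x. H +>\<^bsub>V\<^esub> x)"
  by (intro linear_mapI) (simp_all add: quot_space_add[OF assms] quot_space_smult[OF assms],
      auto simp: quot_space_def A_RCOSETS_def')

lemma carrier_quot_space: "carrier (quot_space V H) = (\<lambda>x. H +>\<^bsub>V\<^esub> x) ` carrier V"
  by (auto simp: quot_space_def A_RCOSETS_def')

lemma module_quot_space: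
  assumes "module K V" and "submodule H K V"
  shows "module K (quot_space V H)"
proof -
  interpret V: module K V by fact
  interpret H: abelian_subgroup H V by (rule abelian_subgroup_submodule) fact+
  show ?thesis
    by (rule module_surj_image[OF assms(1) carrier_quot_space])
      (simp_all add: quot_space_add[OF assms] quot_space_smult[OF assms], simp add: quot_space_def V.M.a_coset_add_zero H.a_subset)
qed

text \<open>Binary tensor products and tensor powers are both given by generators and relations, so
  their universal property is derived once, for arbitrary generators and relations.\<close>

locale presentation =
  fixes K :: "'k ring" and X :: "'x set" and R :: "('x \<Rightarrow> 'k) set"
  assumes cring: "cring K" and rels: "R \<subseteq> carrier (free_space K X)"
begin

lemma module_free: "module K (free_space K X)"
  by (rule module_free_space[OF cring])

lemma submodule_rels: "submodule (lin_span K (free_space K X) R) K (free_space K X)"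
  by (rule submodule_lin_span[OF module_free rels])

lemma module_presented: "module K (presented_space K X R)"
  unfolding presented_space_def by (rule module_quot_space[OF module_free submodule_rels])

lemma presented_gen_closed: "x \<in> X \<Longrightarrow> presented_gen K X R x \<in> carrier (presented_space K X R)"
  unfolding presented_space_def presented_gen_def carrier_quot_space
  by (intro imageI free_gen_closed[OF cring])

lemma coset_eq_of_rel:
  assumes "f \<ominus>\<^bsub>free_space K X\<^esub> g \<in> R" and "f \<in> carrier (free_space K X)" and "g \<in> carrier (free_space K X)"
  shows "lin_span K (free_space K X) R +>\<^bsub>free_space K X\<^esub> f = lin_span K (free_space K X) R +>\<^bsub>free_space K X\<^esub> g"
proof -
  interpret F: module K "free_space K X" by (rule module_free)
  interpret H: abelian_subgroup "lin_span K (free_space K X) R" "free_space K X"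
    by (rule abelian_subgroup_submodule[OF module_free submodule_rels])
  have "f \<in> lin_span K (free_space K X) R +>\<^bsub>free_space K X\<^esub> g"
    using lin_span_superset[of R K "free_space K X", THEN subsetD, OF assms(1)] H.a_rcos_module_rev[OF assms(3,2)]
    by (simp only: a_minus_def)
  then show ?thesis using assms(3) H.a_repr_independence' by metis
qed

lemma presented_gen_add:
  assumes "free_gen K x \<ominus>\<^bsub>free_space K X\<^esub> (free_gen K y \<oplus>\<^bsub>free_space K X\<^esub> free_gen K z) \<in> R"
    and "x \<in> X" and "y \<in> X" and "z \<in> X"
  shows "presented_gen K X R x =
    presented_gen K X R y \<oplus>\<^bsub>presented_space K X R\<^esub> presented_gen K X R z"
proof -
  interpret F: module K "free_space K X" by (rule module_free)
  note c = assms(2-4)[THEN free_gen_closed[OF cring]]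
  show ?thesis
    unfolding presented_gen_def presented_space_def quot_space_add[OF module_free submodule_rels c(2,3)]
    by (rule coset_eq_of_rel[OF assms(1) c(1) F.M.a_closed[OF c(2,3)]])
qed

lemma presented_gen_smult:
  assumes "free_gen K x \<ominus>\<^bsub>free_space K X\<^esub> (c \<odot>\<^bsub>free_space K X\<^esub> free_gen K y) \<in> R"
    and "c \<in> carrier K" and "x \<in> X" and "y \<in> X"
  shows "presented_gen K X R x = c \<odot>\<^bsub>presented_space K X R\<^esub> presented_gen K X R y"
proof -
  interpret F: module K "free_space K X" by (rule module_free)
  note g = assms(3,4)[THEN free_gen_closed[OF cring]]
  show ?thesis
    unfolding presented_gen_def presented_space_def quot_space_smult[OF module_free submodule_rels assms(2) g(2)]
    by (rule coset_eq_of_rel[OF assms(1) g(1) F.smult_closed[OF assms(2) g(2)]])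
qed

text \<open>The two maps are compared after composition with the projection from the free space,
  where agreement on generators is known to spread; surjectivity of the projection brings the
  equality back.\<close>

lemma presented_eqI:
  assumes W: "module K W" and f: "linear_map K (presented_space K X R) W f"
    and g: "linear_map K (presented_space K X R) W g"
    and eq: "\<And>x. x \<in> X \<Longrightarrow> f (presented_gen K X R x) = g (presented_gen K X R x)"
    and t: "t \<in> carrier (presented_space K X R)"
  shows "f t = g t"
proof -
  let ?p = "\<lambda>x. lin_span K (free_space K X) R +>\<^bsub>free_space K X\<^esub> x"
  have p: "linear_map K (free_space K X) (presented_space K X R) ?p"
    unfolding presented_space_def by (rule linear_map_quot_proj[OF module_free submodule_rels])
  have "{x \<in> carrier (free_space K X). f (?p x) = g (?p x)} = carrier (free_space K X)"
    using submodule_equalizer[OF module_free W linear_map_compose[OF f p] linear_map_compose[OF g p]]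
      eq free_gen_closed[OF cring]
    by (intro submodule_free_space_eq[OF cring]) (auto simp: presented_gen_def)
  then show ?thesis using t by (auto simp: presented_space_def carrier_quot_space)
qed

context
  fixes W :: "('k, 'w) module" and \<beta> :: "'x \<Rightarrow> 'w"
  assumes W: "module K W" and \<beta>: "\<And>x. x \<in> X \<Longrightarrow> \<beta> x \<in> carrier W"
begin

lemma linear_map_eval:
  "linear_map K (free_space K X) W (\<lambda>f. \<Oplus>\<^bsub>W\<^esub>x\<in>{x. f x \<noteq> \<zero>\<^bsub>K\<^esub>}. f x \<odot>\<^bsub>W\<^esub> \<beta> x)"
proof -
  interpret W: module K W by (rule W)
  show ?thesis
    by (rule linear_map_finsum_support[OF module_free W, where I = X])
      (auto intro!: linear_mapI simp: free_space_simps \<beta> W.smult_l_distr W.smult_assoc1)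
qed

lemma eval_free_gen:
  assumes "x \<in> X"
  shows "(\<Oplus>\<^bsub>W\<^esub>y\<in>{y. free_gen K x y \<noteq> \<zero>\<^bsub>K\<^esub>}. free_gen K x y \<odot>\<^bsub>W\<^esub> \<beta> y) = \<beta> x"
proof -
  interpret W: module K W by (rule W)
  note x = \<beta>[OF assms]
  \<comment> \<open>\<open>K\<close> is a commutative ring in which one may equal zero. A generator
    then has empty support, but every module element is zero as well.\<close>
  have "\<beta> x = \<zero>\<^bsub>W\<^esub>" if "\<one>\<^bsub>K\<^esub> = \<zero>\<^bsub>K\<^esub>"
    using that W.smult_one[OF x] W.smult_l_null[OF x] by metis
  then have "(\<Oplus>\<^bsub>W\<^esub>y\<in>{y. free_gen K x y \<noteq> \<zero>\<^bsub>K\<^esub>}. free_gen K x y \<odot>\<^bsub>W\<^esub> \<beta> y) =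
      (\<Oplus>\<^bsub>W\<^esub>y\<in>{x}. free_gen K x y \<odot>\<^bsub>W\<^esub> \<beta> y)"
    using x by (intro W.M.add.finprod_mono_neutral_cong_left) (auto simp: free_gen_def)
  also have "\<dots> = free_gen K x x \<odot>\<^bsub>W\<^esub> \<beta> x \<oplus>\<^bsub>W\<^esub> (\<Oplus>\<^bsub>W\<^esub>y\<in>{}. free_gen K x y \<odot>\<^bsub>W\<^esub> \<beta> y)"
    using x by (intro W.M.finsum_insert) (simp_all add: free_gen_def)
  also have "\<dots> = \<beta> x" using x by (simp add: free_gen_def)
  finally show ?thesis .
qed

text \<open>All relations of tensor products and tensor powers are written as differences;
  respecting such a relation amounts to the equality of two evaluations.\<close>

lemma eval_diff:
  assumes "f \<in> carrier (free_space K X)" and "g \<in> carrier (free_space K X)"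
    and "(\<Oplus>\<^bsub>W\<^esub>x\<in>{x. f x \<noteq> \<zero>\<^bsub>K\<^esub>}. f x \<odot>\<^bsub>W\<^esub> \<beta> x) = (\<Oplus>\<^bsub>W\<^esub>x\<in>{x. g x \<noteq> \<zero>\<^bsub>K\<^esub>}. g x \<odot>\<^bsub>W\<^esub> \<beta> x)"
    and "r = f \<ominus>\<^bsub>free_space K X\<^esub> g"
  shows "(\<Oplus>\<^bsub>W\<^esub>x\<in>{x. r x \<noteq> \<zero>\<^bsub>K\<^esub>}. r x \<odot>\<^bsub>W\<^esub> \<beta> x) = \<zero>\<^bsub>W\<^esub>"
proof -
  interpret W: module K W by (rule W)
  interpret F: module K "free_space K X" by (rule module_free)
  let ?ev = "\<lambda>f. \<Oplus>\<^bsub>W\<^esub>x\<in>{x. f x \<noteq> \<zero>\<^bsub>K\<^esub>}. f x \<odot>\<^bsub>W\<^esub> \<beta> x"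
  note ev = linear_map_eval
  have r: "r \<in> carrier (free_space K X)" and f: "f = r \<oplus>\<^bsub>free_space K X\<^esub> g"
    using assms(1,2,4) by (simp_all add: a_minus_def F.M.a_assoc F.M.l_neg)
  have "?ev f = ?ev r \<oplus>\<^bsub>W\<^esub> ?ev g"
    unfolding f by (rule linear_map_add[OF ev r assms(2)])
  then show "?ev r = \<zero>\<^bsub>W\<^esub>"
    unfolding assms(3)
    using W.M.add.r_cancel_one'[OF linear_map_closed[OF ev assms(2)] linear_map_closed[OF ev r]] by blast
qed

lemma eval_rel_add:
  assumes "x \<in> X" and "y \<in> X" and "z \<in> X" and "\<beta> x = \<beta> y \<oplus>\<^bsub>W\<^esub> \<beta> z"
    and "r = free_gen K x \<ominus>\<^bsub>free_space K X\<^esub> (free_gen K y \<oplus>\<^bsub>free_space K X\<^esub> free_gen K z)"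
  shows "(\<Oplus>\<^bsub>W\<^esub>x\<in>{x. r x \<noteq> \<zero>\<^bsub>K\<^esub>}. r x \<odot>\<^bsub>W\<^esub> \<beta> x) = \<zero>\<^bsub>W\<^esub>"
proof -
  interpret F: module K "free_space K X" by (rule module_free)
  note c = assms(1-3)[THEN free_gen_closed[OF cring]]
  show ?thesis
    using assms(4) by (intro eval_diff[OF c(1) F.M.a_closed[OF c(2,3)] _ assms(5)])
      (simp only: linear_map_add[OF linear_map_eval c(2,3)] eval_free_gen assms(1-3))
qed

lemma eval_rel_smult:
  assumes "c \<in> carrier K" and "x \<in> X" and "y \<in> X" and "\<beta> x = c \<odot>\<^bsub>W\<^esub> \<beta> y"
    and "r = free_gen K x \<ominus>\<^bsub>free_space K X\<^esub> (c \<odot>\<^bsub>free_space K X\<^esub> free_gen K y)"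
  shows "(\<Oplus>\<^bsub>W\<^esub>x\<in>{x. r x \<noteq> \<zero>\<^bsub>K\<^esub>}. r x \<odot>\<^bsub>W\<^esub> \<beta> x) = \<zero>\<^bsub>W\<^esub>"
proof -
  interpret F: module K "free_space K X" by (rule module_free)
  note g = assms(2,3)[THEN free_gen_closed[OF cring]]
  show ?thesis
    using assms(4) by (intro eval_diff[OF g(1) F.smult_closed[OF assms(1) g(2)] _ assms(5)])
      (simp only: linear_map_smult[OF linear_map_eval assms(1) g(2)] eval_free_gen assms(2,3))
qed

context
  assumes respects: "\<And>r. r \<in> R \<Longrightarrow> (\<Oplus>\<^bsub>W\<^esub>x\<in>{x. r x \<noteq> \<zero>\<^bsub>K\<^esub>}. r x \<odot>\<^bsub>W\<^esub> \<beta> x) = \<zero>\<^bsub>W\<^esub>"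
begin

text \<open>The chosen representative is unknown, but it differs from \<open>f\<close> by an element
  of the span of the relations. The kernel of the evaluation is a submodule, so it contains this
  span as soon as it contains the relations.\<close>

lemma presented_lift_coset:
  assumes f: "f \<in> carrier (free_space K X)"
  shows "presented_lift K W \<beta> (lin_span K (free_space K X) R +>\<^bsub>free_space K X\<^esub> f) =
    (\<Oplus>\<^bsub>W\<^esub>x\<in>{x. f x \<noteq> \<zero>\<^bsub>K\<^esub>}. f x \<odot>\<^bsub>W\<^esub> \<beta> x)"
proof -
  interpret W: module K W by (rule W)
  interpret F: module K "free_space K X" by (rule module_free)
  let ?H = "lin_span K (free_space K X) R"
  let ?ev = "\<lambda>f. \<Oplus>\<^bsub>W\<^esub>x\<in>{x. f x \<noteq> \<zero>\<^bsub>K\<^esub>}. f x \<odot>\<^bsub>W\<^esub> \<beta> x"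
  interpret H: abelian_subgroup ?H "free_space K X"
    by (rule abelian_subgroup_submodule[OF module_free submodule_rels])
  have ker: "?H \<subseteq> {f \<in> carrier (free_space K X). ?ev f = \<zero>\<^bsub>W\<^esub>}"
    using rels respects
    by (intro lin_span_least submodule_kernel[OF module_free W linear_map_eval]) auto
  define g where "g = (SOME g. g \<in> ?H +>\<^bsub>free_space K X\<^esub> f)"
  have "g \<in> ?H +>\<^bsub>free_space K X\<^esub> f"
    unfolding g_def by (rule someI[of "\<lambda>g. g \<in> ?H +>\<^bsub>free_space K X\<^esub> f"], rule H.a_rcos_self[OF f])
  then obtain h where h: "h \<in> ?H" "g = h \<oplus>\<^bsub>free_space K X\<^esub> f"
    by (auto simp: a_r_coset_def')
  have h': "h \<in> carrier (free_space K X)" "?ev h = \<zero>\<^bsub>W\<^esub>" using ker h(1) by blast+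
  have "?ev g = ?ev h \<oplus>\<^bsub>W\<^esub> ?ev f"
    unfolding h(2) by (rule linear_map_add[OF linear_map_eval h'(1) f])
  also have "\<dots> = ?ev f"
    unfolding h'(2) by (rule W.M.l_zero[OF linear_map_closed[OF linear_map_eval f]])
  finally show ?thesis
    by (simp only: presented_lift_def Let_def g_def)
qed

lemma presented_lift_gen: "x \<in> X \<Longrightarrow> presented_lift K W \<beta> (presented_gen K X R x) = \<beta> x"
  by (simp add: presented_gen_def presented_lift_coset free_gen_closed[OF cring] eval_free_gen)

lemma linear_map_presented_lift: "linear_map K (presented_space K X R) W (presented_lift K W \<beta>)"
proof -
  interpret F: module K "free_space K X" by (rule module_free)
  note ev = linear_map_eval
  show ?thesis
    unfolding presented_space_def
    by (intro linear_mapI)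
      (auto simp: carrier_quot_space quot_space_add[OF module_free submodule_rels] presented_lift_coset
        quot_space_smult[OF module_free submodule_rels] linear_map_add[OF ev] linear_map_smult[OF ev]
        intro: linear_map_closed[OF ev])
qed

end

end

end

section \<open>Tensor products\<close>

lemma bilinear_mapI:
  assumes "\<And>u. u \<in> carrier U \<Longrightarrow> linear_map K V W (\<beta> u)"
    and "\<And>v. v \<in> carrier V \<Longrightarrow> linear_map K U W (\<lambda>u. \<beta> u v)"
  shows "bilinear_map K U V W \<beta>"
  using assms by (simp add: bilinear_map_def)

lemma bilinear_map_right: "bilinear_map K U V W \<beta> \<Longrightarrow> u \<in> carrier U \<Longrightarrow> linear_map K V W (\<beta> u)"
  by (simp add: bilinear_map_def)

lemma bilinear_map_left: "bilinear_map K U V W \<beta> \<Longrightarrow> v \<in> carrier V \<Longrightarrow> linear_map K U W (\<lambda>u. \<beta> u v)"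
  by (simp add: bilinear_map_def)

lemma bilinear_map_closed:
  "bilinear_map K U V W \<beta> \<Longrightarrow> u \<in> carrier U \<Longrightarrow> v \<in> carrier V \<Longrightarrow> \<beta> u v \<in> carrier W"
  by (blast intro: linear_map_closed bilinear_map_right)

lemma bilinear_map_comp:
  assumes "linear_map K Z W f" and "bilinear_map K U V Z \<beta>"
  shows "bilinear_map K U V W (\<lambda>u v. f (\<beta> u v))"
  by (rule bilinear_mapI)
    (rule linear_map_compose[OF assms(1) bilinear_map_right[OF assms(2)]],
      assumption, rule linear_map_compose[OF assms(1) bilinear_map_left[OF assms(2)]])

lemma bilinear_map_comp2:
  assumes "bilinear_map K U V W \<beta>" and "linear_map K U' U f" and "linear_map K V' V g"
  shows "bilinear_map K U' V' W (\<lambda>u v. \<beta> (f u) (g v))"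
  by (rule bilinear_mapI)
    (rule linear_map_compose[OF bilinear_map_right[OF assms(1) linear_map_closed[OF assms(2)]] assms(3)],
      assumption,
      rule linear_map_compose[OF bilinear_map_left[OF assms(1) linear_map_closed[OF assms(3)]] assms(2)])

lemma bilinear_map_swap: "bilinear_map K U V W \<beta> \<Longrightarrow> bilinear_map K V U W (\<lambda>v u. \<beta> u v)"
  by (simp add: bilinear_map_def)

lemma bilinear_rels_cases:
  assumes "r \<in> bilinear_rels K V W"
  obtains v v' w where "v \<in> carrier V" "v' \<in> carrier V" "w \<in> carrier W"
      "r = free_gen K (v \<oplus>\<^bsub>V\<^esub> v', w) \<ominus>\<^bsub>free_space K (carrier V \<times> carrier W)\<^esub>
        (free_gen K (v, w) \<oplus>\<^bsub>free_space K (carrier V \<times> carrier W)\<^esub> free_gen K (v', w))"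
  | v w w' where "v \<in> carrier V" "w \<in> carrier W" "w' \<in> carrier W"
      "r = free_gen K (v, w \<oplus>\<^bsub>W\<^esub> w') \<ominus>\<^bsub>free_space K (carrier V \<times> carrier W)\<^esub>
        (free_gen K (v, w) \<oplus>\<^bsub>free_space K (carrier V \<times> carrier W)\<^esub> free_gen K (v, w'))"
  | c v w where "c \<in> carrier K" "v \<in> carrier V" "w \<in> carrier W"
      "r = free_gen K (c \<odot>\<^bsub>V\<^esub> v, w) \<ominus>\<^bsub>free_space K (carrier V \<times> carrier W)\<^esub>
        (c \<odot>\<^bsub>free_space K (carrier V \<times> carrier W)\<^esub> free_gen K (v, w))"
  | c v w where "c \<in> carrier K" "v \<in> carrier V" "w \<in> carrier W"
      "r = free_gen K (v, c \<odot>\<^bsub>W\<^esub> w) \<ominus>\<^bsub>free_space K (carrier V \<times> carrier W)\<^esub>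
        (c \<odot>\<^bsub>free_space K (carrier V \<times> carrier W)\<^esub> free_gen K (v, w))"
  using assms unfolding bilinear_rels_def Let_def by (elim UnE CollectE exE conjE) blast+

context
  fixes K :: "'k ring" and V :: "('k, 'v) module" and W :: "('k, 'w) module"
  assumes V: "module K V" and W: "module K W"
begin

lemma presentation_tensor: "presentation K (carrier V \<times> carrier W) (bilinear_rels K V W)"
proof -
  interpret V: module K V by (rule V)
  interpret W: module K W by (rule W)
  interpret F: module K "free_space K (carrier V \<times> carrier W)"
    by (rule module_free_space[OF V.R.cring_axioms])
  have "free_gen K (v, w) \<in> carrier (free_space K (carrier V \<times> carrier W))"
    if "v \<in> carrier V" "w \<in> carrier W" for v w
    using that by (intro free_gen_closed[OF V.R.cring_axioms]) simp
  then show ?thesis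
    by unfold_locales (auto simp: bilinear_rels_def Let_def)
qed

lemma module_tensor: "module K (tensor_space K V W)"
  unfolding tensor_space_def by (rule presentation.module_presented[OF presentation_tensor])

lemma bilinear_pure_tensor: "bilinear_map K V W (tensor_space K V W) (pure_tensor K V W)"
proof -
  interpret V: module K V by (rule V)
  interpret W: module K W by (rule W)
  interpret P: presentation K "carrier V \<times> carrier W" "bilinear_rels K V W"
    by (rule presentation_tensor)
  show ?thesis
    unfolding tensor_space_def pure_tensor_def
    by (intro bilinear_mapI linear_mapI P.presented_gen_closed P.presented_gen_add P.presented_gen_smult)
      (auto simp: bilinear_rels_def Let_def)
qed

lemma pure_tensor_closed:
  "v \<in> carrier V \<Longrightarrow> w \<in> carrier W \<Longrightarrow> pure_tensor K V W v w \<in> carrier (tensor_space K V W)"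
  by (rule bilinear_map_closed[OF bilinear_pure_tensor])

lemma tensor_eqI:
  assumes "module K Z" and "linear_map K (tensor_space K V W) Z f" and "linear_map K (tensor_space K V W) Z g"
    and "\<And>v w. v \<in> carrier V \<Longrightarrow> w \<in> carrier W \<Longrightarrow> f (pure_tensor K V W v w) = g (pure_tensor K V W v w)"
    and "t \<in> carrier (tensor_space K V W)"
  shows "f t = g t"
  using assms unfolding tensor_space_def pure_tensor_def
  by (intro presentation.presented_eqI[OF presentation_tensor, of Z f g t]) auto

lemma linear_map_pure_left:
  assumes "linear_map K U V f" and "w \<in> carrier W"
  shows "linear_map K U (tensor_space K V W) (\<lambda>u. pure_tensor K V W (f u) w)"
  by (rule linear_map_compose[OF bilinear_map_left[OF bilinear_pure_tensor assms(2)] assms(1)])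

lemma linear_map_pure_right:
  assumes "linear_map K U W f" and "v \<in> carrier V"
  shows "linear_map K U (tensor_space K V W) (\<lambda>u. pure_tensor K V W v (f u))"
  by (rule linear_map_compose[OF bilinear_map_right[OF bilinear_pure_tensor assms(2)] assms(1)])

context
  fixes Z :: "('k, 'z) module"
  assumes Z: "module K Z"
begin

lemma tensor_lift_facts:
  assumes \<beta>: "bilinear_map K V W Z \<beta>"
  shows "linear_map K (tensor_space K V W) Z (tensor_lift K Z \<beta>) \<and>
    (\<forall>v\<in>carrier V. \<forall>w\<in>carrier W. tensor_lift K Z \<beta> (pure_tensor K V W v w) = \<beta> v w)"
proof -
  interpret V: module K V by (rule V)
  interpret W: module K W by (rule W)
  interpret Z: module K Z by (rule Z)
  interpret P: presentation K "carrier V \<times> carrier W" "bilinear_rels K V W"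
    by (rule presentation_tensor)
  have cl: "(case x of (v, w) \<Rightarrow> \<beta> v w) \<in> carrier Z" if "x \<in> carrier V \<times> carrier W" for x
    using that by (auto intro: bilinear_map_closed[OF \<beta>])
  note add = P.eval_rel_add[OF Z, of "\<lambda>(v, w). \<beta> v w", OF cl]
  note smult = P.eval_rel_smult[OF Z, of "\<lambda>(v, w). \<beta> v w", OF cl]
  have l: "linear_map K W Z (\<beta> v)" if "v \<in> carrier V" for v by (rule bilinear_map_right[OF \<beta> that])
  have r: "linear_map K V Z (\<lambda>v. \<beta> v w)" if "w \<in> carrier W" for w by (rule bilinear_map_left[OF \<beta> that])
  have resp: "(\<Oplus>\<^bsub>Z\<^esub>x\<in>{x. r x \<noteq> \<zero>\<^bsub>K\<^esub>}. r x \<odot>\<^bsub>Z\<^esub> (case x of (v, w) \<Rightarrow> \<beta> v w)) = \<zero>\<^bsub>Z\<^esub>"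
    if "r \<in> bilinear_rels K V W" for r
    using that
  proof (cases rule: bilinear_rels_cases)
    case (1 v v' w)
    then show ?thesis by (intro add[OF _ _ _ _ _ 1(4)]) (simp_all add: linear_map_add[OF r])
  next
    case (2 v w w')
    then show ?thesis by (intro add[OF _ _ _ _ _ 2(4)]) (simp_all add: linear_map_add[OF l])
  next
    case (3 c v w)
    then show ?thesis by (intro smult[OF _ _ _ _ _ 3(4)]) (simp_all add: linear_map_smult[OF r])
  next
    case (4 c v w)
    then show ?thesis by (intro smult[OF _ _ _ _ _ 4(4)]) (simp_all add: linear_map_smult[OF l])
  qed
  show ?thesis
    using P.linear_map_presented_lift[OF Z cl resp] P.presented_lift_gen[OF Z cl resp]
    by (auto simp: tensor_space_def pure_tensor_def tensor_lift_def[abs_def])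
qed

lemma linear_map_tensor_lift:
  "bilinear_map K V W Z \<beta> \<Longrightarrow> linear_map K (tensor_space K V W) Z (tensor_lift K Z \<beta>)"
  using tensor_lift_facts by blast

lemma tensor_lift_pure:
  "bilinear_map K V W Z \<beta> \<Longrightarrow> v \<in> carrier V \<Longrightarrow> w \<in> carrier W \<Longrightarrow>
    tensor_lift K Z \<beta> (pure_tensor K V W v w) = \<beta> v w"
  using tensor_lift_facts by blast

lemma tensor_lift_closed:
  "bilinear_map K V W Z \<beta> \<Longrightarrow> t \<in> carrier (tensor_space K V W) \<Longrightarrow> tensor_lift K Z \<beta> t \<in> carrier Z"
  by (rule linear_map_closed[OF linear_map_tensor_lift])

lemma tensor_lift_unique:
  assumes "bilinear_map K V W Z \<beta>" and "linear_map K (tensor_space K V W) Z f"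
    and "\<And>v w. v \<in> carrier V \<Longrightarrow> w \<in> carrier W \<Longrightarrow> f (pure_tensor K V W v w) = \<beta> v w"
    and "t \<in> carrier (tensor_space K V W)"
  shows "f t = tensor_lift K Z \<beta> t"
  by (rule tensor_eqI[OF Z assms(2) linear_map_tensor_lift[OF assms(1)] _ assms(4)])
    (simp add: assms(3) tensor_lift_pure[OF assms(1)])

text \<open>Rewriting under a Sweedler sum. Agreement on the carriers transfers bilinearity from
  \<open>\<beta>\<close> to \<open>\<gamma>\<close>, and uniqueness of the lift gives the
  equality.\<close>

lemma tensor_lift_cong:
  assumes "bilinear_map K V W Z \<beta>"
    and eq: "\<And>v w. v \<in> carrier V \<Longrightarrow> w \<in> carrier W \<Longrightarrow> \<gamma> v w = \<beta> v w"
    and "t \<in> carrier (tensor_space K V W)"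
  shows "tensor_lift K Z \<gamma> t = tensor_lift K Z \<beta> t"
proof -
  have \<gamma>: "bilinear_map K V W Z \<gamma>"
  proof (rule bilinear_mapI)
    show "linear_map K W Z (\<gamma> v)" if "v \<in> carrier V" for v
      by (rule linear_map_cong[OF W bilinear_map_right[OF assms(1) that] eq[OF that]])
    show "linear_map K V Z (\<lambda>v. \<gamma> v w)" if "w \<in> carrier W" for w
      by (rule linear_map_cong[OF V bilinear_map_left[OF assms(1) that] eq[OF _ that]])
  qed
  show ?thesis
    by (rule tensor_lift_unique[OF assms(1) linear_map_tensor_lift[OF \<gamma>] _ assms(3)])
      (simp add: tensor_lift_pure[OF \<gamma>] eq)
qed

text \<open>A Sweedler sum depends linearly on a parameter of its summands: for fixed parameters,
  additivity and homogeneity are equations between linear maps of the tensor \<open>t\<close>, and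
  on pure tensors they are the hypothesis \<open>lin\<close>.\<close>

lemma linear_map_tensor_lift_param:
  assumes "\<And>u. u \<in> carrier U \<Longrightarrow> bilinear_map K V W Z (\<beta> u)"
    and lin: "\<And>v w. v \<in> carrier V \<Longrightarrow> w \<in> carrier W \<Longrightarrow> linear_map K U Z (\<lambda>u. \<beta> u v w)"
    and U: "module K U" and t: "t \<in> carrier (tensor_space K V W)"
  shows "linear_map K U Z (\<lambda>u. tensor_lift K Z (\<beta> u) t)"
proof -
  interpret U: module K U by (rule U)
  note L = linear_map_tensor_lift[OF assms(1)] and P = tensor_lift_pure[OF assms(1)]
  show ?thesis
  proof (rule linear_mapI)
    fix x y assume xy: "x \<in> carrier U" "y \<in> carrier U"
    show "tensor_lift K Z (\<beta> (x \<oplus>\<^bsub>U\<^esub> y)) t = tensor_lift K Z (\<beta> x) t \<oplus>\<^bsub>Z\<^esub> tensor_lift K Z (\<beta> y) t"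
      by (rule tensor_eqI[OF Z L linear_map_plus[OF Z L L] _ t]) (simp_all add: xy P linear_map_add[OF lin])
  next
    fix c x assume cx: "c \<in> carrier K" "x \<in> carrier U"
    show "tensor_lift K Z (\<beta> (c \<odot>\<^bsub>U\<^esub> x)) t = c \<odot>\<^bsub>Z\<^esub> tensor_lift K Z (\<beta> x) t"
      by (rule tensor_eqI[OF Z L linear_map_scale[OF Z L] _ t]) (simp_all add: cx P linear_map_smult[OF lin])
  qed (simp add: tensor_lift_closed assms t)
qed

end

lemma tensor_lift_comp:
  assumes "module K Z" and "module K Z'" and "linear_map K Z Z' f" and "bilinear_map K V W Z \<beta>"
    and "t \<in> carrier (tensor_space K V W)"
  shows "f (tensor_lift K Z \<beta> t) = tensor_lift K Z' (\<lambda>v w. f (\<beta> v w)) t"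
  by (rule tensor_lift_unique[OF assms(2) bilinear_map_comp[OF assms(3,4)]
        linear_map_compose[OF assms(3) linear_map_tensor_lift[OF assms(1,4)]] _ assms(5)])
    (simp add: tensor_lift_pure[OF assms(1,4)])

end

section \<open>Functoriality of the tensor product and the flip\<close>

lemma tensor_map_bilinear:
  assumes "module K V2" and "module K W2" and "linear_map K V1 V2 f" and "linear_map K W1 W2 g"
  shows "bilinear_map K V1 W1 (tensor_space K V2 W2) (\<lambda>v w. pure_tensor K V2 W2 (f v) (g w))"
  using bilinear_map_comp2[OF bilinear_pure_tensor[OF assms(1,2)] assms(3,4)] .

lemma
  assumes "module K V1" and "module K W1" and "module K V2" and "module K W2"
    and "linear_map K V1 V2 f" and "linear_map K W1 W2 g"
  shows linear_map_tensor_map: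
      "linear_map K (tensor_space K V1 W1) (tensor_space K V2 W2) (tensor_map K V2 W2 f g)"
    and tensor_map_pure: "v \<in> carrier V1 \<Longrightarrow> w \<in> carrier W1 \<Longrightarrow>
      tensor_map K V2 W2 f g (pure_tensor K V1 W1 v w) = pure_tensor K V2 W2 (f v) (g w)"
  using linear_map_tensor_lift[OF assms(1,2) module_tensor tensor_map_bilinear]
    tensor_lift_pure[OF assms(1,2) module_tensor tensor_map_bilinear] assms
  by (simp_all add: tensor_map_def)

lemma
  assumes "module K V" and "module K W"
  shows linear_map_tensor_flip:
      "linear_map K (tensor_space K V W) (tensor_space K W V) (tensor_flip K V W)"
    and tensor_flip_pure: "v \<in> carrier V \<Longrightarrow> w \<in> carrier W \<Longrightarrow>
      tensor_flip K V W (pure_tensor K V W v w) = pure_tensor K W V w v"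
  using linear_map_tensor_lift[OF assms module_tensor bilinear_map_swap[OF bilinear_pure_tensor]]
    tensor_lift_pure[OF assms module_tensor bilinear_map_swap[OF bilinear_pure_tensor]] assms
  by (simp_all add: tensor_flip_def)

section \<open>Rebracketing of threefold tensor products\<close>

context
  fixes K :: "'k ring" and U :: "('k, 'u) module" and V :: "('k, 'v) module" and W :: "('k, 'w) module"
  assumes U: "module K U" and V: "module K V" and W: "module K W"
begin

lemma bilinear_tensor_assoc_inner:
  "w \<in> carrier W \<Longrightarrow> bilinear_map K U V (tensor_space K U (tensor_space K V W))
     (\<lambda>u v. pure_tensor K U (tensor_space K V W) u (pure_tensor K V W v w))"
  by (intro bilinear_map_comp2[OF bilinear_pure_tensor[OF U module_tensor[OF V W]]]
      linear_map_id(2) bilinear_map_left[OF bilinear_pure_tensor[OF V W]])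

lemma bilinear_tensor_assoc:
  "bilinear_map K (tensor_space K U V) W (tensor_space K U (tensor_space K V W))
     (\<lambda>s w. tensor_lift K (tensor_space K U (tensor_space K V W))
         (\<lambda>u v. pure_tensor K U (tensor_space K V W) u (pure_tensor K V W v w)) s)"
proof (rule bilinear_mapI)
  fix s assume "s \<in> carrier (tensor_space K U V)"
  then show "linear_map K W (tensor_space K U (tensor_space K V W)) (\<lambda>w. tensor_lift K (tensor_space K U (tensor_space K V W))
         (\<lambda>u v. pure_tensor K U (tensor_space K V W) u (pure_tensor K V W v w)) s)"
    by (intro linear_map_tensor_lift_param[OF U V module_tensor[OF U module_tensor[OF V W]] _ _ W]
        bilinear_tensor_assoc_inner linear_map_pure_right[OF U module_tensor[OF V W]]
        linear_map_pure_right[OF V W] linear_map_id(2))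
next
  fix w assume "w \<in> carrier W"
  then show "linear_map K (tensor_space K U V) (tensor_space K U (tensor_space K V W)) (tensor_lift K (tensor_space K U (tensor_space K V W))
         (\<lambda>u v. pure_tensor K U (tensor_space K V W) u (pure_tensor K V W v w)))"
    by (intro linear_map_tensor_lift[OF U V module_tensor[OF U module_tensor[OF V W]]] bilinear_tensor_assoc_inner)
qed

lemma linear_map_tensor_assoc:
  "linear_map K (tensor_space K (tensor_space K U V) W) (tensor_space K U (tensor_space K V W))
     (tensor_assoc K U V W)"
  unfolding tensor_assoc_def Let_def
  by (intro linear_map_tensor_lift bilinear_tensor_assoc module_tensor U V W)

text \<open>The left factor \<open>s\<close> is an arbitrary tensor, because it will be the image
  under \<Phi> of a pure tensor, which need not be pure.\<close>

lemma tensor_assoc_pure: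
  "s \<in> carrier (tensor_space K U V) \<Longrightarrow> w \<in> carrier W \<Longrightarrow>
     tensor_assoc K U V W (pure_tensor K (tensor_space K U V) W s w) =
     tensor_lift K (tensor_space K U (tensor_space K V W))
       (\<lambda>u v. pure_tensor K U (tensor_space K V W) u (pure_tensor K V W v w)) s"
  unfolding tensor_assoc_def Let_def
  by (intro tensor_lift_pure[of K "tensor_space K U V"] bilinear_tensor_assoc module_tensor U V W)

lemma bilinear_tensor_assoc_inv_inner:
  "u \<in> carrier U \<Longrightarrow> bilinear_map K V W (tensor_space K (tensor_space K U V) W)
     (\<lambda>v w. pure_tensor K (tensor_space K U V) W (pure_tensor K U V u v) w)"
  by (intro bilinear_map_comp2[OF bilinear_pure_tensor[OF module_tensor[OF U V] W]]
      linear_map_id(2) bilinear_map_right[OF bilinear_pure_tensor[OF U V]])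

lemma bilinear_tensor_assoc_inv:
  "bilinear_map K U (tensor_space K V W) (tensor_space K (tensor_space K U V) W)
     (\<lambda>u s. tensor_lift K (tensor_space K (tensor_space K U V) W)
         (\<lambda>v w. pure_tensor K (tensor_space K U V) W (pure_tensor K U V u v) w) s)"
proof (rule bilinear_mapI)
  fix u assume "u \<in> carrier U"
  then show "linear_map K (tensor_space K V W) (tensor_space K (tensor_space K U V) W) (tensor_lift K (tensor_space K (tensor_space K U V) W)
         (\<lambda>v w. pure_tensor K (tensor_space K U V) W (pure_tensor K U V u v) w))"
    by (intro linear_map_tensor_lift[OF V W module_tensor[OF module_tensor[OF U V] W]] bilinear_tensor_assoc_inv_inner)
next
  fix s assume "s \<in> carrier (tensor_space K V W)"
  then show "linear_map K U (tensor_space K (tensor_space K U V) W) (\<lambda>u. tensor_lift K (tensor_space K (tensor_space K U V) W)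
         (\<lambda>v w. pure_tensor K (tensor_space K U V) W (pure_tensor K U V u v) w) s)"
    by (intro linear_map_tensor_lift_param[OF V W module_tensor[OF module_tensor[OF U V] W] _ _ U]
        bilinear_tensor_assoc_inv_inner linear_map_pure_left[OF module_tensor[OF U V] W]
        linear_map_pure_left[OF U V] linear_map_id(2))
qed

lemma linear_map_tensor_assoc_inv:
  "linear_map K (tensor_space K U (tensor_space K V W)) (tensor_space K (tensor_space K U V) W)
     (tensor_assoc_inv K U V W)"
  unfolding tensor_assoc_inv_def Let_def
  by (intro linear_map_tensor_lift bilinear_tensor_assoc_inv module_tensor U V W)

lemma tensor_assoc_inv_pure:
  assumes "u \<in> carrier U" and "v \<in> carrier V" and "w \<in> carrier W"
  shows "tensor_assoc_inv K U V W (pure_tensor K U (tensor_space K V W) u (pure_tensor K V W v w)) =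
     pure_tensor K (tensor_space K U V) W (pure_tensor K U V u v) w"
  using assms unfolding tensor_assoc_inv_def Let_def
  by (simp add: tensor_lift_pure[OF U module_tensor[OF V W] module_tensor[OF module_tensor[OF U V] W] bilinear_tensor_assoc_inv]
      tensor_lift_pure[OF V W module_tensor[OF module_tensor[OF U V] W] bilinear_tensor_assoc_inv_inner]
      pure_tensor_closed[OF V W])

lemma tensor3_eqI:
  assumes Z: "module K Z" and f: "linear_map K (tensor_space K U (tensor_space K V W)) Z f"
    and g: "linear_map K (tensor_space K U (tensor_space K V W)) Z g"
    and eq: "\<And>u v w. u \<in> carrier U \<Longrightarrow> v \<in> carrier V \<Longrightarrow> w \<in> carrier W \<Longrightarrow>
      f (pure_tensor K U (tensor_space K V W) u (pure_tensor K V W v w)) =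
      g (pure_tensor K U (tensor_space K V W) u (pure_tensor K V W v w))"
    and t: "t \<in> carrier (tensor_space K U (tensor_space K V W))"
  shows "f t = g t"
proof (rule tensor_eqI[OF U module_tensor[OF V W] Z f g _ t])
  fix u s assume u: "u \<in> carrier U" and s: "s \<in> carrier (tensor_space K V W)"
  have p: "linear_map K (tensor_space K V W) (tensor_space K U (tensor_space K V W)) (pure_tensor K U (tensor_space K V W) u)"
    by (rule bilinear_map_right[OF bilinear_pure_tensor[OF U module_tensor[OF V W]] u])
  show "f (pure_tensor K U (tensor_space K V W) u s) = g (pure_tensor K U (tensor_space K V W) u s)"
    by (rule tensor_eqI[OF V W Z linear_map_compose[OF f p] linear_map_compose[OF g p] eq[OF u] s])
qed

end

section \<open>The operators Id \<otimes> \<Phi> and \<Phi> \<otimes> Id as Sweedler sums\<close>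

context
  fixes K :: "'k ring" and A :: "('k, 'a) module" and \<Phi> :: "('k, 'a, 'a) tensor \<Rightarrow> ('k, 'a, 'a) tensor"
  assumes A: "module K A" and \<Phi>: "linear_map K (tensor_space K A A) (tensor_space K A A) \<Phi>"
begin

lemma linear_map_id_tensor:
  "linear_map K (tensor_space K A (tensor_space K A A)) (tensor_space K A (tensor_space K A A)) (id_tensor K A \<Phi>)"
  unfolding id_tensor_def by (intro linear_map_tensor_map module_tensor A \<Phi> linear_map_id)

lemma id_tensor_pure:
  "a \<in> carrier A \<Longrightarrow> s \<in> carrier (tensor_space K A A) \<Longrightarrow>
    id_tensor K A \<Phi> (pure_tensor K A (tensor_space K A A) a s) = pure_tensor K A (tensor_space K A A) a (\<Phi> s)"
  unfolding id_tensor_def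
  using tensor_map_pure[OF A module_tensor[OF A A] A module_tensor[OF A A] linear_map_id(1) \<Phi>] by simp

lemma linear_map_tensor_id:
  "linear_map K (tensor_space K A (tensor_space K A A)) (tensor_space K A (tensor_space K A A)) (tensor_id K A \<Phi>)"
  unfolding tensor_id_def comp_def
  by (intro linear_map_compose[OF linear_map_tensor_assoc[OF A A A]]
      linear_map_compose[OF linear_map_tensor_map[OF module_tensor[OF A A] A module_tensor[OF A A] A \<Phi> linear_map_id(1)]]
      linear_map_tensor_assoc_inv[OF A A A])

text \<open>The map \<open>L\<close> is arbitrary so that it can contain the operators applied
  later; a composite of operators then unfolds one factor at a time, as in a computation with
  Sweedler notation. The same holds for the counterpart \<open>map_tensor_id\<close>.\<close>

lemma map_id_tensor:
  assumes Z: "module K Z" and L: "linear_map K (tensor_space K A (tensor_space K A A)) Z L"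
    and "a \<in> carrier A" and "b \<in> carrier A" and "c \<in> carrier A"
  shows "L (id_tensor K A \<Phi> (pure_tensor K A (tensor_space K A A) a (pure_tensor K A A b c))) =
    tensor_lift K Z (\<lambda>p q. L (pure_tensor K A (tensor_space K A A) a (pure_tensor K A A p q)))
      (\<Phi> (pure_tensor K A A b c))"
proof -
  have bc: "pure_tensor K A A b c \<in> carrier (tensor_space K A A)"
    using assms by (simp add: pure_tensor_closed[OF A A])
  have p: "linear_map K (tensor_space K A A) Z (\<lambda>s. L (pure_tensor K A (tensor_space K A A) a s))"
    using assms(3) by (intro linear_map_compose[OF L] bilinear_map_right[OF bilinear_pure_tensor] A module_tensor)
  show ?thesis
    unfolding id_tensor_pure[OF assms(3) bc]
    by (rule tensor_lift_unique[OF A A Z bilinear_map_comp[OF p bilinear_pure_tensor[OF A A]] p refl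
          linear_map_closed[OF \<Phi> bc]])
qed

lemma map_tensor_id:
  assumes Z: "module K Z" and L: "linear_map K (tensor_space K A (tensor_space K A A)) Z L"
    and "a \<in> carrier A" and "b \<in> carrier A" and "c \<in> carrier A"
  shows "L (tensor_id K A \<Phi> (pure_tensor K A (tensor_space K A A) a (pure_tensor K A A b c))) =
    tensor_lift K Z (\<lambda>p q. L (pure_tensor K A (tensor_space K A A) p (pure_tensor K A A q c)))
      (\<Phi> (pure_tensor K A A a b))"
proof -
  have ab: "pure_tensor K A A a b \<in> carrier (tensor_space K A A)"
    using assms by (simp add: pure_tensor_closed[OF A A])
  note \<Phi>ab = linear_map_closed[OF \<Phi> ab]
  have "tensor_id K A \<Phi> (pure_tensor K A (tensor_space K A A) a (pure_tensor K A A b c)) =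
      tensor_lift K (tensor_space K A (tensor_space K A A))
       (\<lambda>u v. pure_tensor K A (tensor_space K A A) u (pure_tensor K A A v c)) (\<Phi> (pure_tensor K A A a b))"
    using assms(3-5) ab \<Phi>ab
    by (simp add: tensor_id_def tensor_assoc_inv_pure[OF A A A] tensor_assoc_pure[OF A A A]
        tensor_map_pure[OF module_tensor[OF A A] A module_tensor[OF A A] A \<Phi> linear_map_id(1)])
  then show ?thesis
    using tensor_lift_comp[OF A A module_tensor[OF A module_tensor[OF A A]] Z L bilinear_tensor_assoc_inner[OF A A A assms(5)] \<Phi>ab]
    by simp
qed

end

section \<open>The product on \<open>V \<otimes> A\<close>\<close>

definition tensor3_lift ::
  "'k ring \<Rightarrow> ('k, 'z) module \<Rightarrow> ('u \<Rightarrow> 'v \<Rightarrow> 'w \<Rightarrow> 'z) \<Rightarrow> ('k, 'u, ('k, 'v, 'w) tensor) tensor \<Rightarrow> 'z" where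
  "tensor3_lift K Z g = tensor_lift K Z (\<lambda>u. tensor_lift K Z (g u))"

context
  fixes K :: "'k ring" and U :: "('k, 'u) module" and V :: "('k, 'v) module" and W :: "('k, 'w) module"
    and Z :: "('k, 'z) module" and g
  assumes U: "module K U" and V: "module K V" and W: "module K W" and Z: "module K Z"
    and g: "\<And>u. u \<in> carrier U \<Longrightarrow> bilinear_map K V W Z (g u)"
      "\<And>v w. v \<in> carrier V \<Longrightarrow> w \<in> carrier W \<Longrightarrow> linear_map K U Z (\<lambda>u. g u v w)"
begin

lemma bilinear_tensor3_lift: "bilinear_map K U (tensor_space K V W) Z (\<lambda>u. tensor_lift K Z (g u))"
  by (intro bilinear_mapI linear_map_tensor_lift[OF V W Z] linear_map_tensor_lift_param[OF V W Z _ _ U] g)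

lemma linear_map_tensor3_lift: "linear_map K (tensor_space K U (tensor_space K V W)) Z (tensor3_lift K Z g)"
  unfolding tensor3_lift_def
  by (rule linear_map_tensor_lift[OF U module_tensor[OF V W] Z bilinear_tensor3_lift])

lemma tensor3_lift_pure:
  assumes "u \<in> carrier U" and "v \<in> carrier V" and "w \<in> carrier W"
  shows "tensor3_lift K Z g (pure_tensor K U (tensor_space K V W) u (pure_tensor K V W v w)) = g u v w"
  unfolding tensor3_lift_def
  using assms by (simp add: tensor_lift_pure[OF U module_tensor[OF V W] Z bilinear_tensor3_lift]
      pure_tensor_closed[OF V W] tensor_lift_pure[OF V W Z g(1)])

end

text \<open>The innermost of the three nested lifts in \<open>star_prod\<close>. It is isolated
  because bilinearity of the outer two rests on its linearity in all four arguments.\<close>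

definition star_pure ::
  "'k ring \<Rightarrow> ('k, 'a) module \<Rightarrow> (('k, 'a, 'a) tensor \<Rightarrow> ('k, 'a, 'a) tensor) \<Rightarrow>
   ('k, 'v) module \<Rightarrow> ('a \<Rightarrow> ('k, 'v, 'v) tensor \<Rightarrow> 'v) \<Rightarrow> 'v \<Rightarrow> 'a \<Rightarrow> 'v \<Rightarrow> 'a \<Rightarrow> ('k, 'v, 'a) tensor" where
  "star_pure K A \<Phi> V m x a y b = tensor_lift K (tensor_space K V A)
     (\<lambda>p q. pure_tensor K V A (prod_at K V m q x y) p) (\<Phi> (pure_tensor K A A a b))"

text \<open>On a triple \<open>xa\<close>, \<open>yb\<close>, \<open>zc\<close> the two bracketings of \<open>\<star>\<close> are values of the following two linear maps
  on \<open>A \<otimes> A \<otimes> A\<close>, at images of \<open>a \<otimes> b \<otimes> c\<close> that depend on \<open>\<Phi>\<close> only.\<close>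

definition left_nested ::
  "'k ring \<Rightarrow> ('k, 'a) module \<Rightarrow> ('k, 'v) module \<Rightarrow> ('a \<Rightarrow> ('k, 'v, 'v) tensor \<Rightarrow> 'v) \<Rightarrow>
   'v \<Rightarrow> 'v \<Rightarrow> 'v \<Rightarrow> ('k, 'a, ('k, 'a, 'a) tensor) tensor \<Rightarrow> ('k, 'v, 'a) tensor" where
  "left_nested K A V m x y z = tensor3_lift K (tensor_space K V A)
     (\<lambda>r s q. pure_tensor K V A (prod_at K V m s (prod_at K V m q x y) z) r)"

definition right_nested ::
  "'k ring \<Rightarrow> ('k, 'a) module \<Rightarrow> ('k, 'v) module \<Rightarrow> ('a \<Rightarrow> ('k, 'v, 'v) tensor \<Rightarrow> 'v) \<Rightarrow>
   'v \<Rightarrow> 'v \<Rightarrow> 'v \<Rightarrow> ('k, 'a, ('k, 'a, 'a) tensor) tensor \<Rightarrow> ('k, 'v, 'a) tensor" where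
  "right_nested K A V m x y z = tensor3_lift K (tensor_space K V A)
     (\<lambda>r s q. pure_tensor K V A (prod_at K V m s x (prod_at K V m q y z)) r)"

section \<open>Bilinearity of \<star>\<close>

locale product_family =
  fixes K :: "'k ring" and A :: "('k, 'a) module" and V :: "('k, 'v) module"
    and \<Phi> :: "('k, 'a, 'a) tensor \<Rightarrow> ('k, 'a, 'a) tensor"
    and m :: "'a \<Rightarrow> ('k, 'v, 'v) tensor \<Rightarrow> 'v"
  assumes A: "module K A" and V: "module K V"
    and \<Phi>: "linear_map K (tensor_space K A A) (tensor_space K A A) \<Phi>"
    and m: "linear_map K A (Hom_space K (tensor_space K V V) V) m"
begin

abbreviation "AA \<equiv> tensor_space K A A"
abbreviation "AAA \<equiv> tensor_space K A AA"
abbreviation "VA \<equiv> tensor_space K V A"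
abbreviation "pureA \<equiv> pure_tensor K A A"
abbreviation "pureA3 r s q \<equiv> pure_tensor K A AA r (pureA s q)"
abbreviation "pureVA \<equiv> pure_tensor K V A"
abbreviation "mul \<equiv> prod_at K V m"
abbreviation "star \<equiv> star_prod K A \<Phi> V m"

lemma AA: "module K AA" by (rule module_tensor[OF A A])
lemma VA: "module K VA" by (rule module_tensor[OF V A])

lemma \<Phi>_pure_closed: "a \<in> carrier A \<Longrightarrow> b \<in> carrier A \<Longrightarrow> \<Phi> (pureA a b) \<in> carrier AA"
  by (rule linear_map_closed[OF \<Phi> pure_tensor_closed[OF A A]])

lemma linear_map_m: "a \<in> carrier A \<Longrightarrow> linear_map K (tensor_space K V V) V (m a)"
  using linear_map_closed[OF m] by (simp add: Hom_space_def)

lemma bilinear_mul: "a \<in> carrier A \<Longrightarrow> bilinear_map K V V V (mul a)"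
  unfolding prod_at_def[abs_def] by (rule bilinear_map_comp[OF linear_map_m bilinear_pure_tensor[OF V V]])

lemma mul_closed: "a \<in> carrier A \<Longrightarrow> x \<in> carrier V \<Longrightarrow> y \<in> carrier V \<Longrightarrow> mul a x y \<in> carrier V"
  by (rule bilinear_map_closed[OF bilinear_mul])

lemma linear_map_mul:
  assumes "x \<in> carrier V" and "y \<in> carrier V"
  shows "linear_map K A V (\<lambda>a. mul a x y)"
  using assms
  by (intro linear_mapI mul_closed)
    (simp_all add: prod_at_def linear_map_add[OF m] linear_map_smult[OF m],
      simp_all add: Hom_space_def pure_tensor_closed[OF V V])

lemma bilinear_star_inner:
  assumes "x \<in> carrier V" and "y \<in> carrier V"
  shows "bilinear_map K A A VA (\<lambda>p q. pureVA (mul q x y) p)"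
  using assms
  by (intro bilinear_mapI linear_map_pure_left[OF V A] linear_map_pure_right[OF V A]
      linear_map_mul linear_map_id mul_closed)

lemma star_pure_linear:
  assumes "x \<in> carrier V" and "a \<in> carrier A" and "y \<in> carrier V" and "b \<in> carrier A"
  shows "linear_map K V VA (\<lambda>x. star_pure K A \<Phi> V m x a y b)"
    and "linear_map K V VA (\<lambda>y. star_pure K A \<Phi> V m x a y b)"
    and "linear_map K A VA (\<lambda>a. star_pure K A \<Phi> V m x a y b)"
    and "linear_map K A VA (\<lambda>b. star_pure K A \<Phi> V m x a y b)"
proof -
  note L = linear_map_compose[OF linear_map_tensor_lift[OF A A VA bilinear_star_inner] \<Phi>]
  show "linear_map K V VA (\<lambda>x. star_pure K A \<Phi> V m x a y b)"
    unfolding star_pure_def using assms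
    by (intro linear_map_tensor_lift_param[OF A A VA _ _ V] bilinear_star_inner \<Phi>_pure_closed
        linear_map_pure_left[OF V A] bilinear_map_left[OF bilinear_mul])
  show "linear_map K V VA (\<lambda>y. star_pure K A \<Phi> V m x a y b)"
    unfolding star_pure_def using assms
    by (intro linear_map_tensor_lift_param[OF A A VA _ _ V] bilinear_star_inner \<Phi>_pure_closed
        linear_map_pure_left[OF V A] bilinear_map_right[OF bilinear_mul])
  show "linear_map K A VA (\<lambda>a. star_pure K A \<Phi> V m x a y b)"
    unfolding star_pure_def
    by (rule linear_map_compose[OF L[OF assms(1,3)] bilinear_map_left[OF bilinear_pure_tensor[OF A A] assms(4)]])
  show "linear_map K A VA (\<lambda>b. star_pure K A \<Phi> V m x a y b)"
    unfolding star_pure_def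
    by (rule linear_map_compose[OF L[OF assms(1,3)] bilinear_map_right[OF bilinear_pure_tensor[OF A A] assms(2)]])
qed

lemma star_prod_eq: "star s t = tensor_lift K VA (\<lambda>x a. tensor_lift K VA (star_pure K A \<Phi> V m x a) t) s"
  by (simp add: star_prod_def Let_def star_pure_def[abs_def])

lemma bilinear_star_pure:
  "x \<in> carrier V \<Longrightarrow> a \<in> carrier A \<Longrightarrow> bilinear_map K V A VA (star_pure K A \<Phi> V m x a)"
  by (intro bilinear_mapI star_pure_linear)

lemma bilinear_star_outer:
  assumes "t \<in> carrier VA"
  shows "bilinear_map K V A VA (\<lambda>x a. tensor_lift K VA (star_pure K A \<Phi> V m x a) t)"
  using assms
  by (intro bilinear_mapI linear_map_tensor_lift_param[OF V A VA] bilinear_star_pure star_pure_linear A V)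

lemma bilinear_star: "bilinear_map K VA VA VA star"
  unfolding star_prod_eq[abs_def]
  by (intro bilinear_mapI linear_map_tensor_lift[OF V A VA] linear_map_tensor_lift_param[OF V A VA _ _ VA]
      bilinear_star_outer bilinear_star_pure)

lemma star_pure_pure:
  assumes "x \<in> carrier V" and "a \<in> carrier A" and "y \<in> carrier V" and "b \<in> carrier A"
  shows "star (pureVA x a) (pureVA y b) =
    tensor_lift K VA (\<lambda>p q. pureVA (mul q x y) p) (\<Phi> (pureA a b))"
  using assms unfolding star_prod_eq
  by (simp add: tensor_lift_pure[OF V A VA bilinear_star_outer] pure_tensor_closed[OF V A]
      tensor_lift_pure[OF V A VA bilinear_star_pure] star_pure_def)

lemma
  assumes "x \<in> carrier V" and "y \<in> carrier V" and "z \<in> carrier V"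
  shows linear_map_left_nested: "linear_map K AAA VA (left_nested K A V m x y z)"
    and left_nested_pure: "r \<in> carrier A \<Longrightarrow> s \<in> carrier A \<Longrightarrow> q \<in> carrier A \<Longrightarrow>
      left_nested K A V m x y z (pureA3 r s q) = pureVA (mul s (mul q x y) z) r"
    and linear_map_right_nested: "linear_map K AAA VA (right_nested K A V m x y z)"
    and right_nested_pure: "r \<in> carrier A \<Longrightarrow> s \<in> carrier A \<Longrightarrow> q \<in> carrier A \<Longrightarrow>
      right_nested K A V m x y z (pureA3 r s q) = pureVA (mul s x (mul q y z)) r"
proof -
  have 1: "bilinear_map K A A VA (\<lambda>s q. pureVA (mul s (mul q x y) z) r)"
    if "r \<in> carrier A" for r
    using that assms
    by (intro bilinear_mapI linear_map_pure_left[OF V A] linear_map_mul mul_closed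
        linear_map_compose[OF bilinear_map_left[OF bilinear_mul] linear_map_mul])
  have 2: "bilinear_map K A A VA (\<lambda>s q. pureVA (mul s x (mul q y z)) r)"
    if "r \<in> carrier A" for r
    using that assms
    by (intro bilinear_mapI linear_map_pure_left[OF V A] linear_map_mul mul_closed
        linear_map_compose[OF bilinear_map_right[OF bilinear_mul] linear_map_mul])
  have 3: "linear_map K A VA (\<lambda>r. pureVA (mul s (mul q x y) z) r)"
    and 4: "linear_map K A VA (\<lambda>r. pureVA (mul s x (mul q y z)) r)"
    if "s \<in> carrier A" "q \<in> carrier A" for s q
    using that assms
    by (auto intro!: bilinear_map_right[OF bilinear_pure_tensor[OF V A]] mul_closed)
  show "linear_map K AAA VA (left_nested K A V m x y z)" "linear_map K AAA VA (right_nested K A V m x y z)"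
    unfolding left_nested_def right_nested_def
    by (rule linear_map_tensor3_lift[OF A A A VA 1 3] linear_map_tensor3_lift[OF A A A VA 2 4]; assumption)+
  show "left_nested K A V m x y z (pureA3 r s q) = pureVA (mul s (mul q x y) z) r"
    "right_nested K A V m x y z (pureA3 r s q) = pureVA (mul s x (mul q y z)) r"
    if "r \<in> carrier A" "s \<in> carrier A" "q \<in> carrier A"
    unfolding left_nested_def right_nested_def using that
    by (simp_all add: tensor3_lift_pure[OF A A A VA 1 3] tensor3_lift_pure[OF A A A VA 2 4])
qed

section \<open>The two bracketings of a triple product\<close>

context
  fixes x y z
  assumes x: "x \<in> carrier V" and y: "y \<in> carrier V" and z: "z \<in> carrier V"
begin

text \<open>The first product turns \<open>a\<close>, \<open>b\<close> into \<open>p\<close>,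
  \<open>q\<close> and leaves \<open>p\<close> beside the vector \<open>x *\<^sub>q y\<close>. The
  second product needs \<Phi>(p \<otimes> c), but in p \<otimes> q \<otimes> c the index q stands in
  between; the flip moves it to the end, where \<open>left_nested\<close> expects the index of the
  inner product.\<close>

lemma star_star_left:
  assumes a: "a \<in> carrier A" and b: "b \<in> carrier A" and c: "c \<in> carrier A"
  shows "star (star (pureVA x a) (pureVA y b)) (pureVA z c) = left_nested K A V m x y z
    (tensor_id K A \<Phi> (id_tensor K A (tensor_flip K A A) (tensor_id K A \<Phi> (pureA3 a b c))))"
proof -
  note flip = linear_map_tensor_flip[OF A A]
  have L1: "linear_map K AAA VA (\<lambda>t. left_nested K A V m x y z (tensor_id K A \<Phi> t))"
    by (rule linear_map_compose[OF linear_map_left_nested[OF x y z] linear_map_tensor_id[OF A \<Phi>]])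
  have L: "linear_map K AAA VA (\<lambda>t. left_nested K A V m x y z (tensor_id K A \<Phi> (id_tensor K A (tensor_flip K A A) t)))"
    by (rule linear_map_compose[OF L1 linear_map_id_tensor[OF A flip]])
  have st: "linear_map K VA VA (\<lambda>s. star s (pureVA z c))"
    by (rule bilinear_map_left[OF bilinear_star pure_tensor_closed[OF V A z c]])
  have eq: "left_nested K A V m x y z (tensor_id K A \<Phi> (id_tensor K A (tensor_flip K A A) (pureA3 p q c))) =
      star (pureVA (mul q x y) p) (pureVA z c)" if p: "p \<in> carrier A" and q: "q \<in> carrier A" for p q
  proof -
    have "left_nested K A V m x y z (tensor_id K A \<Phi> (id_tensor K A (tensor_flip K A A) (pureA3 p q c))) =
        left_nested K A V m x y z (tensor_id K A \<Phi> (pureA3 p c q))"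
      using p q c by (simp add: id_tensor_pure[OF A flip] pure_tensor_closed[OF A A] tensor_flip_pure[OF A A])
    also have "\<dots> = tensor_lift K VA (\<lambda>r s. left_nested K A V m x y z (pureA3 r s q)) (\<Phi> (pureA p c))"
      by (rule map_tensor_id[OF A \<Phi> VA linear_map_left_nested[OF x y z] p c q])
    also have "\<dots> = tensor_lift K VA (\<lambda>r s. pureVA (mul s (mul q x y) z) r) (\<Phi> (pureA p c))"
      using q by (intro tensor_lift_cong[OF A A VA] bilinear_star_inner \<Phi>_pure_closed mul_closed x y z p c
          left_nested_pure)
    finally show ?thesis using p q c x y z by (simp add: star_pure_pure mul_closed)
  qed
  have "star (star (pureVA x a) (pureVA y b)) (pureVA z c) =
      tensor_lift K VA (\<lambda>p q. star (pureVA (mul q x y) p) (pureVA z c)) (\<Phi> (pureA a b))"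
    unfolding star_pure_pure[OF x a y b]
    by (rule tensor_lift_comp[OF A A VA VA st bilinear_star_inner[OF x y] \<Phi>_pure_closed[OF a b]])
  also have "\<dots> = tensor_lift K VA (\<lambda>p q. left_nested K A V m x y z (tensor_id K A \<Phi>
      (id_tensor K A (tensor_flip K A A) (pureA3 p q c)))) (\<Phi> (pureA a b))"
    by (rule tensor_lift_cong[OF A A VA bilinear_map_comp[OF st bilinear_star_inner[OF x y]] eq \<Phi>_pure_closed[OF a b], symmetric])
  also have "\<dots> = left_nested K A V m x y z
    (tensor_id K A \<Phi> (id_tensor K A (tensor_flip K A A) (tensor_id K A \<Phi> (pureA3 a b c))))"
    by (rule map_tensor_id[OF A \<Phi> VA L a b c, symmetric])
  finally show ?thesis .
qed

text \<open>The inner product turns \<open>b\<close>, \<open>c\<close> into \<open>p\<close>,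
  \<open>q\<close> and leaves \<open>p\<close> beside its vector. This \<open>p\<close> is already
  adjacent to \<open>a\<close>, so the outer product is \<Phi> \<otimes> Id without a flip, and
  \<open>q\<close> again stands last.\<close>

lemma star_star_right:
  assumes a: "a \<in> carrier A" and b: "b \<in> carrier A" and c: "c \<in> carrier A"
  shows "star (pureVA x a) (star (pureVA y b) (pureVA z c)) =
    right_nested K A V m x y z (tensor_id K A \<Phi> (id_tensor K A \<Phi> (pureA3 a b c)))"
proof -
  have L: "linear_map K AAA VA (\<lambda>t. right_nested K A V m x y z (tensor_id K A \<Phi> t))"
    by (rule linear_map_compose[OF linear_map_right_nested[OF x y z] linear_map_tensor_id[OF A \<Phi>]])
  have st: "linear_map K VA VA (star (pureVA x a))"
    by (rule bilinear_map_right[OF bilinear_star pure_tensor_closed[OF V A x a]])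
  have eq: "right_nested K A V m x y z (tensor_id K A \<Phi> (pureA3 a p q)) =
      star (pureVA x a) (pureVA (mul q y z) p)" if p: "p \<in> carrier A" and q: "q \<in> carrier A" for p q
  proof -
    have "right_nested K A V m x y z (tensor_id K A \<Phi> (pureA3 a p q)) =
        tensor_lift K VA (\<lambda>r s. right_nested K A V m x y z (pureA3 r s q)) (\<Phi> (pureA a p))"
      by (rule map_tensor_id[OF A \<Phi> VA linear_map_right_nested[OF x y z] a p q])
    also have "\<dots> = tensor_lift K VA (\<lambda>r s. pureVA (mul s x (mul q y z)) r) (\<Phi> (pureA a p))"
      using q by (intro tensor_lift_cong[OF A A VA] bilinear_star_inner \<Phi>_pure_closed mul_closed x y z p a
          right_nested_pure)
    finally show ?thesis using p q a x y z by (simp add: star_pure_pure mul_closed)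
  qed
  have "star (pureVA x a) (star (pureVA y b) (pureVA z c)) =
      tensor_lift K VA (\<lambda>p q. star (pureVA x a) (pureVA (mul q y z) p)) (\<Phi> (pureA b c))"
    unfolding star_pure_pure[OF y b z c]
    by (rule tensor_lift_comp[OF A A VA VA st bilinear_star_inner[OF y z] \<Phi>_pure_closed[OF b c]])
  also have "\<dots> = tensor_lift K VA (\<lambda>p q. right_nested K A V m x y z (tensor_id K A \<Phi> (pureA3 a p q))) (\<Phi> (pureA b c))"
    by (rule tensor_lift_cong[OF A A VA bilinear_map_comp[OF st bilinear_star_inner[OF y z]] eq \<Phi>_pure_closed[OF b c], symmetric])
  also have "\<dots> = right_nested K A V m x y z (tensor_id K A \<Phi> (id_tensor K A \<Phi> (pureA3 a b c)))"
    by (rule map_id_tensor[OF A \<Phi> VA L a b c, symmetric])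
  finally show ?thesis .
qed

lemma bilinear_mul_mul: "bilinear_map K A A V (\<lambda>p q. mul p (mul q x y) z)"
  using x y z
  by (intro bilinear_mapI linear_map_mul mul_closed linear_map_compose[OF bilinear_map_left[OF bilinear_mul] linear_map_mul])

text \<open>The factor \<open>r\<close> is inert under Id \<otimes> \<Phi>, so the sum moves inside
  the map v \<mapsto> v \<otimes> r; what stands beside \<open>r\<close> is then the right-hand side
  of \<Phi>-associativity.\<close>

lemma left_nested_id_tensor:
  assumes r: "r \<in> carrier A" and s: "s \<in> carrier A" and q: "q \<in> carrier A"
  shows "left_nested K A V m x y z (id_tensor K A \<Phi> (pureA3 r s q)) =
    pureVA (tensor_lift K V (\<lambda>p q. mul p (mul q x y) z) (\<Phi> (pureA s q))) r"
proof -
  have p: "linear_map K V VA (\<lambda>v. pureVA v r)"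
    by (rule bilinear_map_left[OF bilinear_pure_tensor[OF V A] r])
  have "left_nested K A V m x y z (id_tensor K A \<Phi> (pureA3 r s q)) =
      tensor_lift K VA (\<lambda>p q. left_nested K A V m x y z (pureA3 r p q)) (\<Phi> (pureA s q))"
    by (rule map_id_tensor[OF A \<Phi> VA linear_map_left_nested[OF x y z] r s q])
  also have "\<dots> = tensor_lift K VA (\<lambda>p q. pureVA (mul p (mul q x y) z) r) (\<Phi> (pureA s q))"
    by (rule tensor_lift_cong[OF A A VA bilinear_map_comp[OF p bilinear_mul_mul]
          left_nested_pure[OF x y z r] \<Phi>_pure_closed[OF s q]])
  also have "\<dots> = pureVA (tensor_lift K V (\<lambda>p q. mul p (mul q x y) z) (\<Phi> (pureA s q))) r"
    by (rule tensor_lift_comp[OF A A V VA p bilinear_mul_mul \<Phi>_pure_closed[OF s q], symmetric])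
  finally show ?thesis .
qed

text \<open>\<Phi>-associativity enters for one triple \<open>x\<close>, \<open>y\<close>,
  \<open>z\<close> at a time: the first claim has it for all triples, the third uses it for a single
  letter taken three times.\<close>

lemma right_nested_eq_left_nested:
  assumes "\<And>s q. s \<in> carrier A \<Longrightarrow> q \<in> carrier A \<Longrightarrow>
      mul s x (mul q y z) = tensor_lift K V (\<lambda>p q. mul p (mul q x y) z) (\<Phi> (pureA s q))"
    and "t \<in> carrier AAA"
  shows "right_nested K A V m x y z t = left_nested K A V m x y z (id_tensor K A \<Phi> t)"
  by (rule tensor3_eqI[OF A A A VA linear_map_right_nested[OF x y z]
        linear_map_compose[OF linear_map_left_nested[OF x y z] linear_map_id_tensor[OF A \<Phi>]] _ assms(2)])
    (simp add: assms(1) right_nested_pure[OF x y z] left_nested_id_tensor)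

end

text \<open>Both bracketings are linear in each factor, so the three factors are extended from pure
  to arbitrary tensors one after the other.\<close>

lemma assoc_algebra_starI:
  assumes "\<And>x y z a b c. x \<in> carrier V \<Longrightarrow> y \<in> carrier V \<Longrightarrow> z \<in> carrier V \<Longrightarrow>
      a \<in> carrier A \<Longrightarrow> b \<in> carrier A \<Longrightarrow> c \<in> carrier A \<Longrightarrow>
      star (star (pureVA x a) (pureVA y b)) (pureVA z c) = star (pureVA x a) (star (pureVA y b) (pureVA z c))"
  shows "assoc_algebra K VA star"
proof -
  note B = bilinear_star and p = pure_tensor_closed[OF V A]
  note l = bilinear_map_left[OF B] and r = bilinear_map_right[OF B] and cl = bilinear_map_closed[OF B]
  have 1: "star (star s (pureVA y b)) (pureVA z c) = star s (star (pureVA y b) (pureVA z c))"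
    if "s \<in> carrier VA" "y \<in> carrier V" "z \<in> carrier V" "b \<in> carrier A" "c \<in> carrier A" for s y z b c
    by (rule tensor_eqI[OF V A VA linear_map_compose[OF l l] l assms that(1)]) (use that p cl in simp_all)
  have 2: "star (star s t) (pureVA z c) = star s (star t (pureVA z c))"
    if "s \<in> carrier VA" "t \<in> carrier VA" "z \<in> carrier V" "c \<in> carrier A" for s t z c
    by (rule tensor_eqI[OF V A VA linear_map_compose[OF l r] linear_map_compose[OF r l] 1 that(2)])
      (use that p in simp_all)
  have 3: "star (star s t) u = star s (star t u)"
    if "s \<in> carrier VA" "t \<in> carrier VA" "u \<in> carrier VA" for s t u
    by (rule tensor_eqI[OF V A VA r linear_map_compose[OF r r] 2 that(3)]) (use that cl in simp_all)
  show ?thesis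
    unfolding assoc_algebra_def using VA B 3 by blast
qed

text \<open>\<Phi>-associativity replaces \<open>right_nested\<close> by \<open>left_nested\<close>
  at the cost of one more operator Id \<otimes> \<Phi>. Both bracketings are then values of the same
  map, at the two sides of the lEAS identity.\<close>

lemma lEAS_imp_assoc_algebra:
  assumes l: "lEAS K A \<Phi>" and p: "phi_assoc_algebra K A \<Phi> V m"
  shows "assoc_algebra K VA star"
proof (rule assoc_algebra_starI)
  fix x y z a b c
  assume xyz: "x \<in> carrier V" "y \<in> carrier V" "z \<in> carrier V"
    and abc: "a \<in> carrier A" "b \<in> carrier A" "c \<in> carrier A"
  have abc': "pureA3 a b c \<in> carrier AAA"
    using abc by (intro pure_tensor_closed[OF A AA] pure_tensor_closed[OF A A])
  note cl = linear_map_closed[OF linear_map_tensor_id[OF A \<Phi>] linear_map_closed[OF linear_map_id_tensor[OF A \<Phi>] abc']]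
  have "right_nested K A V m x y z (tensor_id K A \<Phi> (id_tensor K A \<Phi> (pureA3 a b c))) =
      left_nested K A V m x y z (id_tensor K A \<Phi> (tensor_id K A \<Phi> (id_tensor K A \<Phi> (pureA3 a b c))))"
    by (rule right_nested_eq_left_nested[OF xyz _ cl]) (use p xyz in \<open>simp add: phi_assoc_algebra_def\<close>)
  then show "star (star (pureVA x a) (pureVA y b)) (pureVA z c) = star (pureVA x a) (star (pureVA y b) (pureVA z c))"
    unfolding star_star_left[OF xyz abc] star_star_right[OF xyz abc]
    using l abc' by (simp add: lEAS_def)
qed

text \<open>Associativity only yields this identity at the values of \<open>(\<Phi> \<otimes> Id) \<circ> (Id \<otimes> \<Phi>)\<close>.\<close>

lemma assoc_imp_nested_eq:
  assumes as: "assoc_algebra K VA star" and xyz: "x \<in> carrier V" "y \<in> carrier V" "z \<in> carrier V"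
    and t: "t \<in> carrier AAA"
  shows "right_nested K A V m x y z (tensor_id K A \<Phi> (id_tensor K A \<Phi> t)) = left_nested K A V m x y z
    (tensor_id K A \<Phi> (id_tensor K A (tensor_flip K A A) (tensor_id K A \<Phi> t)))"
proof -
  note I = linear_map_id_tensor[OF A] and T = linear_map_tensor_id[OF A \<Phi>]
    and flip = linear_map_tensor_flip[OF A A]
  note p = pure_tensor_closed[OF V A]
  show ?thesis
  proof (rule tensor3_eqI[OF A A A VA
        linear_map_compose[OF linear_map_right_nested[OF xyz] linear_map_compose[OF T I[OF \<Phi>]]]
        linear_map_compose[OF linear_map_left_nested[OF xyz] linear_map_compose[OF T linear_map_compose[OF I[OF flip] T]]] _ t])
    fix a b c assume abc: "a \<in> carrier A" "b \<in> carrier A" "c \<in> carrier A"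
    show "right_nested K A V m x y z (tensor_id K A \<Phi> (id_tensor K A \<Phi> (pureA3 a b c))) = left_nested K A V m x y z
    (tensor_id K A \<Phi> (id_tensor K A (tensor_flip K A A) (tensor_id K A \<Phi> (pureA3 a b c))))"
      unfolding star_star_left[OF xyz abc, symmetric] star_star_right[OF xyz abc, symmetric]
      using as p xyz abc by (simp add: assoc_algebra_def)
  qed
qed

end

section \<open>Linear functionals\<close>

text \<open>Upper bounds for Zorn's lemma. The chain condition serves addition, as two summands lie
  in a common member; nonemptiness provides zero.\<close>

lemma submodule_Union_chain:
  assumes V: "module K V" and chain: "subset.chain {H. submodule H K V \<and> r \<notin> H} C" and "C \<noteq> {}"
  shows "submodule (\<Union>C) K V"
proof -
  interpret V: module K V by fact
  have C: "submodule H K V" if "H \<in> C" for H using chain that by (auto simp: subset_chain_def)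
  show ?thesis
  proof (rule submoduleI'[OF V])
    show "\<Union>C \<subseteq> carrier V" using C submodule_subset by blast
    obtain H where "H \<in> C" using \<open>C \<noteq> {}\<close> by blast
    then show "\<zero>\<^bsub>V\<^esub> \<in> \<Union>C"
      using submodule.axioms(1)[OF C] subgroup.one_closed by fastforce
    fix x y assume "x \<in> \<Union>C" "y \<in> \<Union>C"
    then obtain H H' where H: "H \<in> C" "x \<in> H" "H' \<in> C" "y \<in> H'" by blast
    then have "H \<subseteq> H' \<or> H' \<subseteq> H" using chain by (auto simp: subset_chain_def)
    then obtain N where "N \<in> C" "x \<in> N" "y \<in> N" using H by blast
    then show "x \<oplus>\<^bsub>V\<^esub> y \<in> \<Union>C" using V.submoduleE(5)[OF C] by blast
  next
    fix c x assume "c \<in> carrier K" "x \<in> \<Union>C"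
    then show "c \<odot>\<^bsub>V\<^esub> x \<in> \<Union>C" using V.submoduleE(4)[OF C] by blast
  qed
qed

lemma submodule_add_line:
  assumes V: "module K V" and M: "submodule M K V" and v: "v \<in> carrier V"
  shows "submodule {x \<oplus>\<^bsub>V\<^esub> c \<odot>\<^bsub>V\<^esub> v | x c. x \<in> M \<and> c \<in> carrier K} K V"
proof -
  interpret V: module K V by fact
  note M' = V.submoduleE[OF M]
  show ?thesis
  proof (rule submoduleI'[OF V])
    show "{x \<oplus>\<^bsub>V\<^esub> c \<odot>\<^bsub>V\<^esub> v | x c. x \<in> M \<and> c \<in> carrier K} \<subseteq> carrier V"
      using M'(1) v by auto
    have "\<zero>\<^bsub>V\<^esub> \<in> M" using submodule.axioms(1)[OF M] subgroup.one_closed by force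
    moreover have "\<zero>\<^bsub>V\<^esub> = \<zero>\<^bsub>V\<^esub> \<oplus>\<^bsub>V\<^esub> \<zero>\<^bsub>K\<^esub> \<odot>\<^bsub>V\<^esub> v" using v by simp
    ultimately show "\<zero>\<^bsub>V\<^esub> \<in> {x \<oplus>\<^bsub>V\<^esub> c \<odot>\<^bsub>V\<^esub> v | x c. x \<in> M \<and> c \<in> carrier K}" by blast
  next
    fix x y assume "x \<in> {x \<oplus>\<^bsub>V\<^esub> c \<odot>\<^bsub>V\<^esub> v | x c. x \<in> M \<and> c \<in> carrier K}"
      "y \<in> {x \<oplus>\<^bsub>V\<^esub> c \<odot>\<^bsub>V\<^esub> v | x c. x \<in> M \<and> c \<in> carrier K}"
    then obtain x' c y' d where *: "x = x' \<oplus>\<^bsub>V\<^esub> c \<odot>\<^bsub>V\<^esub> v" "x' \<in> M" "c \<in> carrier K"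
      "y = y' \<oplus>\<^bsub>V\<^esub> d \<odot>\<^bsub>V\<^esub> v" "y' \<in> M" "d \<in> carrier K" by blast
    have cl: "x' \<in> carrier V" "y' \<in> carrier V" using * M'(1) by auto
    have "x \<oplus>\<^bsub>V\<^esub> y = (x' \<oplus>\<^bsub>V\<^esub> y') \<oplus>\<^bsub>V\<^esub> (c \<oplus>\<^bsub>K\<^esub> d) \<odot>\<^bsub>V\<^esub> v"
      using * cl v by (simp add: V.smult_l_distr V.M.a_ac)
    then show "x \<oplus>\<^bsub>V\<^esub> y \<in> {x \<oplus>\<^bsub>V\<^esub> c \<odot>\<^bsub>V\<^esub> v | x c. x \<in> M \<and> c \<in> carrier K}"
      using * M'(5) V.R.a_closed by blast
  next
    fix d x assume d: "d \<in> carrier K" and "x \<in> {x \<oplus>\<^bsub>V\<^esub> c \<odot>\<^bsub>V\<^esub> v | x c. x \<in> M \<and> c \<in> carrier K}"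
    then obtain x' c where *: "x = x' \<oplus>\<^bsub>V\<^esub> c \<odot>\<^bsub>V\<^esub> v" "x' \<in> M" "c \<in> carrier K" by blast
    have "x' \<in> carrier V" using * M'(1) by auto
    then have "d \<odot>\<^bsub>V\<^esub> x = d \<odot>\<^bsub>V\<^esub> x' \<oplus>\<^bsub>V\<^esub> (d \<otimes>\<^bsub>K\<^esub> c) \<odot>\<^bsub>V\<^esub> v"
      using * d v by (simp add: V.smult_r_distr V.smult_assoc1)
    then show "d \<odot>\<^bsub>V\<^esub> x \<in> {x \<oplus>\<^bsub>V\<^esub> c \<odot>\<^bsub>V\<^esub> v | x c. x \<in> M \<and> c \<in> carrier K}"
      using * d M'(4) V.R.m_closed by blast
  qed
qed

text \<open>A submodule \<open>M\<close> that is maximal among those avoiding \<open>r\<close> is a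
  complement of the line through \<open>r\<close>; the functional reads off the coefficient of
  \<open>r\<close>. This takes the place of completing \<open>r\<close> to a basis.\<close>

lemma linear_functional_exists:
  assumes K: "field K" and V: "module K V" and r: "r \<in> carrier V" "r \<noteq> \<zero>\<^bsub>V\<^esub>"
  obtains f where "\<And>v. v \<in> carrier V \<Longrightarrow> f v \<in> carrier K"
    and "\<And>v w. v \<in> carrier V \<Longrightarrow> w \<in> carrier V \<Longrightarrow> f (v \<oplus>\<^bsub>V\<^esub> w) = f v \<oplus>\<^bsub>K\<^esub> f w"
    and "\<And>c v. c \<in> carrier K \<Longrightarrow> v \<in> carrier V \<Longrightarrow> f (c \<odot>\<^bsub>V\<^esub> v) = c \<otimes>\<^bsub>K\<^esub> f v"
    and "f r = \<one>\<^bsub>K\<^esub>"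
proof -
  interpret K: field K by fact
  interpret V: module K V by fact
  let ?S = "{H. submodule H K V \<and> r \<notin> H}"
  have "submodule {\<zero>\<^bsub>V\<^esub>} K V"
    by (rule submoduleI'[OF V]) auto
  then have "\<exists>M\<in>?S. \<forall>X\<in>?S. M \<subseteq> X \<longrightarrow> X = M"
    using r(2) submodule_Union_chain[OF V]
    by (intro subset_Zorn_nonempty) (auto simp: subset_chain_def)
  then obtain M where M: "submodule M K V" "r \<notin> M"
    and max: "\<And>X. submodule X K V \<Longrightarrow> r \<notin> X \<Longrightarrow> M \<subseteq> X \<Longrightarrow> X = M" by blast
  note M' = V.submoduleE[OF M(1)]
  have zero: "\<zero>\<^bsub>V\<^esub> \<in> M" using submodule.axioms(1)[OF M(1)] subgroup.one_closed by force
  have ex: "\<exists>c\<in>carrier K. \<exists>x\<in>M. v = x \<oplus>\<^bsub>V\<^esub> c \<odot>\<^bsub>V\<^esub> r" if v: "v \<in> carrier V" for v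
  proof (cases "v \<in> M")
    case True
    then have "v = v \<oplus>\<^bsub>V\<^esub> \<zero>\<^bsub>K\<^esub> \<odot>\<^bsub>V\<^esub> r" using v r by simp
    then show ?thesis using True by blast
  next
    case False
    \<comment> \<open>By maximality, adjoining \<open>v\<close> to \<open>M\<close> captures
      \<open>r\<close>. The coefficient of \<open>v\<close> in the resulting expression is nonzero
      because \<open>r\<close> is not in \<open>M\<close>, so the expression can be solved for
      \<open>v\<close>.\<close>
    let ?N = "{x \<oplus>\<^bsub>V\<^esub> c \<odot>\<^bsub>V\<^esub> v | x c. x \<in> M \<and> c \<in> carrier K}"
    have N: "submodule ?N K V" by (rule submodule_add_line[OF V M(1) v])
    have "x = x \<oplus>\<^bsub>V\<^esub> \<zero>\<^bsub>K\<^esub> \<odot>\<^bsub>V\<^esub> v" if "x \<in> M" for x using M'(1) that v by auto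
    then have sub: "M \<subseteq> ?N" by blast
    have "v = \<zero>\<^bsub>V\<^esub> \<oplus>\<^bsub>V\<^esub> \<one>\<^bsub>K\<^esub> \<odot>\<^bsub>V\<^esub> v" using v by simp
    then have "v \<in> ?N" using zero by blast
    then have "r \<in> ?N" using max[OF N _ sub] False by blast
    then obtain x c where xc: "x \<in> M" "c \<in> carrier K" "r = x \<oplus>\<^bsub>V\<^esub> c \<odot>\<^bsub>V\<^esub> v" by blast
    have x: "x \<in> carrier V" using xc M'(1) by auto
    have "c \<noteq> \<zero>\<^bsub>K\<^esub>" using xc x v M(2) by auto
    then have c: "c \<in> Units K" using xc(2) by (simp add: K.field_Units)
    let ?d = "inv\<^bsub>K\<^esub> c"
    have d: "?d \<in> carrier K" "?d \<otimes>\<^bsub>K\<^esub> c = \<one>\<^bsub>K\<^esub>" using c by simp_all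
    have "?d \<odot>\<^bsub>V\<^esub> r = ?d \<odot>\<^bsub>V\<^esub> x \<oplus>\<^bsub>V\<^esub> v"
      using xc x v d by (simp add: V.smult_r_distr V.smult_assoc1[symmetric])
    then have "v = (\<ominus>\<^bsub>V\<^esub> (?d \<odot>\<^bsub>V\<^esub> x)) \<oplus>\<^bsub>V\<^esub> ?d \<odot>\<^bsub>V\<^esub> r"
      using x v d by (simp add: V.M.a_assoc[symmetric] V.M.l_neg)
    moreover have "\<ominus>\<^bsub>V\<^esub> (?d \<odot>\<^bsub>V\<^esub> x) \<in> M" using M'(3,4) d xc by blast
    ultimately show ?thesis using d(1) by blast
  qed
  \<comment> \<open>Distinct coefficients would place a nonzero multiple of \<open>r\<close> in
    \<open>M\<close>, and dividing by the scalar would place \<open>r\<close> itself there.\<close>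
  have uniq: "c = d" if cd: "c \<in> carrier K" "d \<in> carrier K" "x \<in> M" "y \<in> M"
      "x \<oplus>\<^bsub>V\<^esub> c \<odot>\<^bsub>V\<^esub> r = y \<oplus>\<^bsub>V\<^esub> d \<odot>\<^bsub>V\<^esub> r" for c d x y
  proof (rule ccontr)
    assume "c \<noteq> d"
    let ?e = "c \<ominus>\<^bsub>K\<^esub> d"
    have e: "?e \<in> carrier K" using cd by simp
    have "c = ?e \<oplus>\<^bsub>K\<^esub> d" using cd(1,2) by (simp add: a_minus_def K.a_assoc K.l_neg)
    then have "?e \<noteq> \<zero>\<^bsub>K\<^esub>" using cd(2) \<open>c \<noteq> d\<close> by auto
    then have u: "?e \<in> Units K" using e by (simp add: K.field_Units)
    have cl: "x \<in> carrier V" "y \<in> carrier V" using cd M'(1) by auto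
    have "?e \<odot>\<^bsub>V\<^esub> r = c \<odot>\<^bsub>V\<^esub> r \<oplus>\<^bsub>V\<^esub> \<ominus>\<^bsub>V\<^esub> (d \<odot>\<^bsub>V\<^esub> r)"
      using cd r by (simp add: a_minus_def V.smult_l_distr V.smult_l_minus)
    also have "c \<odot>\<^bsub>V\<^esub> r = \<ominus>\<^bsub>V\<^esub> x \<oplus>\<^bsub>V\<^esub> (x \<oplus>\<^bsub>V\<^esub> c \<odot>\<^bsub>V\<^esub> r)"
      using cl cd(1-4) r by (simp add: V.M.a_assoc[symmetric] V.M.l_neg)
    also have "\<dots> \<oplus>\<^bsub>V\<^esub> \<ominus>\<^bsub>V\<^esub> (d \<odot>\<^bsub>V\<^esub> r) = \<ominus>\<^bsub>V\<^esub> x \<oplus>\<^bsub>V\<^esub> y"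
      unfolding cd(5) using cl cd r by (simp add: V.M.a_assoc V.M.r_neg)
    finally have "?e \<odot>\<^bsub>V\<^esub> r \<in> M" using M'(3,5) cd by simp
    then have "inv\<^bsub>K\<^esub> ?e \<odot>\<^bsub>V\<^esub> (?e \<odot>\<^bsub>V\<^esub> r) \<in> M" using M'(4) u by simp
    then show False
      using M(2) u e r by (simp add: V.smult_assoc1[symmetric])
  qed
  define f where "f v = (THE c. c \<in> carrier K \<and> (\<exists>x\<in>M. v = x \<oplus>\<^bsub>V\<^esub> c \<odot>\<^bsub>V\<^esub> r))" for v
  have f_eq: "f (x \<oplus>\<^bsub>V\<^esub> c \<odot>\<^bsub>V\<^esub> r) = c" if "c \<in> carrier K" "x \<in> M" for x c
    unfolding f_def using that by (intro the_equality) (auto intro: uniq)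
  show thesis
  proof (rule that[of f])
    fix v assume "v \<in> carrier V"
    then show "f v \<in> carrier K" using ex[of v] f_eq by auto
  next
    fix v w assume v: "v \<in> carrier V" and w: "w \<in> carrier V"
    obtain c x where c: "c \<in> carrier K" "x \<in> M" "v = x \<oplus>\<^bsub>V\<^esub> c \<odot>\<^bsub>V\<^esub> r" using ex[OF v] by blast
    obtain d y where d: "d \<in> carrier K" "y \<in> M" "w = y \<oplus>\<^bsub>V\<^esub> d \<odot>\<^bsub>V\<^esub> r" using ex[OF w] by blast
    have cl: "x \<in> carrier V" "y \<in> carrier V" using c d M'(1) by auto
    have "v \<oplus>\<^bsub>V\<^esub> w = (x \<oplus>\<^bsub>V\<^esub> y) \<oplus>\<^bsub>V\<^esub> (c \<oplus>\<^bsub>K\<^esub> d) \<odot>\<^bsub>V\<^esub> r"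
      using c d cl r by (simp add: V.smult_l_distr V.M.a_ac)
    then show "f (v \<oplus>\<^bsub>V\<^esub> w) = f v \<oplus>\<^bsub>K\<^esub> f w"
      using c d f_eq M'(5) by simp
  next
    fix d v assume d: "d \<in> carrier K" and v: "v \<in> carrier V"
    obtain c x where c: "c \<in> carrier K" "x \<in> M" "v = x \<oplus>\<^bsub>V\<^esub> c \<odot>\<^bsub>V\<^esub> r" using ex[OF v] by blast
    have cl: "x \<in> carrier V" using c M'(1) by auto
    have "d \<odot>\<^bsub>V\<^esub> v = d \<odot>\<^bsub>V\<^esub> x \<oplus>\<^bsub>V\<^esub> (d \<otimes>\<^bsub>K\<^esub> c) \<odot>\<^bsub>V\<^esub> r"
      using c d cl r by (simp add: V.smult_r_distr V.smult_assoc1)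
    then show "f (d \<odot>\<^bsub>V\<^esub> v) = d \<otimes>\<^bsub>K\<^esub> f v"
      using c d f_eq M'(4) by simp
  next
    have "f (\<zero>\<^bsub>V\<^esub> \<oplus>\<^bsub>V\<^esub> \<one>\<^bsub>K\<^esub> \<odot>\<^bsub>V\<^esub> r) = \<one>\<^bsub>K\<^esub>" by (rule f_eq) (simp_all add: zero)
    then show "f r = \<one>\<^bsub>K\<^esub>" using r by simp
  qed
qed

lemma pure_tensor_cancel_right:
  assumes K: "field K" and V: "module K V" and A: "module K A" and r: "r \<in> carrier A" "r \<noteq> \<zero>\<^bsub>A\<^esub>"
    and v: "v \<in> carrier V" "w \<in> carrier V" and eq: "pure_tensor K V A v r = pure_tensor K V A w r"
  shows "v = w"
proof -
  interpret V: module K V by fact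
  obtain f where f: "\<And>a. a \<in> carrier A \<Longrightarrow> f a \<in> carrier K"
    "\<And>a b. a \<in> carrier A \<Longrightarrow> b \<in> carrier A \<Longrightarrow> f (a \<oplus>\<^bsub>A\<^esub> b) = f a \<oplus>\<^bsub>K\<^esub> f b"
    "\<And>c a. c \<in> carrier K \<Longrightarrow> a \<in> carrier A \<Longrightarrow> f (c \<odot>\<^bsub>A\<^esub> a) = c \<otimes>\<^bsub>K\<^esub> f a"
    "f r = \<one>\<^bsub>K\<^esub>"
    using linear_functional_exists[OF K A r] by blast
  have "bilinear_map K V A V (\<lambda>v a. f a \<odot>\<^bsub>V\<^esub> v)"
    by (intro bilinear_mapI linear_mapI)
      (simp_all add: f V.smult_l_distr V.smult_r_distr V.smult_assoc1[symmetric] V.R.m_comm)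
  from tensor_lift_pure[OF V A V this _ r(1)] show ?thesis
    using v eq f(4) by (metis V.smult_one)
qed

section \<open>Inverse maps\<close>

lemma linear_map_inv_into:
  assumes V: "module K V" and f: "linear_map K V W f" and bij: "bij_betw f (carrier V) (carrier W)"
  shows "linear_map K W V (inv_into (carrier V) f)"
proof -
  interpret V: module K V by fact
  let ?g = "inv_into (carrier V) f"
  have inj: "inj_on f (carrier V)" using bij by (rule bij_betw_imp_inj_on)
  have g: "?g w \<in> carrier V" "f (?g w) = w" if "w \<in> carrier W" for w
    using that bij by (auto simp: bij_betw_def intro: inv_into_into f_inv_into_f)
  show ?thesis
  proof (rule linear_mapI)
    fix x y assume xy: "x \<in> carrier W" "y \<in> carrier W"
    have "f (?g x \<oplus>\<^bsub>V\<^esub> ?g y) = x \<oplus>\<^bsub>W\<^esub> y"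
      using g xy by (simp add: linear_map_add[OF f])
    then show "?g (x \<oplus>\<^bsub>W\<^esub> y) = ?g x \<oplus>\<^bsub>V\<^esub> ?g y"
      using inv_into_f_f[OF inj, of "?g x \<oplus>\<^bsub>V\<^esub> ?g y"] g xy by simp
  next
    fix c x assume cx: "c \<in> carrier K" "x \<in> carrier W"
    have "f (c \<odot>\<^bsub>V\<^esub> ?g x) = c \<odot>\<^bsub>W\<^esub> x"
      using g cx by (simp add: linear_map_smult[OF f])
    then show "?g (c \<odot>\<^bsub>W\<^esub> x) = c \<odot>\<^bsub>V\<^esub> ?g x"
      using inv_into_f_f[OF inj, of "c \<odot>\<^bsub>V\<^esub> ?g x"] g cx by simp
  qed (rule g(1))
qed

context
  fixes K :: "'k ring" and A :: "('k, 'a) module" and \<Phi> \<Psi> :: "('k, 'a, 'a) tensor \<Rightarrow> ('k, 'a, 'a) tensor"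
  assumes A: "module K A" and \<Phi>: "linear_map K (tensor_space K A A) (tensor_space K A A) \<Phi>"
    and \<Psi>: "linear_map K (tensor_space K A A) (tensor_space K A A) \<Psi>"
    and inverse: "\<And>s. s \<in> carrier (tensor_space K A A) \<Longrightarrow> \<Phi> (\<Psi> s) = s"
begin

lemma id_tensor_inverse:
  assumes "t \<in> carrier (tensor_space K A (tensor_space K A A))"
  shows "id_tensor K A \<Phi> (id_tensor K A \<Psi> t) = t"
  by (rule tensor_eqI[OF A module_tensor[OF A A] module_tensor[OF A module_tensor[OF A A]]
        linear_map_compose[OF linear_map_id_tensor[OF A \<Phi>] linear_map_id_tensor[OF A \<Psi>]]
        linear_map_id(2) _ assms])
    (simp add: id_tensor_pure[OF A \<Phi>] id_tensor_pure[OF A \<Psi>] linear_map_closed[OF \<Psi>] inverse)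

lemma tensor_id_inverse:
  assumes "t \<in> carrier (tensor_space K A (tensor_space K A A))"
  shows "tensor_id K A \<Phi> (tensor_id K A \<Psi> t) = t"
proof -
  let ?AA = "tensor_space K A A"
  let ?AAA = "tensor_space K A ?AA"
  let ?p = "\<lambda>a b c. pure_tensor K A ?AA a (pure_tensor K A A b c)"
  note AA = module_tensor[OF A A]
  note AAA = module_tensor[OF A AA]
  show ?thesis
  proof (rule tensor3_eqI[OF A A A AAA
        linear_map_compose[OF linear_map_tensor_id[OF A \<Phi>] linear_map_tensor_id[OF A \<Psi>]] linear_map_id(2) _ assms])
    fix a b c assume abc: "a \<in> carrier A" "b \<in> carrier A" "c \<in> carrier A"
    let ?L = "\<lambda>s. tensor_lift K ?AAA (\<lambda>p q. ?p p q c) s"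
    note B = bilinear_tensor_assoc_inner[OF A A A abc(3)]
    have L: "linear_map K ?AA ?AAA ?L" by (rule linear_map_tensor_lift[OF A A AAA B])
    have ab: "pure_tensor K A A a b \<in> carrier ?AA" using abc by (simp add: pure_tensor_closed[OF A A])
    have "tensor_id K A \<Phi> (tensor_id K A \<Psi> (?p a b c)) =
        tensor_lift K ?AAA (\<lambda>p q. tensor_id K A \<Phi> (?p p q c)) (\<Psi> (pure_tensor K A A a b))"
      by (rule map_tensor_id[OF A \<Psi> AAA linear_map_tensor_id[OF A \<Phi>] abc])
    \<comment> \<open>The sum over \<Phi> nested in the sum over \<Psi> is linear in the tensor
      \<Psi>(a \<otimes> b), and so is \<open>?L\<close> after \<Phi>. They agree on pure tensors,
      which collapses the double sum to a single one.\<close>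
    also have "\<dots> = ?L (\<Phi> (\<Psi> (pure_tensor K A A a b)))"
      by (rule tensor_lift_unique[OF A A AAA bilinear_map_comp[OF linear_map_tensor_id[OF A \<Phi>] B]
            linear_map_compose[OF L \<Phi>] _ linear_map_closed[OF \<Psi> ab], symmetric])
        (rule map_tensor_id[OF A \<Phi> AAA linear_map_id(2) _ _ abc(3), symmetric])
    also have "\<dots> = ?p a b c"
      using abc by (simp add: inverse[OF ab] tensor_lift_pure[OF A A AAA B])
    finally show "tensor_id K A \<Phi> (tensor_id K A \<Psi> (?p a b c)) = ?p a b c" .
  qed
qed

end

text \<open>The lEAS identity rewrites the left bracketing so that \<open>right_nested\<close> and
  \<open>left_nested\<close> after Id \<otimes> \<Phi> are compared at one and the same point. That
  point can be prescribed as r \<otimes> a \<otimes> b, and any nonzero \<open>r\<close> can be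
  cancelled from the result.\<close>

lemma (in product_family) nondegenerate_lEAS_imp_phi_assoc:
  assumes K: "field K" and n: "nondegenerate_lEAS K A \<Phi>" and as: "assoc_algebra K VA star"
  shows "phi_assoc_algebra K A \<Phi> V m"
proof -
  interpret A: module K A by (rule A)
  interpret V: module K V by (rule V)
  have l: "lEAS K A \<Phi>" and bij: "bij_betw \<Phi> (carrier AA) (carrier AA)"
    using n by (simp_all add: nondegenerate_lEAS_def)
  let ?\<Psi> = "inv_into (carrier AA) \<Phi>"
  have \<Psi>: "linear_map K AA AA ?\<Psi>" by (rule linear_map_inv_into[OF AA \<Phi> bij])
  have inv: "\<Phi> (?\<Psi> s) = s" if "s \<in> carrier AA" for s
    by (rule bij_betw_inv_into_right[OF bij that])
  have "mul a x (mul b y z) = tensor_lift K V (\<lambda>p q. mul p (mul q x y) z) (\<Phi> (pureA a b))"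
    if xyz: "x \<in> carrier V" "y \<in> carrier V" "z \<in> carrier V" and ab: "a \<in> carrier A" "b \<in> carrier A" for x y z a b
  proof (cases "carrier A = {\<zero>\<^bsub>A\<^esub>}")
    case True
    \<comment> \<open>The zero space offers no \<open>r\<close> to cancel. Here the index
      \<open>a\<close> is zero, and both sides vanish by linearity.\<close>
    then have a: "a = \<zero>\<^bsub>A\<^esub>" using ab by simp
    have 1: "mul a x (mul b y z) = \<zero>\<^bsub>V\<^esub>"
      unfolding a by (rule linear_map_zero[OF A V linear_map_mul]) (use xyz ab in \<open>simp_all add: mul_closed\<close>)
    have "pureA a b = \<zero>\<^bsub>AA\<^esub>"
      unfolding a by (rule linear_map_zero[OF A AA bilinear_map_left[OF bilinear_pure_tensor[OF A A] ab(2)]])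
    then have "tensor_lift K V (\<lambda>p q. mul p (mul q x y) z) (\<Phi> (pureA a b)) = \<zero>\<^bsub>V\<^esub>"
      using linear_map_zero[OF AA AA \<Phi>]
        linear_map_zero[OF AA V linear_map_tensor_lift[OF A A V bilinear_mul_mul[OF xyz]]] by simp
    with 1 show ?thesis by simp
  next
    case False
    then obtain r where r: "r \<in> carrier A" "r \<noteq> \<zero>\<^bsub>A\<^esub>" by blast
    let ?t = "pureA3 r a b"
    have t: "?t \<in> carrier AAA"
      using r ab by (intro pure_tensor_closed[OF A AA] pure_tensor_closed[OF A A])
    \<comment> \<open>The operators are undone in the opposite order, the outer one first;
      \<open>?v\<close> is thus a preimage of \<open>?t\<close> under (\<Phi> \<otimes> Id) \<circ>
      (Id \<otimes> \<Phi>).\<close>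
    let ?u = "tensor_id K A ?\<Psi> ?t"
    let ?v = "id_tensor K A ?\<Psi> ?u"
    have u: "?u \<in> carrier AAA" by (rule linear_map_closed[OF linear_map_tensor_id[OF A \<Psi>] t])
    have v: "?v \<in> carrier AAA" by (rule linear_map_closed[OF linear_map_id_tensor[OF A \<Psi>] u])
    have tv: "tensor_id K A \<Phi> (id_tensor K A \<Phi> ?v) = ?t"
      using id_tensor_inverse[OF A \<Phi> \<Psi> inv u] tensor_id_inverse[OF A \<Phi> \<Psi> inv t] by simp
    have "id_tensor K A \<Phi> (tensor_id K A \<Phi> (id_tensor K A \<Phi> ?v)) =
        tensor_id K A \<Phi> (id_tensor K A (tensor_flip K A A) (tensor_id K A \<Phi> ?v))"
      using l v by (simp add: lEAS_def)
    then have *: "right_nested K A V m x y z ?t = left_nested K A V m x y z (id_tensor K A \<Phi> ?t)"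
      using assoc_imp_nested_eq[OF as xyz v] unfolding tv by simp
    have "pureVA (mul a x (mul b y z)) r = right_nested K A V m x y z ?t"
      by (rule right_nested_pure[OF xyz r(1) ab, symmetric])
    also have "\<dots> = left_nested K A V m x y z (id_tensor K A \<Phi> ?t)"
      by (rule *)
    also have "\<dots> = pureVA (tensor_lift K V (\<lambda>p q. mul p (mul q x y) z) (\<Phi> (pureA a b))) r"
      by (rule left_nested_id_tensor[OF xyz r(1) ab])
    finally show ?thesis
      by (rule pure_tensor_cancel_right[OF K V A r, rotated 2])
        (use xyz ab in \<open>simp_all add: mul_closed tensor_lift_closed[OF A A V bilinear_mul_mul] \<Phi>_pure_closed\<close>)
  qed
  then show ?thesis using V m by (simp add: phi_assoc_algebra_def)
qed

section \<open>Tensor powers and direct sums\<close>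

definition multilinear_map ::
  "'k ring \<Rightarrow> ('k, 'v) module \<Rightarrow> nat \<Rightarrow> ('k, 'z) module \<Rightarrow> ('v list \<Rightarrow> 'z) \<Rightarrow> bool" where
  "multilinear_map K V n Z f \<longleftrightarrow>
     (\<forall>xs\<in>pow_words V n. f xs \<in> carrier Z \<and> (\<forall>i<n. linear_map K V Z (\<lambda>v. f (xs[i := v]))))"

lemma multilinear_mapI:
  assumes "\<And>xs. xs \<in> pow_words V n \<Longrightarrow> f xs \<in> carrier Z"
    and "\<And>xs i. xs \<in> pow_words V n \<Longrightarrow> i < n \<Longrightarrow> linear_map K V Z (\<lambda>v. f (xs[i := v]))"
  shows "multilinear_map K V n Z f"
  using assms by (simp add: multilinear_map_def)

lemma multilinear_map_closed: "multilinear_map K V n Z f \<Longrightarrow> xs \<in> pow_words V n \<Longrightarrow> f xs \<in> carrier Z"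
  by (simp add: multilinear_map_def)

lemma multilinear_map_linear:
  "multilinear_map K V n Z f \<Longrightarrow> xs \<in> pow_words V n \<Longrightarrow> i < n \<Longrightarrow> linear_map K V Z (\<lambda>v. f (xs[i := v]))"
  by (simp add: multilinear_map_def)

lemma pow_words_update: "xs \<in> pow_words V n \<Longrightarrow> v \<in> carrier V \<Longrightarrow> xs[i := v] \<in> pow_words V n"
  using set_update_subset_insert[of xs i v] by (auto simp: pow_words_def)

lemma pow_words_snoc: "xs \<in> pow_words V n \<Longrightarrow> v \<in> carrier V \<Longrightarrow> xs @ [v] \<in> pow_words V (Suc n)"
  by (auto simp: pow_words_def)

lemma pow_words_rev: "rev xs \<in> pow_words V n \<longleftrightarrow> xs \<in> pow_words V n"
  by (simp add: pow_words_def)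

lemma multilinear_rels_cases:
  assumes "r \<in> multilinear_rels K V n"
  obtains xs i v v' where "xs \<in> pow_words V n" "i < n" "v \<in> carrier V" "v' \<in> carrier V"
      "r = free_gen K (xs[i := v \<oplus>\<^bsub>V\<^esub> v']) \<ominus>\<^bsub>free_space K (pow_words V n)\<^esub>
        (free_gen K (xs[i := v]) \<oplus>\<^bsub>free_space K (pow_words V n)\<^esub> free_gen K (xs[i := v']))"
  | xs i c v where "xs \<in> pow_words V n" "i < n" "c \<in> carrier K" "v \<in> carrier V"
      "r = free_gen K (xs[i := c \<odot>\<^bsub>V\<^esub> v]) \<ominus>\<^bsub>free_space K (pow_words V n)\<^esub>
        (c \<odot>\<^bsub>free_space K (pow_words V n)\<^esub> free_gen K (xs[i := v]))"
  using assms unfolding multilinear_rels_def Let_def by (elim UnE CollectE exE conjE) blast+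

context
  fixes K :: "'k ring" and V :: "('k, 'v) module"
  assumes V: "module K V"
begin

lemma presentation_pow: "presentation K (pow_words V n) (multilinear_rels K V n)"
proof -
  interpret V: module K V by (rule V)
  interpret F: module K "free_space K (pow_words V n)"
    by (rule module_free_space[OF V.R.cring_axioms])
  have "free_gen K (xs[i := v]) \<in> carrier (free_space K (pow_words V n))"
    if "xs \<in> pow_words V n" "v \<in> carrier V" for xs i v
    using that by (intro free_gen_closed[OF V.R.cring_axioms] pow_words_update)
  then show ?thesis
    by unfold_locales (auto elim!: multilinear_rels_cases)
qed

lemma module_pow: "module K (tensor_pow K V n)"
  unfolding tensor_pow_def by (rule presentation.module_presented[OF presentation_pow])

lemma multilinear_pure_pow: "multilinear_map K V n (tensor_pow K V n) (pure_pow K V)"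
proof -
  interpret V: module K V by (rule V)
  interpret P: presentation K "pow_words V n" "multilinear_rels K V n" by (rule presentation_pow)
  \<comment> \<open>\<open>pure_pow\<close> reads the exponent off the length of its list, whereas
    the presentation is indexed by \<open>n\<close>; list update does not change the length.\<close>
  have eq: "pure_pow K V xs = presented_gen K (pow_words V n) (multilinear_rels K V n) xs"
    if "xs \<in> pow_words V n" for xs
    using that by (auto simp: pure_pow_def pow_words_def)
  show ?thesis
    unfolding tensor_pow_def
  proof (rule multilinear_mapI)
    fix xs i assume xs: "xs \<in> pow_words V n" and i: "i < n"
    note u = pow_words_update[OF xs]
    show "linear_map K V (presented_space K (pow_words V n) (multilinear_rels K V n))
        (\<lambda>v. pure_pow K V (xs[i := v]))"
    proof (rule linear_mapI)
      fix x y assume xy: "x \<in> carrier V" "y \<in> carrier V"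
      then show "pure_pow K V (xs[i := x \<oplus>\<^bsub>V\<^esub> y]) = pure_pow K V (xs[i := x])
          \<oplus>\<^bsub>presented_space K (pow_words V n) (multilinear_rels K V n)\<^esub> pure_pow K V (xs[i := y])"
        unfolding eq[OF u[OF xy(1)]] eq[OF u[OF xy(2)]] eq[OF u[OF V.M.a_closed[OF xy]]]
        using xs i by (intro P.presented_gen_add u V.M.a_closed) (auto simp: multilinear_rels_def Let_def)
    next
      fix c x assume cx: "c \<in> carrier K" "x \<in> carrier V"
      then show "pure_pow K V (xs[i := c \<odot>\<^bsub>V\<^esub> x]) =
          c \<odot>\<^bsub>presented_space K (pow_words V n) (multilinear_rels K V n)\<^esub> pure_pow K V (xs[i := x])"
        unfolding eq[OF u[OF cx(2)]] eq[OF u[OF V.smult_closed[OF cx]]]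
        using xs i by (intro P.presented_gen_smult u V.smult_closed) (auto simp: multilinear_rels_def Let_def)
    qed (simp add: eq u P.presented_gen_closed)
  qed (simp add: eq P.presented_gen_closed)
qed

lemma pure_pow_closed: "xs \<in> pow_words V n \<Longrightarrow> pure_pow K V xs \<in> carrier (tensor_pow K V n)"
  by (rule multilinear_map_closed[OF multilinear_pure_pow])

lemma pow_eqI:
  assumes "module K Z" and "linear_map K (tensor_pow K V n) Z f" and "linear_map K (tensor_pow K V n) Z g"
    and eq: "\<And>xs. xs \<in> pow_words V n \<Longrightarrow> f (pure_pow K V xs) = g (pure_pow K V xs)"
    and "t \<in> carrier (tensor_pow K V n)"
  shows "f t = g t"
proof (rule presentation.presented_eqI[OF presentation_pow])
  fix xs assume "xs \<in> pow_words V n"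
  then show "f (presented_gen K (pow_words V n) (multilinear_rels K V n) xs) =
      g (presented_gen K (pow_words V n) (multilinear_rels K V n) xs)"
    using eq[of xs] by (simp add: pure_pow_def pow_words_def)
qed (use assms in \<open>simp_all add: tensor_pow_def\<close>)

context
  fixes Z :: "('k, 'z) module"
  assumes Z: "module K Z"
begin

lemma pow_lift_facts:
  assumes f: "multilinear_map K V n Z f"
  shows "linear_map K (tensor_pow K V n) Z (presented_lift K Z f) \<and>
    (\<forall>xs\<in>pow_words V n. presented_lift K Z f (pure_pow K V xs) = f xs)"
proof -
  interpret V: module K V by (rule V)
  interpret P: presentation K "pow_words V n" "multilinear_rels K V n" by (rule presentation_pow)
  note cl = multilinear_map_closed[OF f] and lin = multilinear_map_linear[OF f]
  have resp: "(\<Oplus>\<^bsub>Z\<^esub>x\<in>{x. r x \<noteq> \<zero>\<^bsub>K\<^esub>}. r x \<odot>\<^bsub>Z\<^esub> f x) = \<zero>\<^bsub>Z\<^esub>"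
    if "r \<in> multilinear_rels K V n" for r
    using that
  proof (cases rule: multilinear_rels_cases)
    case (1 xs i v v')
    then show ?thesis
      by (intro P.eval_rel_add[OF Z cl _ _ _ _ 1(5)] pow_words_update V.M.a_closed linear_map_add[OF lin])
  next
    case (2 xs i c v)
    then show ?thesis
      by (intro P.eval_rel_smult[OF Z cl _ _ _ _ 2(5)] pow_words_update V.smult_closed linear_map_smult[OF lin])
  qed
  show ?thesis
    using P.linear_map_presented_lift[OF Z cl resp] P.presented_lift_gen[OF Z cl resp]
    by (auto simp: tensor_pow_def pure_pow_def pow_words_def)
qed

lemma linear_map_pow_lift:
  "multilinear_map K V n Z f \<Longrightarrow> linear_map K (tensor_pow K V n) Z (presented_lift K Z f)"
  using pow_lift_facts by blast

lemma pow_lift_pure: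
  "multilinear_map K V n Z f \<Longrightarrow> xs \<in> pow_words V n \<Longrightarrow> presented_lift K Z f (pure_pow K V xs) = f xs"
  using pow_lift_facts by blast

lemma linear_map_pow_lift_param:
  assumes f: "\<And>u. u \<in> carrier U \<Longrightarrow> multilinear_map K V n Z (f u)"
    and lin: "\<And>xs. xs \<in> pow_words V n \<Longrightarrow> linear_map K U Z (\<lambda>u. f u xs)"
    and U: "module K U" and t: "t \<in> carrier (tensor_pow K V n)"
  shows "linear_map K U Z (\<lambda>u. presented_lift K Z (f u) t)"
proof -
  interpret U: module K U by (rule U)
  note L = linear_map_pow_lift[OF f] and P = pow_lift_pure[OF f]
  show ?thesis
  proof (rule linear_mapI)
    fix x y assume xy: "x \<in> carrier U" "y \<in> carrier U"
    show "presented_lift K Z (f (x \<oplus>\<^bsub>U\<^esub> y)) t = presented_lift K Z (f x) t \<oplus>\<^bsub>Z\<^esub> presented_lift K Z (f y) t"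
      by (rule pow_eqI[OF Z L linear_map_plus[OF Z L L] _ t]) (simp_all add: xy P linear_map_add[OF lin])
  next
    fix c x assume cx: "c \<in> carrier K" "x \<in> carrier U"
    show "presented_lift K Z (f (c \<odot>\<^bsub>U\<^esub> x)) t = c \<odot>\<^bsub>Z\<^esub> presented_lift K Z (f x) t"
      by (rule pow_eqI[OF Z L linear_map_scale[OF Z L] _ t]) (simp_all add: cx P linear_map_smult[OF lin])
  qed (rule linear_map_closed[OF L t])
qed

end

lemma multilinear_snoc:
  assumes v: "v \<in> carrier V"
  shows "multilinear_map K V n (tensor_pow K V (Suc n)) (\<lambda>xs. pure_pow K V (xs @ [v]))"
proof (rule multilinear_mapI)
  fix xs i assume xs: "xs \<in> pow_words V n" and i: "i < n"
  then have "(xs @ [v])[i := w] = xs[i := w] @ [v]" for w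
    by (simp add: pow_words_def list_update_append1)
  then show "linear_map K V (tensor_pow K V (Suc n)) (\<lambda>w. pure_pow K V (xs[i := w] @ [v]))"
    using multilinear_map_linear[OF multilinear_pure_pow pow_words_snoc[OF xs v], of i] i by simp
qed (intro pure_pow_closed pow_words_snoc v)

lemma bilinear_pow_snoc: "bilinear_map K (tensor_pow K V n) V (tensor_pow K V (Suc n)) (pow_snoc K V n)"
  unfolding pow_snoc_def[abs_def]
proof (rule bilinear_mapI)
  fix t assume t: "t \<in> carrier (tensor_pow K V n)"
  show "linear_map K V (tensor_pow K V (Suc n))
      (\<lambda>x. presented_lift K (tensor_pow K V (Suc n)) (\<lambda>xs. pure_pow K V (xs @ [x])) t)"
  proof (rule linear_map_pow_lift_param[OF module_pow multilinear_snoc _ V t])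
    fix xs assume xs: "xs \<in> pow_words V n"
    then have "length xs = n" by (simp add: pow_words_def)
    \<comment> \<open>Appending a letter is overwriting the last slot of a word of length
      \<open>n + 1\<close>, whatever letter stands there before. Linearity in the appended letter is
      thus multilinearity in slot \<open>n\<close>, with zero as the placeholder.\<close>
    then have eq: "(xs @ [v])[n := w] = xs @ [w]" for v w by auto
    interpret V: module K V by (rule V)
    show "linear_map K V (tensor_pow K V (Suc n)) (\<lambda>u. pure_pow K V (xs @ [u]))"
      using multilinear_map_linear[OF multilinear_pure_pow pow_words_snoc[OF xs V.M.zero_closed], of n]
      by (simp add: eq)
  qed
qed (intro linear_map_pow_lift module_pow multilinear_snoc)

lemma pow_snoc_pure:
  "xs \<in> pow_words V n \<Longrightarrow> v \<in> carrier V \<Longrightarrow> pow_snoc K V n (pure_pow K V xs) v = pure_pow K V (xs @ [v])"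
  unfolding pow_snoc_def by (rule pow_lift_pure[OF module_pow multilinear_snoc])

end

section \<open>Maps out of the tensor product of two tensor powers\<close>

definition bimultilinear_map ::
  "'k ring \<Rightarrow> ('k, 'a) module \<Rightarrow> nat \<Rightarrow> ('k, 'v) module \<Rightarrow> nat \<Rightarrow> ('k, 'z) module \<Rightarrow>
   ('a list \<Rightarrow> 'v list \<Rightarrow> 'z) \<Rightarrow> bool" where
  "bimultilinear_map K A k V n Z f \<longleftrightarrow>
     (\<forall>as\<in>pow_words A k. multilinear_map K V n Z (f as)) \<and>
     (\<forall>xs\<in>pow_words V n. multilinear_map K A k Z (\<lambda>as. f as xs))"

text \<open>The nested lift that \<open>TA_mult\<close> applies to each homogeneous component, with
  an arbitrary function of the two lists in place of \<open>TA_mult_word\<close>.\<close>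

definition word_lift ::
  "'k ring \<Rightarrow> ('k, 'z) module \<Rightarrow> ('a list \<Rightarrow> 'v list \<Rightarrow> 'z) \<Rightarrow>
   ('k, ('a list \<Rightarrow> 'k) set, ('v list \<Rightarrow> 'k) set) tensor \<Rightarrow> 'z" where
  "word_lift K Z f = tensor_lift K Z (\<lambda>\<alpha> \<xi>. presented_lift K Z (\<lambda>as. presented_lift K Z (f as) \<xi>) \<alpha>)"

context
  fixes K :: "'k ring" and A :: "('k, 'a) module" and V :: "('k, 'v) module" and Z :: "('k, 'z) module"
  assumes A: "module K A" and V: "module K V" and Z: "module K Z"
begin

lemma bimultilinear_map_left:
  "bimultilinear_map K A k V n Z f \<Longrightarrow> xs \<in> pow_words V n \<Longrightarrow> multilinear_map K A k Z (\<lambda>as. f as xs)"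
  by (simp add: bimultilinear_map_def)

lemma bimultilinear_map_right:
  "bimultilinear_map K A k V n Z f \<Longrightarrow> as \<in> pow_words A k \<Longrightarrow> multilinear_map K V n Z (f as)"
  by (simp add: bimultilinear_map_def)

lemma multilinear_word_lift_inner:
  assumes f: "bimultilinear_map K A k V n Z f" and \<xi>: "\<xi> \<in> carrier (tensor_pow K V n)"
  shows "multilinear_map K A k Z (\<lambda>as. presented_lift K Z (f as) \<xi>)"
proof (rule multilinear_mapI)
  fix as i assume as: "as \<in> pow_words A k" and i: "i < k"
  show "linear_map K A Z (\<lambda>v. presented_lift K Z (f (as[i := v])) \<xi>)"
    by (rule linear_map_pow_lift_param[OF V Z bimultilinear_map_right[OF f pow_words_update[OF as]]
          multilinear_map_linear[OF bimultilinear_map_left[OF f] as i] A \<xi>])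
qed (rule linear_map_closed[OF linear_map_pow_lift[OF V Z bimultilinear_map_right[OF f]] \<xi>])

lemma bilinear_word_lift:
  assumes f: "bimultilinear_map K A k V n Z f"
  shows "bilinear_map K (tensor_pow K A k) (tensor_pow K V n) Z
    (\<lambda>\<alpha> \<xi>. presented_lift K Z (\<lambda>as. presented_lift K Z (f as) \<xi>) \<alpha>)"
  by (intro bilinear_mapI linear_map_pow_lift[OF A Z] multilinear_word_lift_inner[OF f])
    (rule linear_map_pow_lift_param[OF A Z multilinear_word_lift_inner[OF f]
        linear_map_pow_lift[OF V Z bimultilinear_map_right[OF f]] module_pow[OF V]])

lemma linear_map_word_lift:
  assumes "bimultilinear_map K A k V n Z f"
  shows "linear_map K (tensor_space K (tensor_pow K A k) (tensor_pow K V n)) Z (word_lift K Z f)"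
  unfolding word_lift_def
  by (rule linear_map_tensor_lift[OF module_pow[OF A] module_pow[OF V] Z bilinear_word_lift[OF assms]])

lemma word_lift_pure:
  assumes f: "bimultilinear_map K A k V n Z f" and "as \<in> pow_words A k" and "xs \<in> pow_words V n"
  shows "word_lift K Z f (pure_tensor K (tensor_pow K A k) (tensor_pow K V n) (pure_pow K A as) (pure_pow K V xs)) = f as xs"
  using assms(2,3) unfolding word_lift_def
  by (simp add: tensor_lift_pure[OF module_pow[OF A] module_pow[OF V] Z bilinear_word_lift[OF f]]
      pure_pow_closed[OF A] pure_pow_closed[OF V] pow_lift_pure[OF A Z multilinear_word_lift_inner[OF f]]
      pow_lift_pure[OF V Z bimultilinear_map_right[OF f]])

lemma linear_map_word_lift_param:
  assumes f: "\<And>u. u \<in> carrier U \<Longrightarrow> bimultilinear_map K A k V n Z (f u)"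
    and lin: "\<And>as xs. as \<in> pow_words A k \<Longrightarrow> xs \<in> pow_words V n \<Longrightarrow> linear_map K U Z (\<lambda>u. f u as xs)"
    and U: "module K U" and t: "t \<in> carrier (tensor_space K (tensor_pow K A k) (tensor_pow K V n))"
  shows "linear_map K U Z (\<lambda>u. word_lift K Z (f u) t)"
  unfolding word_lift_def
  by (rule linear_map_tensor_lift_param[OF module_pow[OF A] module_pow[OF V] Z bilinear_word_lift[OF f] _ U t])
    (assumption, rule linear_map_pow_lift_param[OF A Z multilinear_word_lift_inner[OF f] _ U], assumption+,
      rule linear_map_pow_lift_param[OF V Z bimultilinear_map_right[OF f] lin U])

end

section \<open>Direct sums and the maps into and out of them\<close>

lemma direct_sum_simps:
  "carrier (direct_sum I M) = {t \<in> (\<Pi>\<^sub>E n\<in>I. carrier (M n)). finite {n \<in> I. t n \<noteq> \<zero>\<^bsub>M n\<^esub>}}"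
  "\<zero>\<^bsub>direct_sum I M\<^esub> = (\<lambda>n\<in>I. \<zero>\<^bsub>M n\<^esub>)"
  "s \<oplus>\<^bsub>direct_sum I M\<^esub> t = (\<lambda>n\<in>I. s n \<oplus>\<^bsub>M n\<^esub> t n)"
  "c \<odot>\<^bsub>direct_sum I M\<^esub> t = (\<lambda>n\<in>I. c \<odot>\<^bsub>M n\<^esub> t n)"
  by (simp_all add: direct_sum_def)

lemma direct_sum_component: "t \<in> carrier (direct_sum I M) \<Longrightarrow> i \<in> I \<Longrightarrow> t i \<in> carrier (M i)"
  by (auto simp: direct_sum_simps)

lemma direct_sum_ext:
  assumes "s \<in> carrier (direct_sum I M)" and "t \<in> carrier (direct_sum I M)" and "\<And>i. i \<in> I \<Longrightarrow> s i = t i"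
  shows "s = t"
  using assms by (auto simp: direct_sum_simps intro: PiE_ext)

lemma module_direct_sum:
  assumes K: "cring K" and M: "\<And>i. i \<in> I \<Longrightarrow> module K (M i)"
  shows "module K (direct_sum I M)"
proof -
  interpret K: cring K by fact
  let ?D = "direct_sum I M"
  note [simp] = module.smult_closed[OF M] module.smult_l_distr[OF M] module.smult_r_distr[OF M]
    module.smult_assoc1[OF M] module.smult_one[OF M] module.smult_r_null[OF M]
  have ag: "abelian_group (M i)" if "i \<in> I" for i using M[OF that] by (simp add: module_def)
  note [simp] = abelian_groupE(1,2,3,5)[OF ag]
  have add: "s \<oplus>\<^bsub>?D\<^esub> t \<in> carrier ?D" if s: "s \<in> carrier ?D" and t: "t \<in> carrier ?D" for s t
  proof -
    have "{n \<in> I. (s \<oplus>\<^bsub>?D\<^esub> t) n \<noteq> \<zero>\<^bsub>M n\<^esub>} \<subseteq> {n \<in> I. s n \<noteq> \<zero>\<^bsub>M n\<^esub>} \<union> {n \<in> I. t n \<noteq> \<zero>\<^bsub>M n\<^esub>}"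
      by (auto simp: direct_sum_simps)
    moreover have "finite \<dots>" using s t by (simp add: direct_sum_simps)
    ultimately have "finite {n \<in> I. (s \<oplus>\<^bsub>?D\<^esub> t) n \<noteq> \<zero>\<^bsub>M n\<^esub>}" by (rule finite_subset)
    moreover have "s \<oplus>\<^bsub>?D\<^esub> t \<in> (\<Pi>\<^sub>E n\<in>I. carrier (M n))"
      using s t by (auto simp: direct_sum_simps PiE_iff)
    ultimately show ?thesis unfolding direct_sum_simps(1) by blast
  qed
  have smult: "c \<odot>\<^bsub>?D\<^esub> t \<in> carrier ?D" if c: "c \<in> carrier K" and t: "t \<in> carrier ?D" for c t
  proof -
    have "{n \<in> I. (c \<odot>\<^bsub>?D\<^esub> t) n \<noteq> \<zero>\<^bsub>M n\<^esub>} \<subseteq> {n \<in> I. t n \<noteq> \<zero>\<^bsub>M n\<^esub>}"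
      using c by (auto simp: direct_sum_simps)
    moreover have "finite \<dots>" using t by (simp add: direct_sum_simps)
    ultimately have "finite {n \<in> I. (c \<odot>\<^bsub>?D\<^esub> t) n \<noteq> \<zero>\<^bsub>M n\<^esub>}" by (rule finite_subset)
    moreover have "c \<odot>\<^bsub>?D\<^esub> t \<in> (\<Pi>\<^sub>E n\<in>I. carrier (M n))"
      using c t by (auto simp: direct_sum_simps PiE_iff)
    ultimately show ?thesis unfolding direct_sum_simps(1) by blast
  qed
  have zero: "\<zero>\<^bsub>?D\<^esub> \<in> carrier ?D" by (auto simp: direct_sum_simps)
  note cl = add smult zero
  have comp: "(s \<oplus>\<^bsub>?D\<^esub> t) i = s i \<oplus>\<^bsub>M i\<^esub> t i" "(c \<odot>\<^bsub>?D\<^esub> t) i = c \<odot>\<^bsub>M i\<^esub> t i"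
    "\<zero>\<^bsub>?D\<^esub> i = \<zero>\<^bsub>M i\<^esub>" if "i \<in> I" for s t c i
    using that by (simp_all add: direct_sum_simps)
  note comps = comp direct_sum_component[of _ I M]
  show ?thesis
  proof (intro moduleI abelian_groupI)
    fix s t assume st: "s \<in> carrier ?D" "t \<in> carrier ?D"
    show "s \<oplus>\<^bsub>?D\<^esub> t = t \<oplus>\<^bsub>?D\<^esub> s"
      by (rule direct_sum_ext[of _ I M]) (use st cl comps abelian_groupE(4)[OF ag] in auto)
  next
    fix s t u assume stu: "s \<in> carrier ?D" "t \<in> carrier ?D" "u \<in> carrier ?D"
    show "s \<oplus>\<^bsub>?D\<^esub> t \<oplus>\<^bsub>?D\<^esub> u = s \<oplus>\<^bsub>?D\<^esub> (t \<oplus>\<^bsub>?D\<^esub> u)"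
      by (rule direct_sum_ext[of _ I M]) (use stu cl in \<open>simp_all add: comps abelian_groupE(3)[OF ag]\<close>)
  next
    fix t assume t: "t \<in> carrier ?D"
    show "\<exists>s\<in>carrier ?D. s \<oplus>\<^bsub>?D\<^esub> t = \<zero>\<^bsub>?D\<^esub>"
    proof
      show n: "(\<ominus>\<^bsub>K\<^esub> \<one>\<^bsub>K\<^esub>) \<odot>\<^bsub>?D\<^esub> t \<in> carrier ?D" using t smult by simp
      have "\<ominus>\<^bsub>K\<^esub> \<one>\<^bsub>K\<^esub> \<odot>\<^bsub>M i\<^esub> t i \<oplus>\<^bsub>M i\<^esub> t i = \<zero>\<^bsub>M i\<^esub>" if "i \<in> I" for i
      proof -
        interpret Mi: module K "M i" by (rule M[OF that])
        show ?thesis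
          using direct_sum_component[OF t that] by (simp add: Mi.smult_l_minus Mi.M.l_neg)
      qed
      then show "(\<ominus>\<^bsub>K\<^esub> \<one>\<^bsub>K\<^esub>) \<odot>\<^bsub>?D\<^esub> t \<oplus>\<^bsub>?D\<^esub> t = \<zero>\<^bsub>?D\<^esub>"
        by (intro direct_sum_ext[OF add[OF n t] zero]) (simp add: comp)
    qed
  next
    fix t assume t: "t \<in> carrier ?D"
    show "\<zero>\<^bsub>?D\<^esub> \<oplus>\<^bsub>?D\<^esub> t = t"
      by (rule direct_sum_ext[of _ I M]) (use t cl in \<open>simp_all add: comps\<close>)
    show "\<one>\<^bsub>K\<^esub> \<odot>\<^bsub>?D\<^esub> t = t"
      by (rule direct_sum_ext[of _ I M]) (use t cl in \<open>simp_all add: comps\<close>)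
    fix a b assume ab: "a \<in> carrier K" "b \<in> carrier K"
    show "(a \<oplus>\<^bsub>K\<^esub> b) \<odot>\<^bsub>?D\<^esub> t = a \<odot>\<^bsub>?D\<^esub> t \<oplus>\<^bsub>?D\<^esub> b \<odot>\<^bsub>?D\<^esub> t"
      by (rule direct_sum_ext[of _ I M]) (use ab t cl in \<open>simp_all add: comps\<close>)
    show "(a \<otimes>\<^bsub>K\<^esub> b) \<odot>\<^bsub>?D\<^esub> t = a \<odot>\<^bsub>?D\<^esub> (b \<odot>\<^bsub>?D\<^esub> t)"
      by (rule direct_sum_ext[of _ I M]) (use ab t cl in \<open>simp_all add: comps\<close>)
  next
    fix a s t assume "a \<in> carrier K" and st: "s \<in> carrier ?D" "t \<in> carrier ?D"
    then show "a \<odot>\<^bsub>?D\<^esub> (s \<oplus>\<^bsub>?D\<^esub> t) = a \<odot>\<^bsub>?D\<^esub> s \<oplus>\<^bsub>?D\<^esub> a \<odot>\<^bsub>?D\<^esub> t"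
      by (intro direct_sum_ext[of _ I M]) (use cl in \<open>simp_all add: comps\<close>)
  qed (use assms cl in auto)
qed

lemma linear_map_component:
  "i \<in> I \<Longrightarrow> linear_map K (direct_sum I M) (M i) (\<lambda>t. t i)"
  by (intro linear_mapI) (auto simp: direct_sum_simps)

lemma linear_map_direct_sumI:
  assumes K: "cring K" and M: "\<And>i. i \<in> I \<Longrightarrow> module K (M i)" and U: "module K U"
    and cl: "\<And>u. u \<in> carrier U \<Longrightarrow> f u \<in> carrier (direct_sum I M)"
    and lin: "\<And>i. i \<in> I \<Longrightarrow> linear_map K U (M i) (\<lambda>u. f u i)"
  shows "linear_map K U (direct_sum I M) f"
proof -
  interpret U: module K U by fact
  interpret D: module K "direct_sum I M" by (rule module_direct_sum[OF K M])
  show ?thesis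
  proof (rule linear_mapI)
    fix x y assume xy: "x \<in> carrier U" "y \<in> carrier U"
    show "f (x \<oplus>\<^bsub>U\<^esub> y) = f x \<oplus>\<^bsub>direct_sum I M\<^esub> f y"
      using xy by (intro direct_sum_ext[of _ I M] cl D.M.a_closed U.M.a_closed)
        (simp_all add: linear_map_add[OF lin] direct_sum_simps(3))
  next
    fix c x assume cx: "c \<in> carrier K" "x \<in> carrier U"
    show "f (c \<odot>\<^bsub>U\<^esub> x) = c \<odot>\<^bsub>direct_sum I M\<^esub> f x"
      using cx by (intro direct_sum_ext[of _ I M] cl D.smult_closed U.smult_closed)
        (simp_all add: linear_map_smult[OF lin] direct_sum_simps(4))
  qed (rule cl)
qed

text \<open>Outside its support \<open>t\<close> has zero components, which the linear maps
  \<open>L i\<close> send to zero; the varying index set is therefore harmless.\<close>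

lemma linear_map_direct_sum_lift:
  assumes K: "cring K" and M: "\<And>i. i \<in> I \<Longrightarrow> module K (M i)" and Z: "module K Z"
    and L: "\<And>i. i \<in> I \<Longrightarrow> linear_map K (M i) Z (L i)"
  shows "linear_map K (direct_sum I M) Z (\<lambda>t. \<Oplus>\<^bsub>Z\<^esub>i\<in>{i \<in> I. t i \<noteq> \<zero>\<^bsub>M i\<^esub>}. L i (t i))"
proof (rule linear_map_finsum_support[OF module_direct_sum[OF K M] Z, where I = I])
  fix i assume i: "i \<in> I"
  show "linear_map K (direct_sum I M) Z (\<lambda>t. L i (t i))"
    by (rule linear_map_compose[OF L[OF i] linear_map_component[where M = M, OF i]])
  fix t assume "i \<notin> {i \<in> I. t i \<noteq> \<zero>\<^bsub>M i\<^esub>}"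
  then show "L i (t i) = \<zero>\<^bsub>Z\<^esub>" using i linear_map_zero[OF M Z L] by simp
qed (auto simp: direct_sum_simps)

definition direct_sum_single ::
  "'i set \<Rightarrow> ('i \<Rightarrow> ('k, 'v) module) \<Rightarrow> 'i \<Rightarrow> 'v \<Rightarrow> 'i \<Rightarrow> 'v" where
  "direct_sum_single I M k v = (\<lambda>i\<in>I. if i = k then v else \<zero>\<^bsub>M i\<^esub>)"

lemma direct_sum_single_closed:
  assumes M: "\<And>i. i \<in> I \<Longrightarrow> module K (M i)" and "v \<in> carrier (M k)"
  shows "direct_sum_single I M k v \<in> carrier (direct_sum I M)"
proof -
  have "{i \<in> I. direct_sum_single I M k v i \<noteq> \<zero>\<^bsub>M i\<^esub>} \<subseteq> {k}"
    by (auto simp: direct_sum_single_def)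
  then have "finite {i \<in> I. direct_sum_single I M k v i \<noteq> \<zero>\<^bsub>M i\<^esub>}" by (rule finite_subset) simp
  moreover have "\<zero>\<^bsub>M i\<^esub> \<in> carrier (M i)" if "i \<in> I" for i
    using abelian_groupE(2)[of "M i"] M[OF that] by (simp add: module_def)
  ultimately show ?thesis
    using assms(2) by (auto simp: direct_sum_simps direct_sum_single_def)
qed

lemma direct_sum_lift_single:
  assumes M: "\<And>i. i \<in> I \<Longrightarrow> module K (M i)" and Z: "module K Z"
    and L: "\<And>i. i \<in> I \<Longrightarrow> linear_map K (M i) Z (L i)" and k: "k \<in> I" and v: "v \<in> carrier (M k)"
  shows "(\<Oplus>\<^bsub>Z\<^esub>i\<in>{i \<in> I. direct_sum_single I M k v i \<noteq> \<zero>\<^bsub>M i\<^esub>}. L i (direct_sum_single I M k v i)) = L k v"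
proof -
  interpret Z: module K Z by fact
  let ?s = "direct_sum_single I M k v"
  have s: "?s k = v" using k by (simp add: direct_sum_single_def)
  have Lv: "L k v \<in> carrier Z" by (rule linear_map_closed[OF L[OF k] v])
  \<comment> \<open>If \<open>v\<close> is zero the support is empty instead of \<open>{k}\<close>,
    but then the summand \<open>L k v\<close> is zero too.\<close>
  have "(\<Oplus>\<^bsub>Z\<^esub>i\<in>{i \<in> I. ?s i \<noteq> \<zero>\<^bsub>M i\<^esub>}. L i (?s i)) = (\<Oplus>\<^bsub>Z\<^esub>i\<in>{k}. L i (?s i))"
    using k linear_map_zero[OF M[OF k] Z L[OF k]] Lv s
    by (intro Z.M.add.finprod_mono_neutral_cong_left) (auto simp: direct_sum_single_def)
  also have "\<dots> = L k (?s k) \<oplus>\<^bsub>Z\<^esub> (\<Oplus>\<^bsub>Z\<^esub>i\<in>{}. L i (?s i))"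
    using Lv s by (intro Z.M.finsum_insert) auto
  also have "\<dots> = L k v" using Lv s by simp
  finally show ?thesis .
qed

section \<open>The products on \<open>T\<^sub>A(V)\<close>\<close>

text \<open>The case split underlying \<open>TA_dot\<close>: degree one of the result is zero, and
  degree \<open>k + 2\<close> comes from degree \<open>k + 1\<close>.\<close>

lemma positive_cases:
  assumes "n \<in> {1..}" and "n = Suc 0 \<Longrightarrow> P (Suc 0)" and "\<And>k. n = Suc (Suc k) \<Longrightarrow> P (Suc (Suc k))"
  shows "P (n::nat)"
  using assms by (cases n rule: nat.exhaust; cases "n - 1") auto

locale tensor_words =
  fixes K :: "'k ring" and A :: "('k, 'a) module" and V :: "('k, 'v) module"
    and \<Phi> :: "('k, 'a, 'a) tensor \<Rightarrow> ('k, 'a, 'a) tensor"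
  assumes A: "module K A" and V: "module K V"
    and \<Phi>: "linear_map K (tensor_space K A A) (tensor_space K A A) \<Phi>"
begin

abbreviation "AA \<equiv> tensor_space K A A"
abbreviation "cmp \<equiv> TA_component K A V"
abbreviation "T \<equiv> TA_space K A V"
abbreviation "dot \<equiv> TA_dot K A V"
abbreviation "mult_word \<equiv> TA_mult_word K A V \<Phi>"

text \<open>The exponent on the side of \<open>A\<close> is read off \<open>as\<close>, the degree
  off \<open>xs\<close>. The definition does not enforce that \<open>xs\<close> has one entry more
  than \<open>as\<close>; the lemmas about \<open>word\<close> assume it.\<close>

definition word :: "'a list \<Rightarrow> 'v list \<Rightarrow> ('k, 'a, 'v) TA" where
  "word as xs = direct_sum_single {1..} cmp (length xs)
     (pure_tensor K (tensor_pow K A (length as)) (tensor_pow K V (length xs)) (pure_pow K A as) (pure_pow K V xs))"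

lemma cring: "cring K" using A by (simp add: module_def)

lemma cmp: "module K (cmp n)"
  unfolding TA_component_def by (intro module_tensor module_pow A V)

lemma cmp_Suc: "cmp (Suc k) = tensor_space K (tensor_pow K A k) (tensor_pow K V (Suc k))"
  by (simp add: TA_component_def)

lemma T: "module K T"
  unfolding TA_space_def by (rule module_direct_sum[OF cring cmp])

lemma word_closed:
  assumes "as \<in> pow_words A k" and "xs \<in> pow_words V (Suc k)"
  shows "word as xs \<in> carrier T"
proof -
  have l: "length as = k" "length xs = Suc k" using assms by (simp_all add: pow_words_def)
  show ?thesis
    unfolding word_def TA_space_def l
    by (rule direct_sum_single_closed[OF cmp], unfold cmp_Suc)
      (intro pure_tensor_closed module_pow A V pure_pow_closed assms)
qed

lemma word_component:
  "as \<in> pow_words A k \<Longrightarrow> xs \<in> pow_words V (Suc k) \<Longrightarrow> word as xs (Suc k) =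
    pure_tensor K (tensor_pow K A k) (tensor_pow K V (Suc k)) (pure_pow K A as) (pure_pow K V xs)"
  by (auto simp: word_def direct_sum_single_def pow_words_def)

lemma bilinear_dot:
  assumes "a \<in> carrier A" and "x \<in> carrier V"
  shows "bilinear_map K (tensor_pow K A k) (tensor_pow K V (Suc k)) (cmp (Suc (Suc k)))
    (\<lambda>\<alpha> \<xi>. pure_tensor K (tensor_pow K A (Suc k)) (tensor_pow K V (Suc (Suc k)))
      (pow_snoc K A k \<alpha> a) (pow_snoc K V (Suc k) \<xi> x))"
  unfolding cmp_Suc
  by (rule bilinear_map_comp2[OF bilinear_pure_tensor[OF module_pow[OF A] module_pow[OF V]]
        bilinear_map_left[OF bilinear_pow_snoc[OF A] assms(1)] bilinear_map_left[OF bilinear_pow_snoc[OF V] assms(2)]])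

lemma dot_1: "dot u a x (Suc 0) = \<zero>\<^bsub>cmp (Suc 0)\<^esub>"
  by (simp add: TA_dot_def)

lemma dot_Suc: "dot u a x (Suc (Suc k)) = tensor_lift K (cmp (Suc (Suc k)))
    (\<lambda>\<alpha> \<xi>. pure_tensor K (tensor_pow K A (Suc k)) (tensor_pow K V (Suc (Suc k)))
      (pow_snoc K A k \<alpha> a) (pow_snoc K V (Suc k) \<xi> x)) (u (Suc k))"
  by (simp add: TA_dot_def)

lemma T_component: "u \<in> carrier T \<Longrightarrow> u (Suc k) \<in> carrier (cmp (Suc k))"
  using direct_sum_component[of u "{1..}" cmp "Suc k"] by (simp add: TA_space_def)

lemma linear_map_dot_lift:
  assumes "a \<in> carrier A" and "x \<in> carrier V"
  shows "linear_map K (cmp (Suc k)) (cmp (Suc (Suc k))) (tensor_lift K (cmp (Suc (Suc k)))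
    (\<lambda>\<alpha> \<xi>. pure_tensor K (tensor_pow K A (Suc k)) (tensor_pow K V (Suc (Suc k)))
      (pow_snoc K A k \<alpha> a) (pow_snoc K V (Suc k) \<xi> x)))"
  unfolding cmp_Suc[of k]
  by (rule linear_map_tensor_lift[OF module_pow[OF A] module_pow[OF V] cmp bilinear_dot[OF assms]])

lemma dot_closed:
  assumes u: "u \<in> carrier T" and a: "a \<in> carrier A" and x: "x \<in> carrier V"
  shows "dot u a x \<in> carrier T"
proof -
  have cl: "dot u a x n \<in> carrier (cmp n)" if n: "n \<in> {1..}" for n
  proof (rule positive_cases[OF n])
    interpret C: module K "cmp (Suc 0)" by (rule cmp)
    show "dot u a x (Suc 0) \<in> carrier (cmp (Suc 0))" by (simp add: dot_1)
    show "dot u a x (Suc (Suc k)) \<in> carrier (cmp (Suc (Suc k)))" for k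
      unfolding dot_Suc by (rule linear_map_closed[OF linear_map_dot_lift[OF a x] T_component[OF u]])
  qed
  \<comment> \<open>Multiplying by a letter raises the degree by one, so the support of the result
    lies in the shifted support of \<open>u\<close>, which is finite.\<close>
  have "n \<in> Suc ` {n \<in> {1..}. u n \<noteq> \<zero>\<^bsub>cmp n\<^esub>}"
    if n: "n \<in> {1..}" and nz: "dot u a x n \<noteq> \<zero>\<^bsub>cmp n\<^esub>" for n
    using nz
  proof (rule_tac positive_cases[OF n, of "\<lambda>n. dot u a x n \<noteq> \<zero>\<^bsub>cmp n\<^esub> \<longrightarrow> n \<in> Suc ` {n \<in> {1..}. u n \<noteq> \<zero>\<^bsub>cmp n\<^esub>}", THEN mp])
    show "dot u a x (Suc (Suc k)) \<noteq> \<zero>\<^bsub>cmp (Suc (Suc k))\<^esub> \<longrightarrow>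
        Suc (Suc k) \<in> Suc ` {n \<in> {1..}. u n \<noteq> \<zero>\<^bsub>cmp n\<^esub>}" for k
      using linear_map_zero[OF cmp cmp linear_map_dot_lift[OF a x, of k]] by (auto simp: dot_Suc)
  qed (simp_all add: dot_1)
  then have "{n \<in> {1..}. dot u a x n \<noteq> \<zero>\<^bsub>cmp n\<^esub>} \<subseteq> Suc ` {n \<in> {1..}. u n \<noteq> \<zero>\<^bsub>cmp n\<^esub>}" by blast
  moreover have "finite {n \<in> {1..}. u n \<noteq> \<zero>\<^bsub>cmp n\<^esub>}" using u by (simp add: TA_space_def direct_sum_simps)
  ultimately have "finite {n \<in> {1..}. dot u a x n \<noteq> \<zero>\<^bsub>cmp n\<^esub>}" by (blast intro: finite_subset)
  moreover have "dot u a x \<in> extensional {1..}" unfolding TA_dot_def by (rule restrict_extensional)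
  ultimately show ?thesis
    unfolding TA_space_def direct_sum_simps using cl by (simp add: PiE_def)
qed

lemma
  shows linear_map_dot_word: "a \<in> carrier A \<Longrightarrow> x \<in> carrier V \<Longrightarrow> linear_map K T T (\<lambda>u. dot u a x)"
    and linear_map_dot_scalar: "u \<in> carrier T \<Longrightarrow> x \<in> carrier V \<Longrightarrow> linear_map K A T (\<lambda>a. dot u a x)"
    and linear_map_dot_letter: "u \<in> carrier T \<Longrightarrow> a \<in> carrier A \<Longrightarrow> linear_map K V T (\<lambda>x. dot u a x)"
proof -
  have P: "pow_snoc K A k \<alpha> a \<in> carrier (tensor_pow K A (Suc k))"
    if "\<alpha> \<in> carrier (tensor_pow K A k)" "a \<in> carrier A" for \<alpha> a k
    by (rule bilinear_map_closed[OF bilinear_pow_snoc[OF A] that])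
  have Q: "pow_snoc K V k \<xi> x \<in> carrier (tensor_pow K V (Suc k))"
    if "\<xi> \<in> carrier (tensor_pow K V k)" "x \<in> carrier V" for \<xi> x k
    by (rule bilinear_map_closed[OF bilinear_pow_snoc[OF V] that])
  \<comment> \<open>The three linearity claims share this reduction to components: degree one is
    constantly zero, and the degrees from two on are given by a tensor lift.\<close>
  have D: "linear_map K U T f"
    if U: "module K U" and cl: "\<And>u. u \<in> carrier U \<Longrightarrow> f u \<in> carrier T"
      and one: "\<And>u. f u (Suc 0) = \<zero>\<^bsub>cmp (Suc 0)\<^esub>"
      and suc: "\<And>k. linear_map K U (cmp (Suc (Suc k))) (\<lambda>u. f u (Suc (Suc k)))"
    for U :: "('k, 'u) module" and f :: "'u \<Rightarrow> ('k, 'a, 'v) TA"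
    unfolding TA_space_def
  proof (rule linear_map_direct_sumI[OF cring cmp U])
    fix n :: nat assume n: "n \<in> {1..}"
    show "linear_map K U (cmp n) (\<lambda>u. f u n)"
      by (rule positive_cases[OF n]) (simp_all only: one linear_map_const_zero[OF cmp] suc)
  qed (simp only: cl[unfolded TA_space_def])
  show "linear_map K T T (\<lambda>u. dot u a x)" if a: "a \<in> carrier A" and x: "x \<in> carrier V"
  proof (rule D[OF T dot_closed[OF _ a x] dot_1])
    have c: "linear_map K T (cmp (Suc k)) (\<lambda>u. u (Suc k))" for k
      unfolding TA_space_def by (rule linear_map_component) simp
    show "linear_map K T (cmp (Suc (Suc k))) (\<lambda>u. dot u a x (Suc (Suc k)))" for k
      unfolding dot_Suc by (rule linear_map_compose[OF linear_map_dot_lift[OF a x] c])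
  qed
  show "linear_map K A T (\<lambda>a. dot u a x)" if u: "u \<in> carrier T" and x: "x \<in> carrier V"
  proof (rule D[OF A dot_closed[OF u _ x] dot_1])
    show "linear_map K A (cmp (Suc (Suc k))) (\<lambda>a. dot u a x (Suc (Suc k)))" for k
      unfolding dot_Suc
    proof (rule linear_map_tensor_lift_param[OF module_pow[OF A] module_pow[OF V] cmp bilinear_dot[OF _ x] _ A])
      show "u (Suc k) \<in> carrier (tensor_space K (tensor_pow K A k) (tensor_pow K V (Suc k)))"
        using T_component[OF u] by (simp add: cmp_Suc)
    qed (assumption, unfold cmp_Suc, intro linear_map_pure_left module_pow A V bilinear_map_right[OF bilinear_pow_snoc] Q x)
  qed
  show "linear_map K V T (\<lambda>x. dot u a x)" if u: "u \<in> carrier T" and a: "a \<in> carrier A"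
  proof (rule D[OF V dot_closed[OF u a] dot_1])
    show "linear_map K V (cmp (Suc (Suc k))) (\<lambda>x. dot u a x (Suc (Suc k)))" for k
      unfolding dot_Suc
    proof (rule linear_map_tensor_lift_param[OF module_pow[OF A] module_pow[OF V] cmp bilinear_dot[OF a] _ V])
      show "u (Suc k) \<in> carrier (tensor_space K (tensor_pow K A k) (tensor_pow K V (Suc k)))"
        using T_component[OF u] by (simp add: cmp_Suc)
    qed (assumption, unfold cmp_Suc, intro linear_map_pure_right module_pow A V bilinear_map_right[OF bilinear_pow_snoc] P a)
  qed
qed

lemma dot_word:
  assumes as: "as \<in> pow_words A k" and xs: "xs \<in> pow_words V (Suc k)" and a: "a \<in> carrier A" and x: "x \<in> carrier V"
  shows "dot (word as xs) a x = word (as @ [a]) (xs @ [x])"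
proof (rule direct_sum_ext[of _ "{1..}" cmp])
  note as' = pow_words_snoc[OF as a] and xs' = pow_words_snoc[OF xs x]
  show "dot (word as xs) a x \<in> carrier (direct_sum {1..} cmp)"
    using dot_closed[OF word_closed[OF as xs] a x] by (simp add: TA_space_def)
  show "word (as @ [a]) (xs @ [x]) \<in> carrier (direct_sum {1..} cmp)"
    using word_closed[OF as' xs'] by (simp add: TA_space_def)
  have l: "length as = k" "length xs = Suc k" using as xs by (simp_all add: pow_words_def)
  fix n :: nat assume n: "n \<in> {1..}"
  show "dot (word as xs) a x n = word (as @ [a]) (xs @ [x]) n"
  proof (rule positive_cases[OF n])
    show "dot (word as xs) a x (Suc 0) = word (as @ [a]) (xs @ [x]) (Suc 0)"
      using l by (simp add: dot_1 word_def direct_sum_single_def)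
    fix j
    show "dot (word as xs) a x (Suc (Suc j)) = word (as @ [a]) (xs @ [x]) (Suc (Suc j))"
    \<comment> \<open>\<open>word as xs\<close> has degree \<open>k + 1\<close>, so its product with
      a letter has degree \<open>k + 2\<close>. In every other degree both sides are zero.\<close>
    proof (cases "j = k")
      case True
      have "dot (word as xs) a x (Suc (Suc k)) =
          pure_tensor K (tensor_pow K A (Suc k)) (tensor_pow K V (Suc (Suc k)))
            (pow_snoc K A k (pure_pow K A as) a) (pow_snoc K V (Suc k) (pure_pow K V xs) x)"
        unfolding dot_Suc word_component[OF as xs]
        by (rule tensor_lift_pure[OF module_pow[OF A] module_pow[OF V] cmp bilinear_dot[OF a x]
              pure_pow_closed[OF A as] pure_pow_closed[OF V xs]])
      then show ?thesis
        unfolding True word_component[OF as' xs'] pow_snoc_pure[OF A as a] pow_snoc_pure[OF V xs x] .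
    next
      case False
      then have "word as xs (Suc j) = \<zero>\<^bsub>cmp (Suc j)\<^esub>"
        using l by (simp add: word_def direct_sum_single_def)
      then show ?thesis
        using l False linear_map_zero[OF cmp cmp linear_map_dot_lift[OF a x, of j]]
        by (simp add: dot_Suc word_def direct_sum_single_def)
    qed
  qed
qed

text \<open>Linearity of the shorter product in its index makes the summand of the recursive
  Sweedler sum bilinear, so that the lift is legitimate; linearity in the other arguments then
  passes through the lift. The four statements are therefore proved together. The lists are reversed
  words, so slot 0 holds the last letter.\<close>

lemma mult_word_linear:
  "as \<in> pow_words A k \<Longrightarrow> xs \<in> pow_words V (Suc k) \<Longrightarrow>
    (\<forall>u\<in>carrier T. linear_map K A T (\<lambda>a. mult_word a u as xs)) \<and>
    (\<forall>a\<in>carrier A. linear_map K T T (\<lambda>u. mult_word a u as xs)) \<and>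
    (\<forall>a\<in>carrier A. \<forall>u\<in>carrier T. \<forall>i<k. linear_map K A T (\<lambda>b. mult_word a u (as[i := b]) xs)) \<and>
    (\<forall>a\<in>carrier A. \<forall>u\<in>carrier T. \<forall>i\<le>k. linear_map K V T (\<lambda>x. mult_word a u as (xs[i := x])))"
proof (induction k arbitrary: as xs)
  case 0
  then obtain z where "as = []" "xs = [z]" "z \<in> carrier V"
    by (auto simp: pow_words_def length_Suc_conv)
  then show ?case
    by (simp add: linear_map_dot_word linear_map_dot_scalar linear_map_dot_letter)
next
  case (Suc k)
  obtain b bs where as: "as = b # bs" and b: "b \<in> carrier A" and bs: "bs \<in> pow_words A k"
    using Suc.prems(1) by (auto simp: pow_words_def length_Suc_conv)
  obtain z zs where xs: "xs = z # zs" and z: "z \<in> carrier V" and zs: "zs \<in> pow_words V (Suc k)"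
    using Suc.prems(2) by (auto simp: pow_words_def length_Suc_conv)
  note IH = Suc.IH
  have q: "linear_map K A T (\<lambda>q. mult_word q u bs zs)"
    if "u \<in> carrier T" "bs \<in> pow_words A k" "zs \<in> pow_words V (Suc k)" for u bs zs
    using IH[OF that(2,3)] that(1) by blast
  have B: "bilinear_map K A A T (\<lambda>p q. dot (mult_word q u bs zs) p z)"
    if "u \<in> carrier T" "z \<in> carrier V" "bs \<in> pow_words A k" "zs \<in> pow_words V (Suc k)" for u z bs zs
    using that by (intro bilinear_mapI linear_map_dot_scalar linear_map_compose[OF linear_map_dot_word q]
        linear_map_closed[OF q])
  have \<Phi>ab: "\<Phi> (pure_tensor K A A a b) \<in> carrier AA" if "a \<in> carrier A" "b \<in> carrier A" for a b
    by (rule linear_map_closed[OF \<Phi> pure_tensor_closed[OF A A that]])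
  note lift = linear_map_compose[OF linear_map_tensor_lift[OF A A T B[OF _ z bs zs]] \<Phi>]
  have 1: "linear_map K A T (\<lambda>a. mult_word a u as xs)" if u: "u \<in> carrier T" for u
    unfolding as xs TA_mult_word.simps
    by (rule linear_map_compose[OF lift[OF u] bilinear_map_left[OF bilinear_pure_tensor[OF A A] b]])
  have 2: "linear_map K T T (\<lambda>u. mult_word a u as xs)" if a: "a \<in> carrier A" for a
    unfolding as xs TA_mult_word.simps
  proof (rule linear_map_tensor_lift_param[OF A A T B[OF _ z bs zs] _ T \<Phi>ab[OF a b]])
    fix p q assume "p \<in> carrier A" "q \<in> carrier A"
    then show "linear_map K T T (\<lambda>u. dot (mult_word q u bs zs) p z)"
      using IH[OF bs zs] z by (intro linear_map_compose[OF linear_map_dot_word]) blast+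
  qed
  \<comment> \<open>The head of the list enters through \<Phi>(a \<otimes> b), every later slot
    through the shorter product inside the lift.\<close>
  have 3: "linear_map K A T (\<lambda>b'. mult_word a u (as[i := b']) xs)"
    if a: "a \<in> carrier A" and u: "u \<in> carrier T" and i: "i < Suc k" for a u i
  proof (cases i)
    case 0
    show ?thesis
      unfolding as xs 0 list_update.simps nat.case TA_mult_word.simps
      by (rule linear_map_compose[OF lift[OF u] bilinear_map_right[OF bilinear_pure_tensor[OF A A] a]])
  next
    case (Suc j)
    show ?thesis
      unfolding as xs Suc list_update.simps nat.case TA_mult_word.simps
    proof (rule linear_map_tensor_lift_param[OF A A T B[OF u z pow_words_update[OF bs] zs] _ A \<Phi>ab[OF a b]])
      fix p q assume "p \<in> carrier A" "q \<in> carrier A"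
      then show "linear_map K A T (\<lambda>b'. dot (mult_word q u (bs[j := b']) zs) p z)"
        using IH[OF bs zs] z u i Suc by (intro linear_map_compose[OF linear_map_dot_word]) auto
    qed
  qed
  have 4: "linear_map K V T (\<lambda>x. mult_word a u as (xs[i := x]))"
    if a: "a \<in> carrier A" and u: "u \<in> carrier T" and i: "i \<le> Suc k" for a u i
  proof (cases i)
    case 0
    show ?thesis
      unfolding as xs 0 list_update.simps nat.case TA_mult_word.simps
    proof (rule linear_map_tensor_lift_param[OF A A T B[OF u _ bs zs] _ V \<Phi>ab[OF a b]])
      fix p q assume "p \<in> carrier A" "q \<in> carrier A"
      then show "linear_map K V T (\<lambda>z. dot (mult_word q u bs zs) p z)"
        by (intro linear_map_dot_letter linear_map_closed[OF q[OF u bs zs]])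
    qed
  next
    case (Suc j)
    show ?thesis
      unfolding as xs Suc list_update.simps nat.case TA_mult_word.simps
    proof (rule linear_map_tensor_lift_param[OF A A T B[OF u z bs pow_words_update[OF zs]] _ V \<Phi>ab[OF a b]])
      fix p q assume "p \<in> carrier A" "q \<in> carrier A"
      then show "linear_map K V T (\<lambda>x. dot (mult_word q u bs (zs[j := x])) p z)"
        using IH[OF bs zs] z u i Suc by (intro linear_map_compose[OF linear_map_dot_word]) auto
    qed
  qed
  show ?case using 1 2 3 4 by auto
qed

lemma bimultilinear_mult_word:
  assumes a: "a \<in> carrier A" and u: "u \<in> carrier T"
  shows "bimultilinear_map K A k V (Suc k) T (\<lambda>as xs. mult_word a u (rev as) (rev xs))"
  unfolding bimultilinear_map_def
proof (intro conjI ballI multilinear_mapI)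
  fix as xs assume as: "as \<in> pow_words A k" and xs: "xs \<in> pow_words V (Suc k)"
  note L = mult_word_linear[of "rev as" k "rev xs", unfolded pow_words_rev, OF as xs]
  show cl: "mult_word a u (rev as) (rev xs) \<in> carrier T"
    by (rule linear_map_closed[OF L[THEN conjunct1, rule_format, OF u] a])
  show "mult_word a u (rev as) (rev xs) \<in> carrier T" by (rule cl)
  have l: "length as = k" "length xs = Suc k" using as xs by (simp_all add: pow_words_def)
  show "linear_map K V T (\<lambda>v. mult_word a u (rev as) (rev (xs[i := v])))" if i: "i < Suc k" for i
  proof -
    \<comment> \<open>Reversing a list of length \<open>k + 1\<close> moves slot \<open>i\<close> to
      slot \<open>k - i\<close>. For the list over \<open>A\<close> below, of length
      \<open>k\<close>, the new slot is \<open>k - i - 1\<close>.\<close>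
    have "rev (xs[i := v]) = (rev xs)[k - i := v]" for v using i l by (simp add: rev_update)
    then show ?thesis
      using L[THEN conjunct2, THEN conjunct2, THEN conjunct2, rule_format, OF a u, of "k - i"] by simp
  qed
  show "linear_map K A T (\<lambda>v. mult_word a u (rev (as[i := v])) (rev xs))" if i: "i < k" for i
  proof -
    have "rev (as[i := v]) = (rev as)[k - i - 1 := v]" for v using i l by (simp add: rev_update)
    then show ?thesis
      using L[THEN conjunct2, THEN conjunct2, THEN conjunct1, rule_format, OF a u, of "k - i - 1"] i by simp
  qed
qed

section \<open>From words to all of T_A(V)\<close>

abbreviation "word_mult a u \<equiv> word_lift K T (\<lambda>as xs. mult_word a u (rev as) (rev xs))"

lemma TA_mult_eq: "TA_mult K A V \<Phi> a u w =
    (\<Oplus>\<^bsub>T\<^esub>n\<in>{n \<in> {1..}. w n \<noteq> \<zero>\<^bsub>cmp n\<^esub>}. word_mult a u (w n))"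
  by (simp add: TA_mult_def Let_def word_lift_def)

lemma linear_map_word_mult:
  assumes "a \<in> carrier A" and "u \<in> carrier T" and "n \<in> {1..}"
  shows "linear_map K (cmp n) T (word_mult a u)"
proof -
  obtain k where "n = Suc k" using assms(3) by (cases n) auto
  then show ?thesis
    using linear_map_word_lift[OF A V T bimultilinear_mult_word[OF assms(1,2)]] by (simp add: cmp_Suc)
qed

lemma linear_map_TA_mult_right:
  assumes "a \<in> carrier A" and "u \<in> carrier T"
  shows "linear_map K T T (TA_mult K A V \<Phi> a u)"
  using linear_map_direct_sum_lift[where I = "{1..}" and M = cmp, OF cring cmp T linear_map_word_mult[OF assms]]
  unfolding TA_mult_eq[abs_def] TA_space_def[symmetric] .

text \<open>A pure word is concentrated in one degree, so the sum over degrees reduces to one lift,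
  and that lift is evaluated at a pure tensor.\<close>

lemma TA_mult_word_eq:
  assumes a: "a \<in> carrier A" and u: "u \<in> carrier T" and as: "as \<in> pow_words A k" and xs: "xs \<in> pow_words V (Suc k)"
  shows "TA_mult K A V \<Phi> a u (word as xs) = mult_word a u (rev as) (rev xs)"
proof -
  have l: "length as = k" "length xs = Suc k" using as xs by (simp_all add: pow_words_def)
  show ?thesis
    unfolding TA_mult_eq word_def l
    by (subst direct_sum_lift_single[OF cmp T linear_map_word_mult[OF a u]])
      (use as xs in \<open>simp_all add: cmp_Suc pure_tensor_closed module_pow A V pure_pow_closed
        word_lift_pure[OF A V T bimultilinear_mult_word[OF a u]]\<close>)
qed

lemma
  assumes w: "w \<in> carrier T"
  shows linear_map_TA_mult_left: "a \<in> carrier A \<Longrightarrow> linear_map K T T (\<lambda>u. TA_mult K A V \<Phi> a u w)"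
    and linear_map_TA_mult_scalar: "u \<in> carrier T \<Longrightarrow> linear_map K A T (\<lambda>a. TA_mult K A V \<Phi> a u w)"
proof -
  \<comment> \<open>The index set of the sum depends on \<open>w\<close> alone. When
    \<open>u\<close> or \<open>a\<close> varies it stays fixed, and linearity is checked term by
    term.\<close>
  have fin: "finite {n \<in> {1..}. w n \<noteq> \<zero>\<^bsub>cmp n\<^esub>}" using w by (simp add: TA_space_def direct_sum_simps)
  have wk: "w (Suc k) \<in> carrier (tensor_space K (tensor_pow K A k) (tensor_pow K V (Suc k)))" for k
    using T_component[OF w] by (simp add: cmp_Suc)
  note L = mult_word_linear[of "rev as" k "rev xs" for as k xs, unfolded pow_words_rev]
  show "linear_map K T T (\<lambda>u. TA_mult K A V \<Phi> a u w)" if a: "a \<in> carrier A"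
    unfolding TA_mult_eq
  proof (rule linear_map_finsum_fixed[OF T T fin])
    fix n assume "n \<in> {n \<in> {1..}. w n \<noteq> \<zero>\<^bsub>cmp n\<^esub>}"
    then obtain k where n: "n = Suc k" by (cases n) auto
    show "linear_map K T T (\<lambda>u. word_mult a u (w n))"
      unfolding n
      by (rule linear_map_word_lift_param[OF A V T bimultilinear_mult_word[OF a] _ T wk])
        (assumption, rule L[THEN conjunct2, THEN conjunct1, rule_format, OF _ _ a])
  qed
  show "linear_map K A T (\<lambda>a. TA_mult K A V \<Phi> a u w)" if u: "u \<in> carrier T"
    unfolding TA_mult_eq
  proof (rule linear_map_finsum_fixed[OF A T fin])
    fix n assume "n \<in> {n \<in> {1..}. w n \<noteq> \<zero>\<^bsub>cmp n\<^esub>}"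
    then obtain k where n: "n = Suc k" by (cases n) auto
    show "linear_map K A T (\<lambda>a. word_mult a u (w n))"
      unfolding n
      by (rule linear_map_word_lift_param[OF A V T bimultilinear_mult_word[OF _ u] _ A wk])
        (assumption, rule L[THEN conjunct1, rule_format, OF _ _ u])
  qed
qed

lemma bilinear_TA_mult: "a \<in> carrier A \<Longrightarrow> bilinear_map K T T T (TA_mult K A V \<Phi> a)"
  by (intro bilinear_mapI linear_map_TA_mult_right linear_map_TA_mult_left)

lemma linear_map_TA_prods: "linear_map K A (Hom_space K (tensor_space K T T) T) (TA_prods K A V \<Phi>)"
proof -
  interpret A: module K A by (rule A)
  interpret TT: module K "tensor_space K T T" by (rule module_tensor[OF T T])
  note B = bilinear_TA_mult
  have lin: "linear_map K A T (\<lambda>a. tensor_lift K T (TA_mult K A V \<Phi> a) t)"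
    if t: "t \<in> carrier (tensor_space K T T)" for t
    by (rule linear_map_tensor_lift_param[OF T T T B linear_map_TA_mult_scalar A t])
  show ?thesis
  proof (rule linear_mapI)
    fix a assume a: "a \<in> carrier A"
    have "linear_map K (tensor_space K T T) T (TA_prods K A V \<Phi> a)"
      by (rule linear_map_cong[OF TT.module_axioms linear_map_tensor_lift[OF T T T B[OF a]]])
        (simp add: TA_prods_def)
    then show "TA_prods K A V \<Phi> a \<in> carrier (Hom_space K (tensor_space K T T) T)"
      by (simp add: Hom_space_def TA_prods_def)
  next
    fix a b assume "a \<in> carrier A" "b \<in> carrier A"
    then show "TA_prods K A V \<Phi> (a \<oplus>\<^bsub>A\<^esub> b) =
        TA_prods K A V \<Phi> a \<oplus>\<^bsub>Hom_space K (tensor_space K T T) T\<^esub> TA_prods K A V \<Phi> b"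
      by (auto simp: Hom_space_def TA_prods_def linear_map_add[OF lin] intro: restrict_ext)
  next
    fix c a assume "c \<in> carrier K" "a \<in> carrier A"
    then show "TA_prods K A V \<Phi> (c \<odot>\<^bsub>A\<^esub> a) =
        c \<odot>\<^bsub>Hom_space K (tensor_space K T T) T\<^esub> TA_prods K A V \<Phi> a"
      by (auto simp: Hom_space_def TA_prods_def linear_map_smult[OF lin] intro: restrict_ext)
  qed
qed

lemma prod_at_TA_prods:
  "a \<in> carrier A \<Longrightarrow> u \<in> carrier T \<Longrightarrow> w \<in> carrier T \<Longrightarrow>
    prod_at K T (TA_prods K A V \<Phi>) a u w = TA_mult K A V \<Phi> a u w"
  by (simp add: prod_at_def TA_prods_def pure_tensor_closed[OF T T] tensor_lift_pure[OF T T T bilinear_TA_mult])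

lemma product_family_TA: "product_family K A T \<Phi> (TA_prods K A V \<Phi>)"
  by (intro product_family.intro A T \<Phi> linear_map_TA_prods)

text \<open>All triple products of a single letter \<open>w\<close>, in both bracketings, already determine \<open>\<Phi>\<close>.\<close>

context
  fixes w
  assumes w: "w \<in> carrier V"
begin

lemma letter_words: "[w] \<in> pow_words V (Suc 0)" "[w, w] \<in> pow_words V (Suc (Suc 0))"
    "[w, w, w] \<in> pow_words V (Suc (Suc (Suc 0)))" "[] \<in> pow_words A 0"
    "q \<in> carrier A \<Longrightarrow> [q] \<in> pow_words A (Suc 0)"
    "q \<in> carrier A \<Longrightarrow> s \<in> carrier A \<Longrightarrow> [q, s] \<in> pow_words A (Suc (Suc 0))"
  using w by (auto simp: pow_words_def)

lemma letter_closed: "word [] [w] \<in> carrier T"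
  by (rule word_closed[OF letter_words(4,1)])

lemma mult_letter:
  "a \<in> carrier A \<Longrightarrow> u \<in> carrier T \<Longrightarrow> prod_at K T (TA_prods K A V \<Phi>) a u (word [] [w]) = dot u a w"
  using TA_mult_word_eq[OF _ _ letter_words(4,1)] by (simp add: prod_at_TA_prods letter_closed)

text \<open>The inner product appends its index first, so \<open>q\<close> precedes \<open>s\<close>
  in the word, in contrast to their order in r \<otimes> s \<otimes> q.\<close>

lemma mult_letters_left:
  assumes q: "q \<in> carrier A" and s: "s \<in> carrier A"
  shows "prod_at K T (TA_prods K A V \<Phi>) s (prod_at K T (TA_prods K A V \<Phi>) q (word [] [w]) (word [] [w])) (word [] [w]) =
    word [q, s] [w, w, w]"
  using dot_word[OF letter_words(4,1) q w] dot_word[OF letter_words(5)[OF q] letter_words(2) s w]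
  by (simp add: mult_letter[OF q letter_closed] mult_letter[OF s word_closed[OF letter_words(5)[OF q] letter_words(2)]])

text \<open>The right factor is the word \<open>q w w\<close> of length two: one step of the
  recursion produces the Sweedler sum and leaves only products by a letter, which are
  \<open>TA_dot\<close>.\<close>

lemma mult_letters_right:
  assumes s: "s \<in> carrier A" and q: "q \<in> carrier A"
  shows "prod_at K T (TA_prods K A V \<Phi>) s (word [] [w]) (prod_at K T (TA_prods K A V \<Phi>) q (word [] [w]) (word [] [w])) =
    tensor_lift K T (\<lambda>p q. prod_at K T (TA_prods K A V \<Phi>) p
      (prod_at K T (TA_prods K A V \<Phi>) q (word [] [w]) (word [] [w])) (word [] [w])) (\<Phi> (pure_tensor K A A s q))"
proof -
  interpret F: product_family K A T \<Phi> "TA_prods K A V \<Phi>" by (rule product_family_TA)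
  have qw: "word [q] [w, w] \<in> carrier T" by (rule word_closed[OF letter_words(5)[OF q] letter_words(2)])
  have "prod_at K T (TA_prods K A V \<Phi>) q (word [] [w]) (word [] [w]) = word [q] [w, w]"
    using dot_word[OF letter_words(4,1) q w] by (simp add: mult_letter[OF q letter_closed])
  then have "prod_at K T (TA_prods K A V \<Phi>) s (word [] [w]) (prod_at K T (TA_prods K A V \<Phi>) q (word [] [w]) (word [] [w])) =
      mult_word s (word [] [w]) [q] [w, w]"
    using TA_mult_word_eq[OF s letter_closed letter_words(5)[OF q] letter_words(2)]
    by (simp add: prod_at_TA_prods[OF s letter_closed qw])
  also have "\<dots> = tensor_lift K T (\<lambda>p q. dot (dot (word [] [w]) q w) p w) (\<Phi> (pure_tensor K A A s q))"
    by simp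
  also have "\<dots> = tensor_lift K T (\<lambda>p q. prod_at K T (TA_prods K A V \<Phi>) p
      (prod_at K T (TA_prods K A V \<Phi>) q (word [] [w]) (word [] [w])) (word [] [w])) (\<Phi> (pure_tensor K A A s q))"
    by (rule tensor_lift_cong[OF A A T F.bilinear_mul_mul[OF letter_closed letter_closed letter_closed] _ F.\<Phi>_pure_closed[OF s q]])
      (simp add: mult_letter letter_closed dot_closed w)
  finally show ?thesis .
qed

text \<open>A left inverse is constructed: take the component of degree three, where the words
  \<open>q s w w w\<close> live, evaluate the letters by a functional with value one at
  \<open>w\<close>, restore the order of \<open>s\<close> and \<open>q\<close>, and put
  \<open>r\<close> back in front.\<close>

lemma left_nested_letters_inj:
  assumes K: "field K" and nz: "w \<noteq> \<zero>\<^bsub>V\<^esub>"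
    and s: "s \<in> carrier (tensor_space K A AA)" and t: "t \<in> carrier (tensor_space K A AA)"
    and eq: "left_nested K A T (TA_prods K A V \<Phi>) (word [] [w]) (word [] [w]) (word [] [w]) s =
      left_nested K A T (TA_prods K A V \<Phi>) (word [] [w]) (word [] [w]) (word [] [w]) t"
  shows "s = t"
proof -
  interpret F: product_family K A T \<Phi> "TA_prods K A V \<Phi>" by (rule product_family_TA)
  let ?AAA = "tensor_space K A AA"
  let ?G = "left_nested K A T (TA_prods K A V \<Phi>) (word [] [w]) (word [] [w]) (word [] [w])"
  note AA = module_tensor[OF A A]
  note AAA = module_tensor[OF A AA]
  interpret AA: module K AA by (rule AA)
  obtain f where f: "\<And>v. v \<in> carrier V \<Longrightarrow> f v \<in> carrier K"
    "\<And>v v'. v \<in> carrier V \<Longrightarrow> v' \<in> carrier V \<Longrightarrow> f (v \<oplus>\<^bsub>V\<^esub> v') = f v \<oplus>\<^bsub>K\<^esub> f v'"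
    "\<And>c v. c \<in> carrier K \<Longrightarrow> v \<in> carrier V \<Longrightarrow> f (c \<odot>\<^bsub>V\<^esub> v) = c \<otimes>\<^bsub>K\<^esub> f v"
    "f w = \<one>\<^bsub>K\<^esub>"
    using linear_functional_exists[OF K V w nz] by blast
  \<comment> \<open>Passing each letter to \<open>f\<close> makes \<open>g\<close> multilinear on
    all words, while the three coefficients are one at \<open>w w w\<close>. Positions 1 and 0 of
    \<open>as\<close> undo the order of \<open>q s\<close>.\<close>
  define g where "g = (\<lambda>as xs. f (xs ! 0) \<odot>\<^bsub>AA\<^esub> (f (xs ! 1) \<odot>\<^bsub>AA\<^esub> (f (xs ! 2) \<odot>\<^bsub>AA\<^esub>
    pure_tensor K A A (as ! 1) (as ! 0))))"
  have fl: "linear_map K V AA (\<lambda>v. f v \<odot>\<^bsub>AA\<^esub> z)" if "z \<in> carrier AA" for z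
    using that by (intro linear_mapI) (simp_all add: f AA.smult_l_distr AA.smult_assoc1)
  have g: "bimultilinear_map K A (Suc (Suc 0)) V (Suc (Suc (Suc 0))) AA g"
    unfolding bimultilinear_map_def
  proof (intro conjI ballI multilinear_mapI)
    fix as xs assume "as \<in> pow_words A (Suc (Suc 0))" and "xs \<in> pow_words V (Suc (Suc (Suc 0)))"
    then obtain a b x y z where as: "as = [a, b]" "a \<in> carrier A" "b \<in> carrier A"
      and xs: "xs = [x, y, z]" "x \<in> carrier V" "y \<in> carrier V" "z \<in> carrier V"
      by (auto simp: pow_words_def length_Suc_conv)
    have c: "pure_tensor K A A b a \<in> carrier AA" by (rule pure_tensor_closed[OF A A as(3,2)])
    show "g as xs \<in> carrier AA" using as xs c f(1) by (simp add: g_def)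
    then show "g as xs \<in> carrier AA" .
    show "linear_map K V AA (\<lambda>v. g as (xs[i := v]))" if "i < Suc (Suc (Suc 0))" for i
    proof -
      from that have "i = 0 \<or> i = 1 \<or> i = 2" by linarith
      then show ?thesis
        using as(2,3) xs(2-4) c f(1) unfolding as(1) xs(1) g_def
        by (elim disjE) (simp_all add: fl linear_map_scale[OF AA])
    qed
    show "linear_map K A AA (\<lambda>v. g (as[i := v]) xs)" if "i < Suc (Suc 0)" for i
    proof -
      from that have "i = 0 \<or> i = 1" by linarith
      then show ?thesis
        using as(2,3) xs(2-4) c f(1) unfolding as(1) xs(1) g_def
        by (elim disjE) (simp_all add: linear_map_scale[OF AA] linear_map_pure_left[OF A A linear_map_id(2)]
            linear_map_pure_right[OF A A linear_map_id(2)])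
    qed
  qed
  let ?h = "\<lambda>u r. pure_tensor K A AA r (word_lift K AA g (u (Suc (Suc (Suc 0)))))"
  have u3: "linear_map K T AA (\<lambda>u. word_lift K AA g (u (Suc (Suc (Suc 0)))))"
    by (rule linear_map_compose[OF linear_map_word_lift[OF A V AA g]],
        unfold TA_space_def cmp_Suc[symmetric], rule linear_map_component) simp
  have h: "bilinear_map K T A ?AAA ?h"
    by (intro bilinear_mapI linear_map_pure_left[OF A AA linear_map_id(2)] linear_map_pure_right[OF A AA u3]
        linear_map_closed[OF u3])
  let ?L = "tensor_lift K ?AAA ?h"
  have L: "linear_map K (tensor_space K T A) ?AAA ?L" by (rule linear_map_tensor_lift[OF T A AAA h])
  note G = F.linear_map_left_nested[OF letter_closed letter_closed letter_closed]
  have "?L (?G t) = t" if "t \<in> carrier ?AAA" for t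
  proof (rule tensor3_eqI[OF A A A AAA linear_map_compose[OF L G] linear_map_id(2) _ that])
    fix r s q assume rsq: "r \<in> carrier A" "s \<in> carrier A" "q \<in> carrier A"
    note qs = letter_words(6)[OF rsq(3,2)]
    have "?G (pure_tensor K A AA r (pure_tensor K A A s q)) = pure_tensor K T A (word [q, s] [w, w, w]) r"
      unfolding F.left_nested_pure[OF letter_closed letter_closed letter_closed rsq] mult_letters_left[OF rsq(3,2)] ..
    also have "?L \<dots> = pure_tensor K A AA r (g [q, s] [w, w, w])"
      unfolding tensor_lift_pure[OF T A AAA h word_closed[OF qs letter_words(3)] rsq(1)]
        word_component[OF qs letter_words(3)] word_lift_pure[OF A V AA g qs letter_words(3)] ..
    also have "g [q, s] [w, w, w] = pure_tensor K A A s q"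
      using rsq by (simp add: g_def f(4) pure_tensor_closed[OF A A])
    finally show "?L (?G (pure_tensor K A AA r (pure_tensor K A A s q))) = pure_tensor K A AA r (pure_tensor K A A s q)" .
  qed
  then show ?thesis using s t eq by metis
qed

end

text \<open>The relation between the two nested maps for the letter \<open>w\<close> holds on all of
  A \<otimes> A \<otimes> A. It turns associativity at \<open>t\<close> into the equality of
  \<open>left_nested\<close> at the two sides of the lEAS identity, and \<open>left_nested\<close>
  is cancelled by injectivity.\<close>

lemma assoc_imp_lEAS:
  assumes K: "field K" and nz: "carrier V \<noteq> {\<zero>\<^bsub>V\<^esub>}"
    and as: "assoc_algebra K (tensor_space K T A) (star_prod K A \<Phi> T (TA_prods K A V \<Phi>))"
  shows "lEAS K A \<Phi>"
proof -
  interpret V: module K V by (rule V)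
  interpret F: product_family K A T \<Phi> "TA_prods K A V \<Phi>" by (rule product_family_TA)
  obtain w where w: "w \<in> carrier V" "w \<noteq> \<zero>\<^bsub>V\<^esub>" using nz V.M.zero_closed by blast
  note lc = letter_closed[OF w(1)]
  note I = linear_map_closed[OF linear_map_id_tensor[OF A \<Phi>]]
    and J = linear_map_closed[OF linear_map_id_tensor[OF A linear_map_tensor_flip[OF A A]]]
    and S = linear_map_closed[OF linear_map_tensor_id[OF A \<Phi>]]
  have "id_tensor K A \<Phi> (tensor_id K A \<Phi> (id_tensor K A \<Phi> t)) =
      tensor_id K A \<Phi> (id_tensor K A (tensor_flip K A A) (tensor_id K A \<Phi> t))"
    if t: "t \<in> carrier (tensor_space K A AA)" for t
  proof (rule left_nested_letters_inj[OF w(1) K w(2) I[OF S[OF I[OF t]]] S[OF J[OF S[OF t]]]])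
    show "left_nested K A T (TA_prods K A V \<Phi>) (word [] [w]) (word [] [w]) (word [] [w])
        (id_tensor K A \<Phi> (tensor_id K A \<Phi> (id_tensor K A \<Phi> t))) =
      left_nested K A T (TA_prods K A V \<Phi>) (word [] [w]) (word [] [w]) (word [] [w])
        (tensor_id K A \<Phi> (id_tensor K A (tensor_flip K A A) (tensor_id K A \<Phi> t)))"
      by (rule trans[OF F.right_nested_eq_left_nested[OF lc lc lc mult_letters_right[OF w(1)] S[OF I[OF t]], symmetric]
            F.assoc_imp_nested_eq[OF as lc lc lc t]])
  qed
  then show ?thesis using A \<Phi> by (simp add: lEAS_def)
qed

end

theorem proposition3p6:
  fixes K :: "'k ring" and A :: "('k, 'a) module" and V :: "('k, 'v) module"
    and \<Phi> :: "('k, 'a, 'a) tensor \<Rightarrow> ('k, 'a, 'a) tensor"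
    and m :: "'a \<Rightarrow> ('k, 'v, 'v) tensor \<Rightarrow> 'v"
  assumes "field K" and "module K A" and "module K V"
    and "linear_map K (tensor_space K A A) (tensor_space K A A) \<Phi>"
    and "linear_map K A (Hom_space K (tensor_space K V V) V) m"
  shows
    "(lEAS K A \<Phi> \<and> phi_assoc_algebra K A \<Phi> V m \<longrightarrow>
        assoc_algebra K (tensor_space K V A) (star_prod K A \<Phi> V m)) \<and>
     (nondegenerate_lEAS K A \<Phi> \<and> assoc_algebra K (tensor_space K V A) (star_prod K A \<Phi> V m) \<longrightarrow>
        phi_assoc_algebra K A \<Phi> V m) \<and>
     (\<forall>W :: ('k, 'w) module.
        module K W \<and> carrier W \<noteq> {\<zero>\<^bsub>W\<^esub>} \<and>
        assoc_algebra K (tensor_space K (TA_space K A W) A)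
          (star_prod K A \<Phi> (TA_space K A W) (TA_prods K A W \<Phi>)) \<longrightarrow>
        lEAS K A \<Phi>)"
proof -
  interpret product_family K A V \<Phi> m by (rule product_family.intro) (rule assms)+
  \<comment> \<open>The space \<open>W\<close> has a type of its own, unrelated to \<open>V\<close>
    and \<open>m\<close>, so the third claim comes from the locale \<open>tensor_words\<close>
    instead of the interpretation above.\<close>
  have "lEAS K A \<Phi>" if "module K W" "carrier W \<noteq> {\<zero>\<^bsub>W\<^esub>}"
    "assoc_algebra K (tensor_space K (TA_space K A W) A)
      (star_prod K A \<Phi> (TA_space K A W) (TA_prods K A W \<Phi>))" for W :: "('k, 'w) module"
    by (rule tensor_words.assoc_imp_lEAS[OF tensor_words.intro[OF assms(2) that(1) assms(4)] assms(1) that(2,3)])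
  then show ?thesis
    using lEAS_imp_assoc_algebra nondegenerate_lEAS_imp_phi_assoc[OF assms(1)] by blast
qed

end
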